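(* Let $n\ge1$. The graded Frobenius characteristic of ${\mathcal A}_n'$, with ${\mathfrak S}_n$ acting by permuting the variables, is \[ \mathcal{F}rob_{{\mathfrak S}_n}({\mathcal A}'_n) = \sum_{d=0}^{n} \frac{q^d }{\{ q;q \}_d}\, h_{(n-d,1^{d})}[X(1-q)]. \]
   Context: ${\mathbb Q}\langle X_n\rangle={\mathbb Q}\langle x_1,\dots,x_n\rangle$ is the algebra of polynomials in noncommuting variables, graded by degree. ${\mathcal L}_n$ is the smallest subspace containing $x_1,\dots,x_n$ and closed under $[a,b]=ab-ba$; ${\mathcal L}_n'=[{\mathcal L}_n,{\mathcal L}_n]$; ${\mathcal A}_n'$ is the unital subalgebra of ${\mathbb Q}\langle X_n\rangle$ generated by ${\mathcal L}_n'$, a graded ${\mathfrak S}_n$-submodule. The graded Frobenius characteristic of $M=\bigoplus_kM_k$ is $\sum_k q^k\mathcal{F}rob(M_k)$. $h_{(n-d,1^d)}=h_{n-d}h_1^d$ and $\{q;q\}_d=\prod_{i=1}^d(1-iq)$. Plethystic notation: for a symmetric function $f$, $f[X(1-q)]$ is the image of $f$ under the algebra homomorphism sending the power sum $p_k$ to $(1-q^k)p_k$. *)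

theory Defs
  imports
    "HOL-Library.Multiset"
    "HOL-Library.Poly_Mapping"
    "HOL-Combinatorics.Permutations"
    "HOL-Combinatorics.Orbits"
    "HOL-Computational_Algebra.Formal_Power_Series"
begin

section \<open>Noncommutative polynomials\<close>

text \<open>
  The free monoid, written additively because the product of \<^typ>\<open>'a \<Rightarrow>\<^sub>0 'b\<close> is the convolution
  over a (not necessarily commutative) additive monoid \<^typ>\<open>'a\<close>.  The wrapper avoids a global
  instance for lists.
\<close>

datatype 'a ncword = NCWord (letters: "'a list")

instantiation ncword :: (type) monoid_add
begin

definition zero_ncword :: "'a ncword" where
  "zero_ncword = NCWord []"

definition plus_ncword :: "'a ncword \<Rightarrow> 'a ncword \<Rightarrow> 'a ncword" where
  "plus_ncword u v = NCWord (letters u @ letters v)"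

instance
  by standard (simp_all add: zero_ncword_def plus_ncword_def)

end

text \<open>
  Polynomials in noncommuting variables \<open>x\<^sub>i\<close> (\<open>i\<close> any natural number) over the rationals.
  The algebra on \<open>x\<^sub>1, \<dots>, x\<^sub>n\<close> is the subalgebra of polynomials in which only letters from
  \<open>{1..n}\<close> occur; the subspaces below all lie in it.
\<close>

type_synonym ncpoly = "nat ncword \<Rightarrow>\<^sub>0 rat"

definition nc_var :: "nat \<Rightarrow> ncpoly" where
  "nc_var i = Poly_Mapping.single (NCWord [i]) 1"

definition nc_scale :: "rat \<Rightarrow> ncpoly \<Rightarrow> ncpoly" where
  "nc_scale c f = Poly_Mapping.single 0 c * f"

context vector_space
begin

text \<open>
  Trace of the restriction of \<open>f\<close> to a finite-dimensional \<open>f\<close>-invariant subspace \<open>V\<close>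
  (it does not depend on the basis chosen).
\<close>

definition trace_on :: "'b set \<Rightarrow> ('b \<Rightarrow> 'b) \<Rightarrow> 'a" where
  "trace_on V f =
     (let B = (SOME B. B \<subseteq> V \<and> independent B \<and> span B = V)
      in \<Sum>b\<in>B. representation B (f b) b)"

end

global_interpretation nc: vector_space nc_scale
  defines nc_trace_on = nc.trace_on
proof
  fix a b :: rat and x y :: ncpoly
  show "nc_scale a (x + y) = nc_scale a x + nc_scale a y"
    by (simp add: nc_scale_def distrib_left)
  show "nc_scale (a + b) x = nc_scale a x + nc_scale b x"
    by (simp add: nc_scale_def single_add distrib_right)
  show "nc_scale a (nc_scale b x) = nc_scale (a * b) x"
    by (simp add: nc_scale_def mult.assoc [symmetric] mult_single)
  show "nc_scale 1 x = x"
    by (simp add: nc_scale_def)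
qed

definition nc_bracket :: "ncpoly \<Rightarrow> ncpoly \<Rightarrow> ncpoly" where
  "nc_bracket a b = a * b - b * a"

definition nc_lie :: "nat \<Rightarrow> ncpoly set" where
  "nc_lie n =
     (\<lambda>V. nc.subspace V \<and> (\<forall>a\<in>V. \<forall>b\<in>V. nc_bracket a b \<in> V)) hull (nc_var ` {1..n})"

text \<open>As usual, \<open>[L, L]\<close> is the linear span of all brackets.\<close>

definition nc_lie_derived :: "nat \<Rightarrow> ncpoly set" where
  "nc_lie_derived n = nc.span {nc_bracket a b | a b. a \<in> nc_lie n \<and> b \<in> nc_lie n}"

definition nc_A' :: "nat \<Rightarrow> ncpoly set" where
  "nc_A' n =
     (\<lambda>A. nc.subspace A \<and> 1 \<in> A \<and> (\<forall>a\<in>A. \<forall>b\<in>A. a * b \<in> A)) hull nc_lie_derived n"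

definition nc_graded_part :: "ncpoly set \<Rightarrow> nat \<Rightarrow> ncpoly set" where
  "nc_graded_part M k = {f \<in> M. \<forall>w\<in>Poly_Mapping.keys f. length (letters w) = k}"

definition nc_act :: "(nat \<Rightarrow> nat) \<Rightarrow> ncpoly \<Rightarrow> ncpoly" where
  "nc_act \<sigma> f =
     (\<Sum>w\<in>Poly_Mapping.keys f.
        Poly_Mapping.single (NCWord (map \<sigma> (letters w))) (Poly_Mapping.lookup f w))"

lemma nc_act_var: "nc_act \<sigma> (nc_var i) = nc_var (\<sigma> i)"
  by (simp add: nc_act_def nc_var_def)


section \<open>Symmetric functions\<close>

text \<open>
  A monomial in the commuting variables \<open>y\<^sub>0, y\<^sub>1, \<dots>\<close> is the multiset of its variable indices.
  A symmetric function is a formal power series (a function from monomials to coefficients) of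
  bounded degree that is invariant under all permutations of the variables.
\<close>

typedef (overloaded) 'a symf =
  "{f :: nat multiset \<Rightarrow> 'a::zero.
      (\<exists>N. \<forall>m. size m > N \<longrightarrow> f m = 0) \<and>
      (\<forall>\<pi> m. bij \<pi> \<longrightarrow> f (image_mset \<pi> m) = f m)}"
  morphisms symf_coeff Abs_symf
  by (rule exI [of _ "\<lambda>_. 0"]) simp

setup_lifting type_definition_symf

lemma finite_mset_splits: "finite {(a, b). a + b = (m :: 'a multiset)}"
proof (induction m)
  case empty
  have "{(a, b). a + b = ({#} :: 'a multiset)} = {({#}, {#})}"
    by auto
  then show ?case
    by simp
next
  case (add x m)
  let ?S = "{(a, b). a + b = m}"
  have "{(a, b). a + b = add_mset x m}
      \<subseteq> (\<lambda>(a, b). (add_mset x a, b)) ` ?S \<union> (\<lambda>(a, b). (a, add_mset x b)) ` ?S"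
  proof
    fix p assume "p \<in> {(a, b). a + b = add_mset x m}"
    then obtain a b where p: "p = (a, b)" and ab: "a + b = add_mset x m"
      by auto
    have "x \<in># a + b"
      by (simp add: ab)
    then consider "x \<in># a" | "x \<in># b"
      by auto
    then show "p \<in> (\<lambda>(a, b). (add_mset x a, b)) ` ?S \<union> (\<lambda>(a, b). (a, add_mset x b)) ` ?S"
    proof cases
      case 1
      then obtain a' where "a = add_mset x a'"
        by (meson mset_add)
      with p ab show ?thesis
        by (intro UnI1 image_eqI [of _ _ "(a', b)"]) auto
    next
      case 2
      then obtain b' where "b = add_mset x b'"
        by (meson mset_add)
      with p ab show ?thesis
        by (intro UnI2 image_eqI [of _ _ "(a, b')"]) auto
    qed
  qed
  then show ?case
    using add.IH by (meson finite_UnI finite_imageI finite_subset)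
qed

lemma sum_mset_splits_assoc:
  fixes F :: "nat multiset \<Rightarrow> nat multiset \<Rightarrow> nat multiset \<Rightarrow> 'a::comm_monoid_add"
  shows "(\<Sum>(d, c) | d + c = m. \<Sum>(a, b) | a + b = d. F a b c)
       = (\<Sum>(a, e) | a + e = m. \<Sum>(b, c) | b + c = e. F a b c)"
proof -
  have "(\<Sum>(d, c) | d + c = m. \<Sum>(a, b) | a + b = d. F a b c)
      = (\<Sum>p\<in>{(d, c). d + c = m}. \<Sum>r\<in>{(a, b). a + b = fst p}. F (fst r) (snd r) (snd p))"
    by (intro sum.cong) (auto simp: case_prod_beta)
  also have "\<dots> = (\<Sum>(p, r)\<in>Sigma {(d, c). d + c = m} (\<lambda>p. {(a, b). a + b = fst p}).
      F (fst r) (snd r) (snd p))"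
    by (rule sum.Sigma) (use finite_mset_splits in auto)
  also have "\<dots> = (\<Sum>(p, r)\<in>Sigma {(a, e). a + e = m} (\<lambda>p. {(b, c). b + c = snd p}).
      F (fst p) (fst r) (snd r))"
    by (rule sum.reindex_bij_witness
        [of _ "\<lambda>(p, r). ((fst p + fst r, snd r), (fst p, fst r))"
              "\<lambda>(p, r). ((fst r, snd r + snd p), (snd r, snd p))"])
      (auto simp: add_ac)
  also have "\<dots> = (\<Sum>p\<in>{(a, e). a + e = m}. \<Sum>r\<in>{(b, c). b + c = snd p}. F (fst p) (fst r) (snd r))"
    by (rule sum.Sigma [symmetric]) (use finite_mset_splits in auto)
  also have "\<dots> = (\<Sum>(a, e) | a + e = m. \<Sum>(b, c) | b + c = e. F a b c)"
    by (intro sum.cong) (auto simp: case_prod_beta)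
  finally show ?thesis .
qed

lemma image_mset_bij_splits:
  fixes g :: "nat multiset \<Rightarrow> nat multiset \<Rightarrow> 'a::comm_monoid_add" and \<pi> :: "nat \<Rightarrow> nat"
  assumes "bij \<pi>"
  shows "(\<Sum>(a, b) | a + b = image_mset \<pi> m. g a b)
       = (\<Sum>(a, b) | a + b = m. g (image_mset \<pi> a) (image_mset \<pi> b))"
proof -
  have 1: "image_mset (inv \<pi>) (image_mset \<pi> a) = a"
    and 2: "image_mset \<pi> (image_mset (inv \<pi>) a) = a" for a :: "nat multiset"
    using assms by (simp_all add: multiset.map_comp bij_is_inj bij_is_surj surj_iff [THEN iffD1]
        multiset.map_id0)
  let ?f = "\<lambda>(a, b). (image_mset \<pi> a, image_mset \<pi> b)"
  have img: "{(a, b). a + b = image_mset \<pi> m} = ?f ` {(a, b). a + b = m}" (is "?L = ?f ` ?R")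
  proof (intro equalityI subsetI)
    fix p assume "p \<in> ?L"
    then obtain a b where p: "p = (a, b)" and ab: "image_mset \<pi> m = a + b"
      by auto
    have "image_mset (inv \<pi>) a + image_mset (inv \<pi>) b = m"
      using 1 [of m] unfolding ab by simp
    then show "p \<in> ?f ` ?R"
      by (intro image_eqI [of _ _ "(image_mset (inv \<pi>) a, image_mset (inv \<pi>) b)"])
        (simp_all add: p 2)
  next
    fix p assume "p \<in> ?f ` ?R"
    then show "p \<in> ?L"
      by (auto simp flip: image_mset_union)
  qed
  have "inj_on ?f ?R"
    by (rule inj_on_inverseI [of _ "\<lambda>(a, b). (image_mset (inv \<pi>) a, image_mset (inv \<pi>) b)"])
      (auto simp only: 1 prod.case split: prod.splits)
  then show ?thesis
    unfolding img by (subst sum.reindex) (simp_all add: case_prod_beta)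
qed

instantiation symf :: (comm_ring_1) comm_ring_1
begin

lift_definition zero_symf :: "'a symf" is "\<lambda>_. 0"
  by simp

lift_definition one_symf :: "'a symf" is "\<lambda>m. if m = {#} then 1 else 0"
  by (auto intro!: exI [of _ 0])

lift_definition plus_symf :: "'a symf \<Rightarrow> 'a symf \<Rightarrow> 'a symf" is "\<lambda>f g m. f m + g m"
proof -
  fix f g :: "nat multiset \<Rightarrow> 'a"
  assume f: "(\<exists>N. \<forall>m. size m > N \<longrightarrow> f m = 0) \<and> (\<forall>\<pi> m. bij \<pi> \<longrightarrow> f (image_mset \<pi> m) = f m)"
    and g: "(\<exists>N. \<forall>m. size m > N \<longrightarrow> g m = 0) \<and> (\<forall>\<pi> m. bij \<pi> \<longrightarrow> g (image_mset \<pi> m) = g m)"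
  then obtain N N' where "\<forall>m. size m > N \<longrightarrow> f m = 0" "\<forall>m. size m > N' \<longrightarrow> g m = 0"
    by blast
  then have "\<forall>m. size m > max N N' \<longrightarrow> f m + g m = 0"
    by simp
  with f g show "(\<exists>N. \<forall>m. size m > N \<longrightarrow> f m + g m = 0) \<and>
      (\<forall>\<pi> m. bij \<pi> \<longrightarrow> f (image_mset \<pi> m) + g (image_mset \<pi> m) = f m + g m)"
    by (intro conjI exI [of _ "max N N'"]) auto
qed

lift_definition uminus_symf :: "'a symf \<Rightarrow> 'a symf" is "\<lambda>f m. - f m"
  by simp

definition minus_symf :: "'a symf \<Rightarrow> 'a symf \<Rightarrow> 'a symf" where
  "minus_symf f g = f + - g"

lift_definition times_symf :: "'a symf \<Rightarrow> 'a symf \<Rightarrow> 'a symf"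
  is "\<lambda>f g m. \<Sum>(a, b) | a + b = m. f a * g b"
proof -
  fix f g :: "nat multiset \<Rightarrow> 'a"
  assume f: "(\<exists>N. \<forall>m. size m > N \<longrightarrow> f m = 0) \<and> (\<forall>\<pi> m. bij \<pi> \<longrightarrow> f (image_mset \<pi> m) = f m)"
    and g: "(\<exists>N. \<forall>m. size m > N \<longrightarrow> g m = 0) \<and> (\<forall>\<pi> m. bij \<pi> \<longrightarrow> g (image_mset \<pi> m) = g m)"
  then obtain N N' where N: "\<And>m. size m > N \<Longrightarrow> f m = 0" "\<And>m. size m > N' \<Longrightarrow> g m = 0"
    by blast
  have "(\<Sum>(a, b) | a + b = m. f a * g b) = 0" if m: "size m > N + N'" for m
  proof (rule sum.neutral, safe)
    fix a b assume "m = a + b"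
    with m have "size a > N \<or> size b > N'"
      by auto
    with N show "f a * g b = 0"
      by auto
  qed
  moreover have "(\<Sum>(a, b) | a + b = image_mset \<pi> m. f a * g b) = (\<Sum>(a, b) | a + b = m. f a * g b)"
    if "bij \<pi>" for \<pi> m
    using image_mset_bij_splits [OF that, of "\<lambda>a b. f a * g b" m] that f g by simp
  ultimately show "(\<exists>N. \<forall>m. size m > N \<longrightarrow> (\<Sum>(a, b) | a + b = m. f a * g b) = 0) \<and>
      (\<forall>\<pi> m. bij \<pi> \<longrightarrow>
        (\<Sum>(a, b) | a + b = image_mset \<pi> m. f a * g b) = (\<Sum>(a, b) | a + b = m. f a * g b))"
    by blast
qed

instance
proof
  fix f g h :: "'a symf"
  show "f + g + h = f + (g + h)"
    by transfer (simp add: add.assoc)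
  show "f + g = g + f"
    by transfer (simp add: add.commute)
  show "0 + f = f"
    by transfer simp
  show "- f + f = 0"
    by transfer simp
  show "f - g = f + - g"
    by (simp add: minus_symf_def)
  show "f * g * h = f * (g * h)"
  proof (transfer, rule ext)
    fix f g h :: "nat multiset \<Rightarrow> 'a" and m
    show "(\<Sum>(d, c) | d + c = m. (\<Sum>(a, b) | a + b = d. f a * g b) * h c)
        = (\<Sum>(a, e) | a + e = m. f a * (\<Sum>(b, c) | b + c = e. g b * h c))"
      using sum_mset_splits_assoc [of "\<lambda>a b c. f a * g b * h c" m]
      by (simp add: sum_distrib_left sum_distrib_right case_prod_beta mult.assoc)
  qed
  show "f * g = g * f"
  proof (transfer, rule ext)
    fix f g :: "nat multiset \<Rightarrow> 'a" and m
    show "(\<Sum>(a, b) | a + b = m. f a * g b) = (\<Sum>(a, b) | a + b = m. g a * f b)"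
      by (rule sum.reindex_bij_witness [of _ prod.swap prod.swap])
        (auto simp: add.commute mult.commute)
  qed
  show "1 * f = f"
  proof (transfer, rule ext)
    fix f :: "nat multiset \<Rightarrow> 'a" and m
    have "(\<Sum>(a, b) | a + b = m. (if a = {#} then 1 else 0) * f b)
        = (\<Sum>(a, b)\<in>{({#} :: nat multiset, m)}. (if a = {#} then 1 else 0) * f b)"
      by (intro sum.mono_neutral_right finite_mset_splits) (auto split: if_splits)
    then show "(\<Sum>(a, b) | a + b = m. (if a = {#} then 1 else 0) * f b) = f m"
      by simp
  qed
  show "(f + g) * h = f * h + g * h"
    by transfer (simp add: distrib_right sum.distrib case_prod_beta)
  show "(0 :: 'a symf) \<noteq> 1"
    by transfer (auto simp: fun_eq_iff)
qed

end

lift_definition symf_scale :: "'a::comm_ring_1 \<Rightarrow> 'a symf \<Rightarrow> 'a symf" is "\<lambda>c f m. c * f m"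
  by (metis mult_zero_right)

text \<open>Complete homogeneous symmetric function: the sum of all monomials of degree \<open>k\<close>.\<close>

lift_definition symf_h :: "nat \<Rightarrow> 'a::comm_ring_1 symf" is "\<lambda>k m. if size m = k then 1 else 0"
  by auto

text \<open>
  Power sum: the sum of all \<open>y\<^sub>i\<^sup>k\<close>.  Only \<open>k > 0\<close> is meaningful; this formula gives \<open>1\<close> for \<open>k = 0\<close>.
\<close>

lift_definition symf_p :: "nat \<Rightarrow> 'a::comm_ring_1 symf"
  is "\<lambda>k m. if \<exists>i. m = replicate_mset k i then 1 else 0"
proof -
  fix k :: nat
  have inv: "(\<exists>i. image_mset \<pi> m = replicate_mset k i) \<longleftrightarrow> (\<exists>i. m = replicate_mset k i)"
    if "bij \<pi>" for \<pi> :: "nat \<Rightarrow> nat" and m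
  proof
    assume "\<exists>i. image_mset \<pi> m = replicate_mset k i"
    then obtain i where "image_mset \<pi> m = replicate_mset k i" ..
    then have "image_mset (inv \<pi>) (image_mset \<pi> m) = replicate_mset k (inv \<pi> i)"
      by simp
    then show "\<exists>i. m = replicate_mset k i"
      using that by (auto simp: multiset.map_comp bij_is_inj multiset.map_id0)
  next
    assume "\<exists>i. m = replicate_mset k i"
    then show "\<exists>i. image_mset \<pi> m = replicate_mset k i"
      by auto
  qed
  have bound: "(if \<exists>i. m = replicate_mset k i then 1 else 0) = (0 :: 'a)"
    if "size m > k" for m :: "nat multiset"
    using that by auto
  show "(\<exists>N. \<forall>m :: nat multiset. size m > N \<longrightarrow>
        (if \<exists>i. m = replicate_mset k i then 1 else 0) = (0 :: 'a)) \<and>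
      (\<forall>(\<pi> :: nat \<Rightarrow> nat) m. bij \<pi> \<longrightarrow>
        (if \<exists>i. image_mset \<pi> m = replicate_mset k i then 1 else 0)
        = (if \<exists>i. m = replicate_mset k i then 1 else (0 :: 'a)))"
    by (intro conjI exI [of _ k] allI impI) (simp_all only: inv bound)
qed

text \<open>
  \<open>f[X(1 - q)]\<close>, with coefficients in the formal power series ring in \<open>q\<close>.  The power sums
  are algebraically independent generators of the algebra of symmetric functions (the rationals
  being contained in the coefficient ring), so there is exactly one such homomorphism.
\<close>

definition is_symf_alg_hom :: "('a::comm_ring_1 symf \<Rightarrow> 'a symf) \<Rightarrow> bool" where
  "is_symf_alg_hom \<phi> \<longleftrightarrow>
     \<phi> 1 = 1 \<and>
     (\<forall>f g. \<phi> (f + g) = \<phi> f + \<phi> g) \<and>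
     (\<forall>f g. \<phi> (f * g) = \<phi> f * \<phi> g) \<and>
     (\<forall>c f. \<phi> (symf_scale c f) = symf_scale c (\<phi> f))"

definition plethysm_1_minus_q :: "rat fps symf \<Rightarrow> rat fps symf" where
  "plethysm_1_minus_q =
     (THE \<phi>. is_symf_alg_hom \<phi> \<and> (\<forall>k>0. \<phi> (symf_p k) = symf_scale (1 - fps_X ^ k) (symf_p k)))"


section \<open>Frobenius characteristic\<close>

text \<open>
  \<open>p\<^sub>\<lambda>\<close> for \<open>\<lambda>\<close> the cycle type of a permutation of \<open>{1..n}\<close>; the orbits include the
  fixed points as singletons.
\<close>

definition cycle_power_sum :: "nat \<Rightarrow> (nat \<Rightarrow> nat) \<Rightarrow> 'a::comm_ring_1 symf" where
  "cycle_power_sum n \<sigma> = (\<Prod>C\<in>orbit \<sigma> ` {1..n}. symf_p (card C))"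

text \<open>
  \<open>1/n! \<Sum>\<^sub>\<sigma> \<chi>(\<sigma>) p\<^bsub>type(\<sigma>)\<^esub>\<close> for the character \<open>\<chi>\<close> of a finite-dimensional invariant subspace.
\<close>

definition nc_frob :: "nat \<Rightarrow> ncpoly set \<Rightarrow> rat symf" where
  "nc_frob n V =
     symf_scale (1 / fact n)
       (\<Sum>\<sigma> | \<sigma> permutes {1..n}. symf_scale (nc_trace_on V (nc_act \<sigma>)) (cycle_power_sum n \<sigma>))"

text \<open>
  \<open>\<Sum>\<^sub>k q\<^sup>k F\<^sub>k\<close> for symmetric functions \<open>F\<^sub>k\<close> of uniformly bounded degree.
\<close>

lift_definition symf_q_series :: "(nat \<Rightarrow> rat symf) \<Rightarrow> rat fps symf"
  is "\<lambda>F m. if \<exists>N. \<forall>k m. size m > N \<longrightarrow> F k m = 0 then Abs_fps (\<lambda>k. F k m) else 0"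
proof -
  fix F :: "nat \<Rightarrow> nat multiset \<Rightarrow> rat"
  assume F: "\<And>k. (\<exists>N. \<forall>m. size m > N \<longrightarrow> F k m = 0) \<and>
    (\<forall>\<pi> m. bij \<pi> \<longrightarrow> F k (image_mset \<pi> m) = F k m)"
  define B where "B \<longleftrightarrow> (\<exists>N. \<forall>k m. size m > N \<longrightarrow> F k m = 0)"
  have "\<exists>N. \<forall>m. size m > N \<longrightarrow> (if B then Abs_fps (\<lambda>k. F k m) else 0) = 0"
  proof (cases B)
    case True
    then obtain N where "\<And>k m. size m > N \<Longrightarrow> F k m = 0"
      unfolding B_def by blast
    then show ?thesis
      by (intro exI [of _ N]) (simp add: fps_eq_iff)
  qed simp
  moreover have "F k (image_mset \<pi> m) = F k m" if "bij \<pi>" for k \<pi> m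
    using F [of k] that by blast
  ultimately show "(\<exists>N. \<forall>m. size m > N \<longrightarrow>
        (if \<exists>N. \<forall>k m. size m > N \<longrightarrow> F k m = 0 then Abs_fps (\<lambda>k. F k m) else 0) = 0) \<and>
      (\<forall>\<pi> m. bij \<pi> \<longrightarrow>
        (if \<exists>N. \<forall>k m. size m > N \<longrightarrow> F k m = 0 then Abs_fps (\<lambda>k. F k (image_mset \<pi> m)) else 0)
        = (if \<exists>N. \<forall>k m. size m > N \<longrightarrow> F k m = 0 then Abs_fps (\<lambda>k. F k m) else 0))"
    unfolding B_def [symmetric] by simp
qed

definition nc_graded_frob :: "nat \<Rightarrow> ncpoly set \<Rightarrow> rat fps symf" where
  "nc_graded_frob n M = symf_q_series (\<lambda>k. nc_frob n (nc_graded_part M k))"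

lemma symf_coeff_sum: "symf_coeff (sum f S) m = (\<Sum>x\<in>S. symf_coeff (f x) m)"
  by (induction S rule: infinite_finite_induct)
    (simp_all add: zero_symf.rep_eq plus_symf.rep_eq)

text \<open>The degrees are indeed uniformly bounded.\<close>

lemma nc_graded_frob_coeff:
  "fps_nth (symf_coeff (nc_graded_frob n M) m) k = symf_coeff (nc_frob n (nc_graded_part M k)) m"
proof -
  let ?P = "{\<sigma>. \<sigma> permutes {1..n}}"
  have fin: "finite ?P"
    by (simp add: finite_permutations)
  have "\<exists>N. \<forall>m. size m > N \<longrightarrow> symf_coeff (cycle_power_sum n \<sigma> :: rat symf) m = 0" for \<sigma>
    using symf_coeff [of "cycle_power_sum n \<sigma> :: rat symf"] by blast
  then obtain N where N:
    "\<And>\<sigma> m. size m > N \<sigma> \<Longrightarrow> symf_coeff (cycle_power_sum n \<sigma> :: rat symf) m = 0"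
    by metis
  have "symf_coeff (nc_frob n V) m = 0" if m: "size m > (\<Sum>\<sigma>\<in>?P. N \<sigma>)" for V m
  proof -
    have "symf_coeff (cycle_power_sum n \<sigma> :: rat symf) m = 0" if "\<sigma> \<in> ?P" for \<sigma>
      using member_le_sum [OF that, of N] fin m by (intro N) auto
    then show ?thesis
      by (simp add: nc_frob_def symf_scale.rep_eq symf_coeff_sum)
  qed
  then have "\<exists>N. \<forall>k m. size m > N \<longrightarrow> symf_coeff (nc_frob n (nc_graded_part M k)) m = 0"
    by blast
  then show ?thesis
    by (simp add: nc_graded_frob_def symf_q_series.rep_eq)
qed

text \<open>\<open>{q;q}\<^sub>d\<close>: constant coefficient 1, so division by it takes place in the power series ring.\<close>

definition q_bracket :: "nat \<Rightarrow> rat fps" where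
  "q_bracket d = (\<Prod>i=1..d. 1 - of_nat i * fps_X)"

end

theory Submission
  imports Defs "HOL-Combinatorics.Multiset_Permutations"
begin

text \<open>
  The symmetrisations \<open>s\<^sub>m\<close> of the commutative monomials \<open>m\<close> form a basis of the free algebra as a
  right \<open>\<A>'\<close>-module.  They span because exchanging two neighbouring letters costs a commutator,
  and \<open>\<A>'\<close> is stable under \<open>[\<cdot>, x\<^sub>i]\<close>; they are independent because the partial derivatives
  \<open>\<partial>\<^sub>i\<close> vanish on \<open>\<A>'\<close> and act on the \<open>s\<^sub>m\<close> as on commutative monomials.  The symmetric group
  permutes the \<open>s\<^sub>m\<close>, so comparing traces on all words of length \<open>k\<close> shows that \<open>\<sigma>\<close> has graded trace
  \<open>(\<Prod>\<^sub>C (1 - q\<^bsup>|C|\<^esup>)) / (1 - q fix(\<sigma>))\<close> on \<open>\<A>'\<close>, with \<open>C\<close> ranging over the cycles of \<open>\<sigma>\<close>.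
  The product is what the plethysm does to \<open>p\<^bsub>type(\<sigma>)\<^esub>\<close>.  Finally
  \<open>1 / (1 - qf) = \<Sum>\<^sub>d f(f-1)\<cdots>(f-d+1) q\<^sup>d / {q;q}\<^sub>d\<close>, and weighting \<open>p\<^bsub>type(\<sigma>)\<^esub>\<close> by the falling
  factorial of \<open>fix(\<sigma>)\<close> and summing over \<open>\<sigma>\<close> gives \<open>n! h\<^bsub>n-d\<^esub> h\<^sub>1\<^sup>d\<close>.
\<close>

section \<open>Traces\<close>

text \<open>No basis of the homogeneous parts of \<open>nc_A' n\<close> is ever written down.
  Arbitrary bases of them are combined with the symmetrised monomials into bases of all words of a
  given length; there a permutation moves blocks, so the unknown traces enter only through the
  blocks that it fixes, and the resulting convolution can be divided out as a power series with
  constant term 1. The denominators come from set partitions: with S(k,d) the Stirling numbers of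
  the second kind, f^k is the sum over d of S(k,d) times the falling factorial of f of length d, and
  the generating function of S(k,d) in k is q^d over \<open>q_bracket d\<close>. The sum stops at n
  because a permutation has at most n fixed points. The plethysm is given by a definite description,
  so it must be shown to exist and to be unique before it can be evaluated; this is why the power
  sums have to be proved a basis over the power series ring.\<close>

context vector_space
begin

text \<open>Expanding \<open>f b\<close> in \<open>C\<close> and taking coordinates in
  \<open>B\<close> turns the left trace into a double sum over \<open>B\<close> and
  \<open>C\<close>; expanding \<open>c\<close> in \<open>B\<close> before applying \<open>f\<close>
  gives the same double sum for the right one. This removes the dependence on the
  \<open>SOME\<close> in \<open>trace_on\<close>.\<close>

lemma trace_basis_change:
  assumes B: "finite B" "independent B" "span B = V"
    and C: "finite C" "independent C" "span C = V"
    and f: "Vector_Spaces.linear scale scale f" "\<And>v. v \<in> V \<Longrightarrow> f v \<in> V"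
  shows "(\<Sum>b\<in>B. representation B (f b) b) = (\<Sum>c\<in>C. representation C (f c) c)"
proof -
  interpret f: Vector_Spaces.linear scale scale f
    by (fact f(1))
  have BV: "b \<in> V" if "b \<in> B" for b
    using that B span_base by blast
  have CV: "c \<in> V" if "c \<in> C" for c
    using that C span_base by blast
  have 1: "representation B (f b) b = (\<Sum>c\<in>C. representation C (f b) c * representation B c b)"
    if "b \<in> B" for b
  proof -
    have "f b = (\<Sum>c\<in>C. scale (representation C (f b) c) c)"
      using sum_representation_eq [of C "f b" C] C f(2) [OF BV [OF that]] by simp
    then have "representation B (f b) b
        = representation B (\<Sum>c\<in>C. scale (representation C (f b) c) c) b"
      by simp
    also have "\<dots> = (\<Sum>c\<in>C. representation C (f b) c * representation B c b)"
      using B CV by (subst representation_sum) (auto simp: representation_scale span_scale)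
    finally show ?thesis .
  qed
  have 2: "representation C (f c) c = (\<Sum>b\<in>B. representation B c b * representation C (f b) c)"
    if "c \<in> C" for c
  proof -
    have "c = (\<Sum>b\<in>B. scale (representation B c b) b)"
      using sum_representation_eq [of B c B] B CV [OF that] by simp
    then have "f c = f (\<Sum>b\<in>B. scale (representation B c b) b)"
      by (rule arg_cong)
    also have "\<dots> = (\<Sum>b\<in>B. scale (representation B c b) (f b))"
      by (simp add: f.sum f.scale)
    finally have "representation C (f c) c
        = representation C (\<Sum>b\<in>B. scale (representation B c b) (f b)) c"
      by simp
    also have "\<dots> = (\<Sum>b\<in>B. representation B c b * representation C (f b) c)"
      using C BV f(2) by (subst representation_sum) (auto simp: representation_scale span_scale)
    finally show ?thesis .
  qed
  show ?thesis
    by (simp add: 1 2 sum.swap [of _ C] mult.commute cong: sum.cong)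
qed

lemma trace_on_basis:
  assumes C: "finite C" "independent C" "span C = V"
    and f: "Vector_Spaces.linear scale scale f" "\<And>v. v \<in> V \<Longrightarrow> f v \<in> V"
  shows "trace_on V f = (\<Sum>c\<in>C. representation C (f c) c)"
proof -
  define B where "B = (SOME B. B \<subseteq> V \<and> independent B \<and> span B = V)"
  have "B \<subseteq> V \<and> independent B \<and> span B = V"
    unfolding B_def by (rule someI [of _ C]) (use C span_superset in auto)
  moreover from this have "finite B"
    using independent_span_bound [of C B] C by auto
  ultimately show ?thesis
    unfolding trace_on_def B_def [symmetric] Let_def
    by (intro trace_basis_change [OF _ _ _ C f]) auto
qed

text \<open>Indexed families suit words and pairs better than sets of vectors; injectivity comes
  along because a repeated vector is itself a linear relation.\<close>

lemma family_independent:
  assumes I: "finite I" and ind: "\<And>c. (\<Sum>i\<in>I. scale (c i) (e i)) = 0 \<Longrightarrow> \<forall>i\<in>I. c i = 0"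
  shows "inj_on e I" "independent (e ` I)"
proof -
  show inj: "inj_on e I"
  proof (rule inj_onI, rule ccontr)
    fix i j assume ij: "i \<in> I" "j \<in> I" "e i = e j" "i \<noteq> j"
    let ?c = "\<lambda>k. (if k = i then 1 else 0) - (if k = j then 1 else 0)"
    have "(\<Sum>k\<in>I. scale (?c k) (e k)) = 0"
      using ij I by (simp add: scale_left_diff_distrib sum_subtractf if_distrib [of "\<lambda>x. scale x _"]
          cong: if_cong)
    from ind [OF this] ij show False
      by force
  qed
  show "independent (e ` I)"
  proof (rule independent_if_scalars_zero)
    fix g x assume "(\<Sum>x\<in>e ` I. scale (g x) x) = 0" "x \<in> e ` I"
    then show "g x = 0"
      using ind [of "g \<circ> e"] by (auto simp: sum.reindex [OF inj])
  qed (use I in simp)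
qed

text \<open>\<open>M\<close> is the matrix of \<open>f\<close>. Invariance of \<open>V\<close> is
  derived from it, so a trace can be computed from the action on the family alone.\<close>

lemma trace_on_family:
  assumes I: "finite I" and V: "span (e ` I) = V"
    and ind: "\<And>c. (\<Sum>i\<in>I. scale (c i) (e i)) = 0 \<Longrightarrow> \<forall>i\<in>I. c i = 0"
    and lin: "Vector_Spaces.linear scale scale f"
    and f: "\<And>i. i \<in> I \<Longrightarrow> f (e i) = (\<Sum>j\<in>I. scale (M j i) (e j))"
  shows "trace_on V f = (\<Sum>i\<in>I. M i i)"
proof -
  interpret f: Vector_Spaces.linear scale scale f
    by (fact lin)
  have inj: "inj_on e I"
    by (rule family_independent(1) [OF I]) (rule ind)
  have indep: "independent (e ` I)"
    by (rule family_independent(2) [OF I]) (rule ind)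
  have eV: "e i \<in> span (e ` I)" if "i \<in> I" for i
    using that by (simp add: span_base)
  have inv: "f v \<in> V" if "v \<in> V" for v
  proof -
    from that have "v \<in> span (e ` I)"
      by (simp add: V)
    then show "f v \<in> V"
      unfolding V [symmetric]
    proof (induction rule: span_induct_alt)
      case base
      then show ?case
        by (simp add: f.zero span_zero)
    next
      case (step c x y)
      then obtain i where "i \<in> I" "x = e i"
        by auto
      then have "f x \<in> span (e ` I)"
        by (auto simp: f intro!: span_sum span_scale eV)
      with step show ?case
        by (simp add: f.add f.scale span_add span_scale)
    qed
  qed
  have "trace_on V f = (\<Sum>i\<in>I. representation (e ` I) (f (e i)) (e i))"
    using I inv by (simp add: trace_on_basis [OF _ indep V lin] sum.reindex [OF inj])
  also have "\<dots> = (\<Sum>i\<in>I. M i i)"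
  proof (intro sum.cong refl)
    fix i assume i: "i \<in> I"
    have "representation (e ` I) (f (e i)) (e i)
        = (\<Sum>j\<in>I. M j i * representation (e ` I) (e j) (e i))"
      unfolding f [OF i] using indep eV
      by (subst representation_sum) (simp_all add: representation_scale span_scale)
    also have "\<dots> = (\<Sum>j\<in>I. if j = i then M j i else 0)"
    proof (intro sum.cong refl)
      fix j assume "j \<in> I"
      then have "representation (e ` I) (e j) (e i) = (if j = i then 1 else 0)"
        using inj_on_eq_iff [OF inj i, of j] by (subst representation_basis [OF indep]) auto
      then show "M j i * representation (e ` I) (e j) (e i) = (if j = i then M j i else 0)"
        by simp
    qed
    also have "\<dots> = M i i"
      using I i by simp
    finally show "representation (e ` I) (f (e i)) (e i) = M i i" .
  qed
  finally show ?thesis .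
qed

end

section \<open>Noncommutative polynomials\<close>

definition nc_mono :: "nat list \<Rightarrow> ncpoly" where
  "nc_mono w = Poly_Mapping.single (NCWord w) 1"

lemma nc_mono_mult: "nc_mono u * nc_mono v = nc_mono (u @ v)"
  by (simp add: nc_mono_def mult_single plus_ncword_def)

lemma nc_mono_Nil: "nc_mono [] = 1"
  unfolding nc_mono_def zero_ncword_def [symmetric] by (rule single_one)

lemma nc_var_conv_mono: "nc_var i = nc_mono [i]"
  by (simp add: nc_var_def nc_mono_def)

lemma nc_scale_single: "nc_scale c (Poly_Mapping.single k a) = Poly_Mapping.single k (c * a)"
  by (simp add: nc_scale_def mult_single)

lemma single_conv_mono: "Poly_Mapping.single k c = nc_scale c (nc_mono (letters k))"
  by (simp add: nc_mono_def nc_scale_single)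

lemma nc_expand: "f = (\<Sum>w\<in>Poly_Mapping.keys f. nc_scale (Poly_Mapping.lookup f w) (nc_mono (letters w)))"
proof (rule poly_mapping_eqI)
  fix k
  have "(\<Sum>w\<in>Poly_Mapping.keys f. Poly_Mapping.lookup f w when w = k) = Poly_Mapping.lookup f k"
    by (simp add: when_def in_keys_iff)
  then show "Poly_Mapping.lookup f k = Poly_Mapping.lookup (\<Sum>w\<in>Poly_Mapping.keys f. nc_scale (Poly_Mapping.lookup f w) (nc_mono (letters w))) k"
    unfolding single_conv_mono [symmetric] by (simp add: lookup_sum lookup_single)
qed

lemma nc_scale_mult_left: "nc_scale c f * g = nc_scale c (f * g)"
  by (simp add: nc_scale_def mult.assoc)

lemma nc_scale_mult_right: "f * nc_scale c g = nc_scale c (f * g)"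
proof -
  have "Poly_Mapping.single k a * Poly_Mapping.single 0 c
      = Poly_Mapping.single 0 c * Poly_Mapping.single k a"
    for k :: "nat ncword" and a
    by (simp add: mult_single mult.commute)
  then have "f * Poly_Mapping.single 0 c = Poly_Mapping.single 0 c * f"
    by (subst (1 2) nc_expand [of f])
      (simp add: sum_distrib_left sum_distrib_right single_conv_mono [symmetric])
  then show ?thesis
    by (simp add: nc_scale_def flip: mult.assoc)
qed
lemmas nc_scale_mult = nc_scale_mult_left nc_scale_mult_right

lemma nc_linearI:
  assumes "\<And>f g. F (f + g) = F f + F g" "\<And>c f. F (nc_scale c f) = nc_scale c (F f)"
  shows "Vector_Spaces.linear nc_scale nc_scale F"
  using assms by (simp add: Vector_Spaces.linear_iff nc.vector_space_axioms)

text \<open>The words are a basis. Product rules are checked below by applying this once in each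
  factor.\<close>

lemma nc_linear_eqI:
  assumes "Vector_Spaces.linear nc_scale nc_scale F" "Vector_Spaces.linear nc_scale nc_scale G"
    and "\<And>w. F (nc_mono w) = G (nc_mono w)"
  shows "F f = G f"
proof -
  interpret F: Vector_Spaces.linear nc_scale nc_scale F by fact
  interpret G: Vector_Spaces.linear nc_scale nc_scale G by fact
  show ?thesis
    by (subst (1 2) nc_expand [of f]) (simp add: F.sum G.sum F.scale G.scale assms)
qed

section \<open>Linear extension from words, and the permutation action\<close>

definition nc_ext :: "(nat list \<Rightarrow> ncpoly) \<Rightarrow> ncpoly \<Rightarrow> ncpoly" where
  "nc_ext \<phi> f = (\<Sum>w\<in>Poly_Mapping.keys f. nc_scale (Poly_Mapping.lookup f w) (\<phi> (letters w)))"

text \<open>Supports shrink under cancellation; summing over a common finite superset makes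
  additivity of \<open>nc_ext\<close> a termwise statement.\<close>

lemma nc_ext_superset:
  assumes "finite K" "Poly_Mapping.keys f \<subseteq> K"
  shows "nc_ext \<phi> f = (\<Sum>w\<in>K. nc_scale (Poly_Mapping.lookup f w) (\<phi> (letters w)))"
  unfolding nc_ext_def using assms
  by (intro sum.mono_neutral_left) (auto simp: in_keys_iff)

lemma nc_ext_mono [simp]: "nc_ext \<phi> (nc_mono w) = \<phi> w"
  by (simp add: nc_ext_def nc_mono_def)

lemma lookup_nc_scale: "Poly_Mapping.lookup (nc_scale c f) w = c * Poly_Mapping.lookup f w"
  by (simp add: nc_scale_def mult_map_scale_conv_mult [symmetric] Poly_Mapping.map.rep_eq when_def)
lemma linear_nc_ext: "Vector_Spaces.linear nc_scale nc_scale (nc_ext \<phi>)"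
proof (rule nc_linearI)
  fix f g :: ncpoly and c :: rat
  let ?K = "Poly_Mapping.keys f \<union> Poly_Mapping.keys g"
  have K: "finite ?K"
    by simp
  have 1: "nc_ext \<phi> (f + g)
      = (\<Sum>w\<in>?K. nc_scale (Poly_Mapping.lookup (f + g) w) (\<phi> (letters w)))"
    using Poly_Mapping.keys_add [of f g] by (intro nc_ext_superset K)
  have 2: "nc_ext \<phi> f = (\<Sum>w\<in>?K. nc_scale (Poly_Mapping.lookup f w) (\<phi> (letters w)))"
    by (intro nc_ext_superset K) simp
  have 3: "nc_ext \<phi> g = (\<Sum>w\<in>?K. nc_scale (Poly_Mapping.lookup g w) (\<phi> (letters w)))"
    by (intro nc_ext_superset K) simp
  show "nc_ext \<phi> (f + g) = nc_ext \<phi> f + nc_ext \<phi> g"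
    unfolding 1 2 3 by (simp only: lookup_add nc.scale_left_distrib sum.distrib)
  have "Poly_Mapping.keys (nc_scale c f) \<subseteq> Poly_Mapping.keys f"
    by (auto simp: in_keys_iff lookup_nc_scale)
  then have "nc_ext \<phi> (nc_scale c f)
      = (\<Sum>w\<in>Poly_Mapping.keys f. nc_scale (Poly_Mapping.lookup (nc_scale c f) w) (\<phi> (letters w)))"
    by (intro nc_ext_superset) simp_all
  then show "nc_ext \<phi> (nc_scale c f) = nc_scale c (nc_ext \<phi> f)"
    by (simp add: lookup_nc_scale nc_ext_def nc.scale_sum_right)
qed

lemma nc_act_conv_ext: "nc_act \<sigma> = nc_ext (\<lambda>w. nc_mono (map \<sigma> w))"
  by (simp add: fun_eq_iff nc_act_def nc_ext_def nc_mono_def nc_scale_single)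

lemma linear_nc_act: "Vector_Spaces.linear nc_scale nc_scale (nc_act \<sigma>)"
  unfolding nc_act_conv_ext by (rule linear_nc_ext)

lemma nc_act_mono [simp]: "nc_act \<sigma> (nc_mono w) = nc_mono (map \<sigma> w)"
  by (simp add: nc_act_conv_ext)

lemma linear_comp_mult_left:
  assumes "Vector_Spaces.linear nc_scale nc_scale F"
  shows "Vector_Spaces.linear nc_scale nc_scale (\<lambda>f. a * F f)"
    "Vector_Spaces.linear nc_scale nc_scale (\<lambda>f. F f * a)"
    "Vector_Spaces.linear nc_scale nc_scale (\<lambda>f. F (a * f))"
    "Vector_Spaces.linear nc_scale nc_scale (\<lambda>f. F (f * a))"
  using assms
  by (auto simp: Vector_Spaces.linear_iff nc.vector_space_axioms nc_scale_mult distrib_left distrib_right)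

lemma linear_plus:
  assumes "Vector_Spaces.linear nc_scale nc_scale F" "Vector_Spaces.linear nc_scale nc_scale G"
  shows "Vector_Spaces.linear nc_scale nc_scale (\<lambda>f. F f + G f)"
  using assms by (simp add: Vector_Spaces.linear_iff nc.scale_right_distrib)

lemma linear_id_nc: "Vector_Spaces.linear nc_scale nc_scale (\<lambda>f. f)"
  by (rule nc_linearI) auto

lemma nc_act_mult: "nc_act \<sigma> (f * g) = nc_act \<sigma> f * nc_act \<sigma> g"
proof (rule nc_linear_eqI [of "\<lambda>f. nc_act \<sigma> (f * g)" "\<lambda>f. nc_act \<sigma> f * nc_act \<sigma> g" f])
  fix w
  show "nc_act \<sigma> (nc_mono w * g) = nc_act \<sigma> (nc_mono w) * nc_act \<sigma> g"
    by (rule nc_linear_eqI [of "\<lambda>g. nc_act \<sigma> (nc_mono w * g)"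
          "\<lambda>g. nc_act \<sigma> (nc_mono w) * nc_act \<sigma> g" g])
      (auto simp: nc_mono_mult intro!: linear_comp_mult_left linear_nc_act)
qed (intro linear_comp_mult_left linear_nc_act)+

section \<open>Partial derivatives\<close>

text \<open>The partial derivative of a word: all ways to delete one occurrence of the letter,
  organised by the Leibniz rule for the first letter.\<close>

fun del_letter :: "nat \<Rightarrow> nat list \<Rightarrow> ncpoly" where
  "del_letter i [] = 0"
| "del_letter i (x # w) = (if x = i then nc_mono w else 0) + nc_var x * del_letter i w"

definition nc_pd :: "nat \<Rightarrow> ncpoly \<Rightarrow> ncpoly" where
  "nc_pd i = nc_ext (del_letter i)"

lemma linear_nc_pd: "Vector_Spaces.linear nc_scale nc_scale (nc_pd i)"
  unfolding nc_pd_def by (rule linear_nc_ext)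

lemma nc_pd_mono [simp]: "nc_pd i (nc_mono w) = del_letter i w"
  by (simp add: nc_pd_def)

lemma del_letter_append:
  "del_letter i (u @ v) = del_letter i u * nc_mono v + nc_mono u * del_letter i v"
proof (induction u)
  case Nil
  then show ?case by (simp add: nc_mono_Nil)
next
  case (Cons x u)
  have "nc_mono (x # u) = nc_var x * nc_mono u"
    by (simp add: nc_var_conv_mono nc_mono_mult)
  with Cons show ?case
    by (auto simp: distrib_left distrib_right nc_mono_mult mult.assoc)
qed

lemma nc_pd_mult: "nc_pd i (f * g) = nc_pd i f * g + f * nc_pd i g"
proof (rule nc_linear_eqI [of "\<lambda>f. nc_pd i (f * g)" "\<lambda>f. nc_pd i f * g + f * nc_pd i g" f])
  fix w
  show "nc_pd i (nc_mono w * g) = nc_pd i (nc_mono w) * g + nc_mono w * nc_pd i g"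
    by (rule nc_linear_eqI [of "\<lambda>g. nc_pd i (nc_mono w * g)"
          "\<lambda>g. nc_pd i (nc_mono w) * g + nc_mono w * nc_pd i g" g])
      (auto simp: nc_mono_mult del_letter_append
        intro!: linear_comp_mult_left linear_nc_pd linear_plus linear_id_nc)
qed (intro linear_comp_mult_left linear_nc_pd linear_plus linear_id_nc)+

section \<open>The subalgebra generated by the derived Lie algebra\<close>

lemma nc_lie_closed:
  "nc.subspace (nc_lie n) \<and> (\<forall>a\<in>nc_lie n. \<forall>b\<in>nc_lie n. nc_bracket a b \<in> nc_lie n)"
  unfolding nc_lie_def by (rule hull_in) (auto intro: nc.subspace_Inter)

lemma nc_var_in_lie: "i \<in> {1..n} \<Longrightarrow> nc_var i \<in> nc_lie n"
  unfolding nc_lie_def by (intro hull_inc imageI)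

lemma nc_bracket_in_lie: "a \<in> nc_lie n \<Longrightarrow> b \<in> nc_lie n \<Longrightarrow> nc_bracket a b \<in> nc_lie n"
  using nc_lie_closed by blast

text \<open>The elements of the hull that satisfy \<open>P\<close> are again closed and contain the
  generators, hence are everything. Intersecting with \<open>nc_lie n\<close> supplies the
  membership hypotheses of the bracket case.\<close>

lemma nc_lie_induct [consumes 1, case_names var bracket subspace]:
  assumes "f \<in> nc_lie n"
    and "\<And>i. i \<in> {1..n} \<Longrightarrow> P (nc_var i)"
    and "\<And>a b. a \<in> nc_lie n \<Longrightarrow> b \<in> nc_lie n \<Longrightarrow> P a \<Longrightarrow> P b \<Longrightarrow> P (nc_bracket a b)"
    and "nc.subspace {f. P f}"
  shows "P f"
proof -
  have "nc.subspace (nc_lie n \<inter> {f. P f})"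
    using nc_lie_closed assms(4) by (intro nc.subspace_inter) auto
  moreover have "nc_var ` {1..n} \<subseteq> nc_lie n \<inter> {f. P f}"
    using assms(2) nc_var_in_lie by auto
  ultimately have "nc_lie n \<subseteq> nc_lie n \<inter> {f. P f}"
    by (subst (1) nc_lie_def, intro hull_minimal) (use assms(3) nc_bracket_in_lie in auto)
  with assms(1) show ?thesis
    by auto
qed

lemma nc_A'_closed:
  "nc.subspace (nc_A' n) \<and> 1 \<in> nc_A' n \<and> (\<forall>a\<in>nc_A' n. \<forall>b\<in>nc_A' n. a * b \<in> nc_A' n)"
  unfolding nc_A'_def by (rule hull_in) (auto intro: nc.subspace_Inter)

lemma subspace_nc_A': "nc.subspace (nc_A' n)"
  and one_in_nc_A': "1 \<in> nc_A' n"
  and mult_in_nc_A': "a \<in> nc_A' n \<Longrightarrow> b \<in> nc_A' n \<Longrightarrow> a * b \<in> nc_A' n"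
  using nc_A'_closed [of n] by auto

lemma bracket_in_nc_A':
  assumes "a \<in> nc_lie n" "b \<in> nc_lie n"
  shows "nc_bracket a b \<in> nc_A' n"
proof -
  have "nc_bracket a b \<in> nc_lie_derived n"
    unfolding nc_lie_derived_def using assms by (intro nc.span_base) auto
  then show ?thesis
    unfolding nc_A'_def by (rule hull_inc)
qed

text \<open>Since \<open>P\<close> defines a subspace and \<open>nc_lie_derived n\<close> is a span,
  single brackets are enough as generators.\<close>

lemma nc_A'_induct [consumes 1, case_names bracket one mult subspace]:
  assumes "f \<in> nc_A' n"
    and "\<And>a b. a \<in> nc_lie n \<Longrightarrow> b \<in> nc_lie n \<Longrightarrow> P (nc_bracket a b)"
    and "P 1"
    and "\<And>f g. f \<in> nc_A' n \<Longrightarrow> g \<in> nc_A' n \<Longrightarrow> P f \<Longrightarrow> P g \<Longrightarrow> P (f * g)"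
    and "nc.subspace {f. P f}"
  shows "P f"
proof -
  have sub: "nc.subspace (nc_A' n \<inter> {f. P f})"
    using subspace_nc_A' assms(5) by (intro nc.subspace_inter) auto
  have "nc_lie_derived n \<subseteq> nc_A' n \<inter> {f. P f}"
    unfolding nc_lie_derived_def using assms(2) bracket_in_nc_A'
    by (intro nc.span_minimal sub) auto
  then have "nc_A' n \<subseteq> nc_A' n \<inter> {f. P f}"
    by (subst (1) nc_A'_def, intro hull_minimal)
      (use assms(3,4) sub one_in_nc_A' mult_in_nc_A' in auto)
  with assms(1) show ?thesis
    by auto
qed

lemma subspace_linear_pred:
  assumes "Vector_Spaces.linear nc_scale nc_scale F" "nc.subspace V"
  shows "nc.subspace {f. F f \<in> V}"
proof -
  interpret F: Vector_Spaces.linear nc_scale nc_scale F by fact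
  show ?thesis
    using assms(2) unfolding nc.subspace_def by (auto simp: F.zero F.add F.scale)
qed

lemma nc_linear_diff:
  assumes "Vector_Spaces.linear nc_scale nc_scale F"
  shows "F (f - g) = F f - F g"
proof -
  interpret F: Vector_Spaces.linear nc_scale nc_scale F by fact
  show ?thesis by (rule F.diff)
qed

lemma nc_linear_sum:
  assumes "Vector_Spaces.linear nc_scale nc_scale F"
  shows "F (sum h S) = (\<Sum>x\<in>S. F (h x))"
proof -
  interpret F: Vector_Spaces.linear nc_scale nc_scale F by fact
  show ?thesis by (rule F.sum)
qed

lemma nc_linear_zero:
  assumes "Vector_Spaces.linear nc_scale nc_scale F"
  shows "F 0 = 0"
  using nc_linear_sum [OF assms, of _ "{}"] by simp

lemma nc_linear_scale:
  assumes "Vector_Spaces.linear nc_scale nc_scale F"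
  shows "F (nc_scale c f) = nc_scale c (F f)"
  using assms by (simp add: Vector_Spaces.linear_iff)

section \<open>Derivations on the Lie algebra and on the subalgebra\<close>

lemma nc_pd_bracket:
  "nc_pd i (nc_bracket a b) = nc_bracket (nc_pd i a) b + nc_bracket a (nc_pd i b)"
  by (simp add: nc_bracket_def nc_linear_diff [OF linear_nc_pd] nc_pd_mult)

lemma nc_pd_one: "nc_pd i 1 = 0"
  by (simp add: nc_mono_Nil [symmetric])

lemma nc_bracket_scalar:
  assumes "a \<in> nc.span {1}"
  shows "nc_bracket a b = 0" "nc_bracket b a = 0"
  using assms by (auto simp: nc.span_singleton nc_bracket_def nc_scale_mult)

text \<open>A variable has derivative 0 or 1, and the derivative of a bracket is a sum of brackets
  with constants, which vanish because constants are central.\<close>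

lemma nc_pd_lie: "a \<in> nc_lie n \<Longrightarrow> nc_pd i a \<in> nc.span {1}"
proof (induction rule: nc_lie_induct)
  case (var j)
  then show ?case
    by (auto simp: nc_var_conv_mono nc_mono_Nil nc.span_zero nc.span_base)
next
  case (bracket a b)
  then show ?case
    by (simp add: nc_pd_bracket nc_bracket_scalar nc.span_zero)
next
  case subspace
  show ?case
    by (rule subspace_linear_pred [OF linear_nc_pd nc.subspace_span])
qed

text \<open>The generating brackets are killed since their entries have constant derivatives, and
  the kernel of a derivation is a subalgebra.\<close>

lemma nc_pd_A': "f \<in> nc_A' n \<Longrightarrow> nc_pd i f = 0"
proof (induction rule: nc_A'_induct)
  case (bracket a b)
  then show ?case
    by (simp add: nc_pd_bracket nc_bracket_scalar [OF nc_pd_lie])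
next
  case (mult f g)
  then show ?case
    by (simp add: nc_pd_mult)
next
  case subspace
  show ?case
    using subspace_linear_pred [OF linear_nc_pd, of "{0}"] by simp
qed (simp add: nc_pd_one)

text \<open>Bracketing with a variable is a derivation, and it sends a generator
  \<open>[a, b]\<close> to a bracket of the two Lie elements \<open>[a, b]\<close> and
  \<open>nc_var i\<close>. It allows a letter to be carried past an element of
  \<open>nc_A' n\<close> with an error inside \<open>nc_A' n\<close>.\<close>

lemma nc_bracket_var_A':
  assumes "i \<in> {1..n}"
  shows "f \<in> nc_A' n \<Longrightarrow> nc_bracket f (nc_var i) \<in> nc_A' n"
proof (induction rule: nc_A'_induct)
  case (bracket a b)
  then show ?case
    using assms by (intro bracket_in_nc_A' nc_bracket_in_lie nc_var_in_lie)
next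
  case one
  show ?case
    by (simp add: nc_bracket_def nc.subspace_0 [OF subspace_nc_A'])
next
  case (mult f g)
  have "nc_bracket (f * g) (nc_var i) = f * nc_bracket g (nc_var i) + nc_bracket f (nc_var i) * g"
    by (simp add: nc_bracket_def algebra_simps)
  with mult show ?case
    by (simp add: mult_in_nc_A' nc.subspace_add [OF subspace_nc_A'])
next
  case subspace
  have "Vector_Spaces.linear nc_scale nc_scale (\<lambda>f. nc_bracket f (nc_var i))"
    by (rule nc_linearI) (simp_all add: nc_bracket_def algebra_simps nc_scale_mult nc.scale_right_diff_distrib)
  then show ?case
    using subspace_linear_pred subspace_nc_A' by blast
qed

lemma nc_act_bracket: "nc_act \<sigma> (nc_bracket a b) = nc_bracket (nc_act \<sigma> a) (nc_act \<sigma> b)"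
  by (simp add: nc_bracket_def nc_linear_diff [OF linear_nc_act] nc_act_mult)

lemma nc_act_lie:
  assumes "\<sigma> permutes {1..n}"
  shows "a \<in> nc_lie n \<Longrightarrow> nc_act \<sigma> a \<in> nc_lie n"
proof (induction rule: nc_lie_induct)
  case (var i)
  then have "\<sigma> i \<in> {1..n}"
    using permutes_in_image [OF assms] by blast
  then show ?case
    by (simp add: nc_act_var nc_var_in_lie)
next
  case (bracket a b)
  then show ?case
    by (simp add: nc_act_bracket nc_bracket_in_lie)
next
  case subspace
  show ?case
    using subspace_linear_pred [OF linear_nc_act] nc_lie_closed by blast
qed

lemma nc_act_A':
  assumes "\<sigma> permutes {1..n}"
  shows "f \<in> nc_A' n \<Longrightarrow> nc_act \<sigma> f \<in> nc_A' n"
proof (induction rule: nc_A'_induct)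
  case (bracket a b)
  then show ?case
    by (simp add: nc_act_bracket bracket_in_nc_A' nc_act_lie [OF assms])
next
  case one
  have "nc_act \<sigma> 1 = 1"
    by (simp flip: nc_mono_Nil)
  then show ?case
    by (simp add: one_in_nc_A')
next
  case (mult f g)
  then show ?case
    by (simp add: nc_act_mult mult_in_nc_A')
next
  case subspace
  show ?case
    by (rule subspace_linear_pred [OF linear_nc_act subspace_nc_A'])
qed

section \<open>Alphabet and degree\<close>

definition nc_words :: "nat \<Rightarrow> ncpoly set" where
  "nc_words n = {f. \<forall>w\<in>Poly_Mapping.keys f. set (letters w) \<subseteq> {1..n}}"

lemma keys_nc_scale: "Poly_Mapping.keys (nc_scale c f) \<subseteq> Poly_Mapping.keys f"
  by (auto simp: in_keys_iff lookup_nc_scale)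

lemma subspace_keys: "nc.subspace {f. \<forall>w\<in>Poly_Mapping.keys f. P w}"
  unfolding nc.subspace_def
proof (intro conjI ballI allI)
  fix f g :: ncpoly and c :: rat
  assume "f \<in> {f. \<forall>w\<in>Poly_Mapping.keys f. P w}"
  then show "nc_scale c f \<in> {f. \<forall>w\<in>Poly_Mapping.keys f. P w}"
    using keys_nc_scale [of c f] by blast
  assume "g \<in> {f. \<forall>w\<in>Poly_Mapping.keys f. P w}"
  with \<open>f \<in> _\<close> show "f + g \<in> {f. \<forall>w\<in>Poly_Mapping.keys f. P w}"
    using Poly_Mapping.keys_add [of f g] by blast
qed simp

lemma keys_mult_cases:
  assumes "w \<in> Poly_Mapping.keys (f * g)"
  obtains u v where "u \<in> Poly_Mapping.keys f" "v \<in> Poly_Mapping.keys g" "letters w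
      = letters u @ letters v"
  using assms keys_mult [of f g] by (auto simp: plus_ncword_def)

lemma subspace_nc_words: "nc.subspace (nc_words n)"
  unfolding nc_words_def by (rule subspace_keys)

lemma mult_nc_words: "f \<in> nc_words n \<Longrightarrow> g \<in> nc_words n \<Longrightarrow> f * g \<in> nc_words n"
  unfolding nc_words_def by (fastforce elim!: keys_mult_cases)

lemma nc_lie_subset_words: "nc_lie n \<subseteq> nc_words n"
proof
  fix f assume "f \<in> nc_lie n"
  then show "f \<in> nc_words n"
  proof (induction rule: nc_lie_induct)
    case (var i)
    then show ?case
      by (auto simp: nc_words_def nc_var_def)
  next
    case (bracket a b)
    then show ?case
      by (simp add: nc_bracket_def mult_nc_words nc.subspace_diff [OF subspace_nc_words])
  next
    case subspace
    then show ?case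
      by (simp add: subspace_nc_words)
  qed
qed

lemma nc_A'_subset_words: "nc_A' n \<subseteq> nc_words n"
proof
  fix f assume "f \<in> nc_A' n"
  then show "f \<in> nc_words n"
  proof (induction rule: nc_A'_induct)
    case (bracket a b)
    then show ?case
      using nc_lie_subset_words
      by (auto simp: nc_bracket_def intro!: mult_nc_words nc.subspace_diff [OF subspace_nc_words])
  next
    case one
    then show ?case
      by (simp add: nc_words_def zero_ncword_def)
  next
    case subspace
    then show ?case
      by (simp add: subspace_nc_words)
  qed (rule mult_nc_words)
qed

definition nc_hom :: "nat \<Rightarrow> ncpoly set" where
  "nc_hom k = {f. \<forall>w\<in>Poly_Mapping.keys f. length (letters w) = k}"

lemma nc_graded_part_eq: "nc_graded_part M k = M \<inter> nc_hom k"
  by (auto simp: nc_graded_part_def nc_hom_def)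

lemma subspace_nc_hom: "nc.subspace (nc_hom k)"
  unfolding nc_hom_def by (rule subspace_keys)

lemma mult_nc_hom: "f \<in> nc_hom j \<Longrightarrow> g \<in> nc_hom k \<Longrightarrow> f * g \<in> nc_hom (j + k)"
  unfolding nc_hom_def by (fastforce elim!: keys_mult_cases)

lemma nc_mono_hom: "nc_mono w \<in> nc_hom (length w)"
  by (simp add: nc_hom_def nc_mono_def)

lemma nc_act_hom:
  assumes "f \<in> nc_hom k"
  shows "nc_act \<sigma> f \<in> nc_hom k"
proof -
  have "nc_scale (Poly_Mapping.lookup f w) (nc_mono (map \<sigma> (letters w))) \<in> nc_hom k"
    if "w \<in> Poly_Mapping.keys f" for w
    using that assms nc_mono_hom [of "map \<sigma> (letters w)"]
    by (intro nc.subspace_scale [OF subspace_nc_hom]) (simp add: nc_hom_def)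
  then show ?thesis
    unfolding nc_act_conv_ext nc_ext_def by (intro nc.subspace_sum [OF subspace_nc_hom])
qed

lemma nc_words_hom_span:
  "nc_words n \<inter> nc_hom k = nc.span (nc_mono ` {w. set w \<subseteq> {1..n} \<and> length w = k})"
proof
  show "nc_words n \<inter> nc_hom k \<subseteq> nc.span (nc_mono ` {w. set w \<subseteq> {1..n} \<and> length w = k})"
  proof
    fix f assume f: "f \<in> nc_words n \<inter> nc_hom k"
    show "f \<in> nc.span (nc_mono ` {w. set w \<subseteq> {1..n} \<and> length w = k})"
      by (subst nc_expand, intro nc.span_sum nc.span_scale nc.span_base imageI)
        (use f in \<open>auto simp: nc_words_def nc_hom_def\<close>)
  qed
  show "nc.span (nc_mono ` {w. set w \<subseteq> {1..n} \<and> length w = k}) \<subseteq> nc_words n \<inter> nc_hom k"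
    by (intro nc.span_minimal nc.subspace_inter subspace_nc_words subspace_nc_hom)
      (auto simp: nc_words_def nc_hom_def nc_mono_def)
qed

abbreviation nc_A'_part :: "nat \<Rightarrow> nat \<Rightarrow> ncpoly set" where
  "nc_A'_part n k \<equiv> nc_graded_part (nc_A' n) k"

lemma subspace_nc_A'_part: "nc.subspace (nc_A'_part n k)"
  unfolding nc_graded_part_eq by (intro nc.subspace_inter subspace_nc_A' subspace_nc_hom)

lemma mult_nc_A'_part: "f \<in> nc_A'_part n j \<Longrightarrow> g \<in> nc_A'_part n k \<Longrightarrow> f * g \<in> nc_A'_part n (j + k)"
  by (simp add: nc_graded_part_eq mult_in_nc_A' mult_nc_hom)

lemma one_nc_A'_part: "1 \<in> nc_A'_part n 0"
  using nc_mono_hom [of "[]"] by (simp add: nc_graded_part_eq one_in_nc_A' nc_mono_Nil)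

lemma nc_bracket_var_A'_part:
  assumes "i \<in> {1..n}" "f \<in> nc_A'_part n k"
  shows "nc_bracket f (nc_var i) \<in> nc_A'_part n (Suc k)"
proof -
  have "f * nc_var i \<in> nc_hom (Suc k)" "nc_var i * f \<in> nc_hom (Suc k)"
    using mult_nc_hom [of f k "nc_var i" 1] mult_nc_hom [of "nc_var i" 1 f k] nc_mono_hom [of "[i]"] assms
    by (simp_all add: nc_graded_part_eq nc_var_conv_mono)
  then show ?thesis
    using assms nc_bracket_var_A'
    by (simp add: nc_graded_part_eq nc_bracket_def nc.subspace_diff [OF subspace_nc_hom])
qed

lemma nc_bracket_vars_A'_part:
  assumes "i \<in> {1..n}" "j \<in> {1..n}"
  shows "nc_bracket (nc_var i) (nc_var j) \<in> nc_A'_part n 2"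
proof -
  have "nc_bracket (nc_var i) (nc_var j) \<in> nc_hom 2"
    using nc_mono_hom [of "[i, j]"] nc_mono_hom [of "[j, i]"]
    by (simp add: nc_bracket_def nc_var_conv_mono nc_mono_mult nc.subspace_diff [OF subspace_nc_hom]
        numeral_2_eq_2)
  then show ?thesis
    using assms by (simp add: nc_graded_part_eq bracket_in_nc_A' nc_var_in_lie)
qed

lemma nc_act_A'_part:
  "\<sigma> permutes {1..n} \<Longrightarrow> f \<in> nc_A'_part n k \<Longrightarrow> nc_act \<sigma> f \<in> nc_A'_part n k"
  by (simp add: nc_graded_part_eq nc_act_A' nc_act_hom)

section \<open>Symmetrised words\<close>

lemma span_bilinear:
  assumes F: "\<And>a. Vector_Spaces.linear nc_scale nc_scale (F a)"
    and G: "\<And>b. Vector_Spaces.linear nc_scale nc_scale (\<lambda>a. F a b)"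
    and x: "x \<in> nc.span A" and y: "y \<in> nc.span B"
    and V: "nc.subspace V" "\<And>a b. a \<in> A \<Longrightarrow> b \<in> B \<Longrightarrow> F a b \<in> V"
  shows "F x y \<in> V"
proof -
  have "A \<subseteq> {a. F a y \<in> V}"
  proof
    fix a assume a: "a \<in> A"
    have "nc.span B \<subseteq> {b. F a b \<in> V}"
      using V(2) [OF a] by (intro nc.span_minimal subspace_linear_pred [OF F V(1)]) auto
    with y show "a \<in> {a. F a y \<in> V}"
      by auto
  qed
  then have "nc.span A \<subseteq> {a. F a y \<in> V}"
    by (intro nc.span_minimal subspace_linear_pred [OF G V(1)]) auto
  with x show ?thesis
    by auto
qed

lemma span_mult:
  assumes "x \<in> nc.span A" "y \<in> nc.span B" "nc.subspace V"
    and "\<And>a b. a \<in> A \<Longrightarrow> b \<in> B \<Longrightarrow> a * b \<in> V"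
  shows "x * y \<in> V"
  by (rule span_bilinear [of "(*)" x A y B V])
    (use assms in \<open>auto intro: linear_comp_mult_left linear_id_nc\<close>)

text \<open>
  The degree \<open>k\<close> part of the filtration of the right \<open>\<A>'\<close>-module of all polynomials by the length of
  the word in front of an element of \<open>\<A>'\<close>.
\<close>

definition nc_filt :: "nat \<Rightarrow> nat \<Rightarrow> nat \<Rightarrow> ncpoly set" where
  "nc_filt n d k = nc.span {nc_mono r * u | r u.
     set r \<subseteq> {1..n} \<and> length r \<le> d \<and> length r \<le> k \<and> u \<in> nc_A'_part n (k - length r)}"

lemma nc_filtI:
  "set r \<subseteq> {1..n} \<Longrightarrow> length r \<le> d \<Longrightarrow> u \<in> nc_A'_part n j \<Longrightarrow> k = length r + j \<Longrightarrow>
    nc_mono r * u \<in> nc_filt n d k"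
  unfolding nc_filt_def by (intro nc.span_base CollectI exI [of _ r] exI [of _ u]) simp

lemma subspace_nc_filt: "nc.subspace (nc_filt n d k)"
  by (simp add: nc_filt_def)

lemma nc_filt_mono: "d \<le> d' \<Longrightarrow> nc_filt n d k \<subseteq> nc_filt n d' k"
  unfolding nc_filt_def by (intro nc.span_mono) force

lemma nc_filt_left:
  assumes "f \<in> nc_filt n d k" "set p \<subseteq> {1..n}"
  shows "nc_mono p * f \<in> nc_filt n (length p + d) (length p + k)"
  using nc.span_base [of "nc_mono p" "{nc_mono p}"] assms(1) subspace_nc_filt
  unfolding nc_filt_def [of n d k]
proof (rule span_mult)
  fix a b
  assume "a \<in> {nc_mono p}" "b \<in> {nc_mono r * u |r u. set r \<subseteq> {1..n} \<and> length r \<le> d \<and>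
    length r \<le> k \<and> u \<in> nc_A'_part n (k - length r)}"
  then obtain r u where "a * b = nc_mono (p @ r) * u" "set r \<subseteq> {1..n}" "length r \<le> d"
    "length r \<le> k" "u \<in> nc_A'_part n (k - length r)"
    by (auto simp: nc_mono_mult simp flip: mult.assoc)
  with assms(2) show "a * b \<in> nc_filt n (length p + d) (length p + k)"
    using nc_filtI [of "p @ r" n "length p + d" u "k - length r" "length p + k"] by simp
qed simp

lemma nc_filt_right:
  assumes "f \<in> nc_filt n d k" "v \<in> nc_A'_part n j"
  shows "f * v \<in> nc_filt n d (k + j)"
  using assms(1) nc.span_base [of v "{v}"] subspace_nc_filt
  unfolding nc_filt_def [of n d k]
proof (rule span_mult)
  fix a b
  assume b: "b \<in> {v}" and "a \<in> {nc_mono r * u |r u. set r \<subseteq> {1..n} \<and> length r \<le> d \<and>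
    length r \<le> k \<and> u \<in> nc_A'_part n (k - length r)}"
  then obtain r u where a: "a = nc_mono r * u" and r: "set r \<subseteq> {1..n}" "length r \<le> d"
    "length r \<le> k" and u: "u \<in> nc_A'_part n (k - length r)"
    by blast
  have "a * b = nc_mono r * (u * v)"
    using b by (simp only: a singleton_iff mult.assoc)
  also have "\<dots> \<in> nc_filt n d (k + j)"
    by (rule nc_filtI [OF r(1,2) mult_nc_A'_part [OF u assms(2)]]) (use r(3) in arith)
  finally show "a * b \<in> nc_filt n d (k + j)" .
qed simp

lemma nc_mono_Cons: "nc_mono (x # w) = nc_var x * nc_mono w"
  by (simp add: nc_var_conv_mono nc_mono_mult)

text \<open>Carry \<open>u\<close> rightwards with \<open>u x = x u + [u, x]\<close>: the commutator
  is again in \<open>nc_A' n\<close>, one degree higher, and stands before a shorter word. Hence the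
  induction on the word for all \<open>u\<close> and \<open>j\<close>.\<close>

lemma nc_filt_A'_word:
  "set r \<subseteq> {1..n} \<Longrightarrow> u \<in> nc_A'_part n j \<Longrightarrow> u * nc_mono r \<in> nc_filt n (length r) (length r + j)"
proof (induction r arbitrary: u j)
  case Nil
  then show ?case
    using nc_filtI [of "[]" n 0 u j j] by (simp add: nc_mono_Nil)
next
  case (Cons x r)
  have "nc_mono [x] * (u * nc_mono r) \<in> nc_filt n (length (x # r)) (length (x # r) + j)"
    using nc_filt_left [OF Cons.IH [OF _ Cons.prems(2)], of "[x]"] Cons.prems(1) by simp
  moreover have "nc_bracket u (nc_var x) * nc_mono r \<in> nc_filt n (length r) (length r + Suc j)"
    using Cons.prems by (intro Cons.IH nc_bracket_var_A'_part) auto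
  then have "nc_bracket u (nc_var x) * nc_mono r \<in> nc_filt n (length (x # r)) (length (x # r) + j)"
    using nc_filt_mono [of "length r" "length (x # r)" n] by auto
  ultimately have "nc_mono [x] * (u * nc_mono r) + nc_bracket u (nc_var x) * nc_mono r
      \<in> nc_filt n (length (x # r)) (length (x # r) + j)"
    by (rule nc.subspace_add [OF subspace_nc_filt])
  moreover have "u * nc_mono (x # r) = nc_mono [x] * (u * nc_mono r) + nc_bracket u (nc_var x) * nc_mono r"
    by (simp add: nc_mono_Cons nc_mono_Nil nc_bracket_def algebra_simps)
  ultimately show ?case
    by simp
qed

text \<open>Each transposition costs \<open>[x, y]\<close>, an element of \<open>nc_A' n\<close>
  that is then carried through the rest of the word. It replaces two letters, so the error has a
  shorter word in front.\<close>

lemma nc_filt_move: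
  assumes "x \<in> {1..n}" "set s \<subseteq> {1..n}"
  shows "set p \<subseteq> {1..n} \<Longrightarrow> nc_mono (x # p @ s) - nc_mono (p @ x # s)
    \<in> nc_filt n (length (p @ s)) (Suc (length (p @ s)))"
proof (induction p)
  case Nil
  then show ?case
    by (simp add: nc.subspace_0 [OF subspace_nc_filt])
next
  case (Cons y p)
  let ?F = "nc_filt n (length ((y # p) @ s)) (Suc (length ((y # p) @ s)))"
  have "nc_bracket (nc_var x) (nc_var y) * nc_mono (p @ s)
      \<in> nc_filt n (length (p @ s)) (length (p @ s) + 2)"
    using Cons.prems assms by (intro nc_filt_A'_word nc_bracket_vars_A'_part) auto
  then have "nc_bracket (nc_var x) (nc_var y) * nc_mono (p @ s) \<in> ?F"
    using nc_filt_mono [of "length (p @ s)" "length ((y # p) @ s)" n] by auto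
  moreover have "nc_mono [y] * (nc_mono (x # p @ s) - nc_mono (p @ x # s)) \<in> ?F"
    using nc_filt_left [OF Cons.IH, of "[y]"] Cons.prems by simp
  ultimately have "nc_bracket (nc_var x) (nc_var y) * nc_mono (p @ s)
      + nc_mono [y] * (nc_mono (x # p @ s) - nc_mono (p @ x # s)) \<in> ?F"
    by (rule nc.subspace_add [OF subspace_nc_filt])
  then show ?case
    by (simp add: nc_mono_Cons nc_mono_Nil nc_bracket_def algebra_simps)
qed

text \<open>Bring the first letter of \<open>w\<close> to the front of \<open>w'\<close>, then
  compare the tails by induction.\<close>

lemma nc_filt_permute:
  "mset w = mset w' \<Longrightarrow> set w \<subseteq> {1..n} \<Longrightarrow>
    nc_mono w - nc_mono w' \<in> nc_filt n (length w - 1) (length w)"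
proof (induction w arbitrary: w')
  case Nil
  then show ?case
    by (simp add: nc.subspace_0 [OF subspace_nc_filt])
next
  case (Cons x w)
  then have "x \<in> set w'"
    by (metis list.set_intros(1) mset_eq_setD)
  then obtain p s where w': "w' = p @ x # s"
    by (meson split_list)
  with Cons.prems(1) have ps: "mset w = mset (p @ s)"
    by simp
  then have len: "length (p @ s) = length w" and sets: "set p \<union> set s = set w"
    by (metis size_mset) (metis ps mset_eq_setD set_append)
  have "nc_mono (x # p @ s) - nc_mono w' \<in> nc_filt n (length w) (Suc (length w))"
    using nc_filt_move [of x n s p] Cons.prems(2) sets unfolding w' len by auto
  moreover have "nc_mono (x # w) - nc_mono (x # p @ s) \<in> nc_filt n (length w) (Suc (length w))"
  \<comment> \<open>For \<open>w = []\<close> the truncated bound \<open>length w - 1\<close> is 0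
    rather than -1, so the induction hypothesis would be too weak by one; the two words coincide
    instead.\<close>
  proof (cases "w = []")
    case True
    with len show ?thesis
      by (simp add: nc.subspace_0 [OF subspace_nc_filt])
  next
    case False
    then have "nc_mono [x] * (nc_mono w - nc_mono (p @ s)) \<in> nc_filt n (length w) (Suc (length w))"
      using nc_filt_left [OF Cons.IH [OF ps], of "[x]"] Cons.prems(2) by (cases w) auto
    then show ?thesis
      by (simp add: right_diff_distrib nc_mono_mult)
  qed
  ultimately have "(nc_mono (x # p @ s) - nc_mono w') + (nc_mono (x # w) - nc_mono (x # p @ s))
      \<in> nc_filt n (length w) (Suc (length w))"
    by (rule nc.subspace_add [OF subspace_nc_filt])
  then show ?case
    by simp
qed

section \<open>Symmetrised monomials as a module basis\<close>

text \<open>Each distinct rearrangement occurs once, without averaging; over the rationals this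
  changes the usual symmetrisation only by a nonzero factor.\<close>

definition nc_sym :: "nat multiset \<Rightarrow> ncpoly" where
  "nc_sym m = (\<Sum>w\<in>permutations_of_multiset m. nc_mono w)"

lemma nc_sym_empty [simp]: "nc_sym {#} = 1"
  by (simp add: nc_sym_def nc_mono_Nil)

lemma nc_sym_rec:
  assumes "m \<noteq> {#}"
  shows "nc_sym m = (\<Sum>x\<in>set_mset m. nc_var x * nc_sym (m - {#x#}))"
proof -
  have "nc_sym m = (\<Sum>w\<in>(\<Union>x\<in>set_mset m. (#) x ` permutations_of_multiset (m - {#x#})). nc_mono w)"
    using assms by (simp add: nc_sym_def permutations_of_multiset_nonempty)
  also have "\<dots> = (\<Sum>x\<in>set_mset m. \<Sum>w\<in>(#) x ` permutations_of_multiset (m - {#x#}). nc_mono w)"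
    by (rule sum.UNION_disjoint) auto
  also have "\<dots> = (\<Sum>x\<in>set_mset m. nc_var x * nc_sym (m - {#x#}))"
    by (simp add: sum.reindex nc_sym_def sum_distrib_left nc_mono_Cons)
  finally show ?thesis .
qed

lemma nc_pd_var: "nc_pd i (nc_var x) = (if x = i then 1 else 0)"
  by (simp add: nc_var_conv_mono nc_mono_Nil)

text \<open>A given rearrangement of \<open>m - {#i#}\<close> arises from \<open>size m\<close>
  insertions of \<open>i\<close>, one for each slot; so the factor is the size, not the multiplicity
  of \<open>i\<close> as for a commutative monomial. In the induction the deleted letter is either
  the first one, contributing 1, or a later one, contributing \<open>k\<close>.\<close>

lemma nc_pd_sym:
  "nc_pd i (nc_sym m) = (if i \<in># m then nc_scale (of_nat (size m)) (nc_sym (m - {#i#})) else 0)"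
proof (induction "size m" arbitrary: m)
  case 0
  then show ?case
    by (simp add: nc_pd_one)
next
  case (Suc k)
  then have m: "m \<noteq> {#}"
    by auto
  have IH: "nc_pd i (nc_sym (m - {#x#})) =
      (if i \<in># m - {#x#} then nc_scale (of_nat k) (nc_sym (m - {#x#} - {#i#})) else 0)"
    if "x \<in># m" for x
    using Suc.hyps(1) [of "m - {#x#}"] Suc.hyps(2) that by (simp add: size_Diff_singleton)
  have mem: "i \<in># m - {#x#} \<longleftrightarrow> i \<in># m \<and> x \<in># m - {#i#}" if "x \<in># m" for x
    using that by (auto simp: in_diff_count)
  have "nc_pd i (nc_sym m) = (\<Sum>x\<in>set_mset m. (if x = i then nc_sym (m - {#x#}) else 0)
      + nc_var x * nc_pd i (nc_sym (m - {#x#})))"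
    by (subst nc_sym_rec [OF m])
      (auto simp: nc_linear_sum [OF linear_nc_pd] nc_pd_mult nc_pd_var intro!: sum.cong)
  also have "\<dots> = (if i \<in># m then nc_sym (m - {#i#}) else 0)
      + (\<Sum>x\<in>set_mset m. nc_var x * nc_pd i (nc_sym (m - {#x#})))"
    by (simp add: sum.distrib)
  also have "(\<Sum>x\<in>set_mset m. nc_var x * nc_pd i (nc_sym (m - {#x#}))) =
      (if i \<in># m then nc_scale (of_nat k) (nc_sym (m - {#i#})) else 0)"
  proof (cases "i \<in># m")
    case True
    have "(\<Sum>x\<in>set_mset m. nc_var x * nc_pd i (nc_sym (m - {#x#})))
        = (\<Sum>x\<in>set_mset m. if x \<in># m - {#i#}
            then nc_scale (of_nat k) (nc_var x * nc_sym (m - {#i#} - {#x#})) else 0)"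
      using True by (intro sum.cong refl) (simp add: IH mem nc_scale_mult diff_diff_add add.commute)
    also have "\<dots> = (\<Sum>x\<in>set_mset (m - {#i#}). nc_scale (of_nat k) (nc_var x * nc_sym (m - {#i#} - {#x#})))"
      by (rule sum.mono_neutral_cong_right) (auto dest: in_diffD)
    also have "\<dots> = nc_scale (of_nat k) (nc_sym (m - {#i#}))"
    \<comment> \<open>Here \<open>nc_sym_rec\<close> does not apply, but \<open>size m = 1\<close>
      forces \<open>k = 0\<close>.\<close>
    proof (cases "m - {#i#} = {#}")
      case True
      with \<open>i \<in># m\<close> have "size m = 1"
        by (metis Diff_eq_empty_iff_mset diff_single_trivial insert_DiffM size_single)
      with True Suc.hyps(2) show ?thesis
        by simp
    next
      case False
      show ?thesis
        by (subst nc_sym_rec [OF False]) (simp add: nc.scale_sum_right)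
    qed
    finally show ?thesis
      using True by simp
  next
    case False
    then have "nc_pd i (nc_sym (m - {#x#})) = 0" if "x \<in># m" for x
      using IH [OF that] mem [OF that] by simp
    with False show ?thesis
      by simp
  qed
  also have "(if i \<in># m then nc_sym (m - {#i#}) else 0)
      + (if i \<in># m then nc_scale (of_nat k) (nc_sym (m - {#i#})) else 0)
      = (if i \<in># m then nc_scale (of_nat (size m)) (nc_sym (m - {#i#})) else 0)"
    by (simp add: Suc.hyps(2) [symmetric] nc.scale_left_distrib)
  finally show ?case .
qed

text \<open>Since every derivative kills the coefficients, it acts only on the symmetrised factors
  and lowers their size, so induction kills each coefficient whose index contains some
  \<open>i\<close>. What is left is the index \<open>{#}\<close>, where the factor is 1.\<close>

lemma nc_sym_independent:
  "finite I \<Longrightarrow> (\<And>m. m \<in> I \<Longrightarrow> size m \<le> d) \<Longrightarrow> (\<And>m i. m \<in> I \<Longrightarrow> nc_pd i (u m) = 0) \<Longrightarrow>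
    (\<Sum>m\<in>I. nc_sym m * u m) = 0 \<Longrightarrow> m0 \<in> I \<Longrightarrow> u m0 = 0"
proof (induction d arbitrary: I u m0)
  case 0
  then have "I = {{#}}"
    by auto
  with 0 show ?case
    by simp
next
  case (Suc d)
  have nonempty: "u m = 0" if m: "m \<in> I" "i \<in># m" for m i
  proof -
    let ?I = "{m\<in>I. i \<in># m}"
    have inj: "inj_on (\<lambda>m. m - {#i#}) ?I"
      by (rule inj_on_inverseI [of _ "add_mset i"]) simp
    have "0 = nc_pd i (\<Sum>m\<in>I. nc_sym m * u m)"
      by (simp add: Suc.prems(4) nc_linear_zero [OF linear_nc_pd])
    also have "\<dots> = (\<Sum>m\<in>I. if i \<in># m then nc_scale (of_nat (size m)) (nc_sym (m - {#i#}) * u m) else 0)"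
      unfolding nc_linear_sum [OF linear_nc_pd] using Suc.prems(3)
      by (intro sum.cong refl) (simp add: nc_pd_mult nc_pd_sym nc_scale_mult)
    also have "\<dots> = (\<Sum>m\<in>?I. nc_sym (m - {#i#}) * nc_scale (of_nat (size m)) (u m))"
      using Suc.prems(1) by (simp add: sum.If_cases nc_scale_mult Int_def)
    \<comment> \<open>Deleting \<open>i\<close> is injective on the multisets that contain it; the
      new coefficient keeps the nonzero factor \<open>size m\<close>, which is divided out at the
      end.\<close>
    also have "\<dots> = (\<Sum>m\<in>(\<lambda>m. m - {#i#}) ` ?I.
        nc_sym m * nc_scale (of_nat (size (add_mset i m))) (u (add_mset i m)))"
      by (subst sum.reindex [OF inj]) (auto intro!: sum.cong simp del: size_add_mset)
    finally have *: "(\<Sum>m\<in>(\<lambda>m. m - {#i#}) ` ?I.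
        nc_sym m * nc_scale (of_nat (size (add_mset i m))) (u (add_mset i m))) = 0" ..
    have "size m - Suc 0 \<le> d" if "m \<in> I" for m
      using Suc.prems(2) [OF that] by simp
    then have "nc_scale (of_nat (size (add_mset i (m - {#i#})))) (u (add_mset i (m - {#i#}))) = 0"
      using Suc.prems(1-3) m *
      by (intro Suc.IH [of "(\<lambda>m. m - {#i#}) ` ?I"
            "\<lambda>m. nc_scale (of_nat (size (add_mset i m))) (u (add_mset i m))" "m - {#i#}"])
        (auto simp: nc_linear_scale [OF linear_nc_pd] size_Diff_singleton simp del: size_add_mset)
    then have "nc_scale (of_nat (size m)) (u m) = 0"
      using m(2) by simp
    with m show ?thesis
      by (auto simp: nc.scale_eq_0_iff)
  qed
  show ?case
  proof (cases "m0 = {#}")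
    case False
    with nonempty Suc.prems(5) show ?thesis
      by (meson multiset_nonemptyE)
  next
    case True
    have "0 = (\<Sum>m\<in>I. nc_sym m * u m)"
      by (simp add: Suc.prems)
    also have "\<dots> = (\<Sum>m\<in>{m0}. nc_sym m * u m)"
    proof (rule sum.mono_neutral_right)
      show "\<forall>m\<in>I - {m0}. nc_sym m * u m = 0"
        using nonempty True by (metis DiffD1 DiffD2 insertI1 mult_zero_right multiset_nonemptyE)
    qed (use Suc.prems in auto)
    finally show ?thesis
      using True by simp
  qed
qed

text \<open>Summing \<open>r - w\<close> over all rearrangements \<open>w\<close> of
  \<open>r\<close> gives a multiple of \<open>r\<close> minus the symmetrised word; each difference
  has smaller filtration degree, and the number of rearrangements can be divided out.\<close>

lemma nc_filt_subset_sym: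
  "nc_filt n d k \<subseteq> nc.span {nc_sym m * u | m u.
     set_mset m \<subseteq> {1..n} \<and> size m \<le> k \<and> u \<in> nc_A'_part n (k - size m)}"
  (is "_ \<subseteq> ?S k")
proof (induction d arbitrary: k rule: less_induct)
  case (less d)
  have "nc_mono r * u \<in> ?S k"
    if r: "set r \<subseteq> {1..n}" "length r \<le> d" "length r \<le> k" and u: "u \<in> nc_A'_part n (k - length r)" for r u
  proof -
    let ?P = "permutations_of_multiset (mset r)"
    have sym: "nc_sym (mset r) * u \<in> ?S k"
      using r u by (intro nc.span_base CollectI exI [of _ "mset r"] exI [of _ u]) simp
    have diff: "(nc_mono r - nc_mono w) * u \<in> ?S k" if "w \<in> ?P" for w
    \<comment> \<open>The empty word is its own only rearrangement; with \<open>d = 0\<close> there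
      would be no smaller filtration degree.\<close>
    proof (cases "r = []")
      case True
      with that show ?thesis
        by (simp add: nc.span_zero)
    next
      case False
      then have "length r - 1 < d"
        using r(2) by (cases r) auto
      have "(nc_mono r - nc_mono w) * u \<in> nc_filt n (length r - 1) (length r + (k - length r))"
        using that r(1) by (intro nc_filt_right [OF nc_filt_permute u])
            (simp_all add: permutations_of_multiset_def)
      then show ?thesis
        using less.IH [OF \<open>length r - 1 < d\<close>, of k] r(3) by auto
    qed
    have "nc_scale (of_nat (card ?P)) (nc_mono r * u) = (\<Sum>w\<in>?P. nc_mono r * u)"
      by (rule nc.sum_constant_scale [symmetric])
    also have "\<dots> = (\<Sum>w\<in>?P. (nc_mono r - nc_mono w) * u) + nc_sym (mset r) * u"
      by (simp only: nc_sym_def sum_distrib_right left_diff_distrib sum_subtractf) simp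
    also have "\<dots> \<in> ?S k"
      by (intro nc.span_add nc.span_sum sym diff)
    finally have "nc_scale (1 / of_nat (card ?P)) (nc_scale (of_nat (card ?P)) (nc_mono r * u)) \<in> ?S k"
      by (rule nc.span_scale)
    moreover have "card ?P \<noteq> 0"
      by (simp add: permutations_of_multiset_not_empty)
    ultimately show ?thesis
      by simp
  qed
  then show ?case
    unfolding nc_filt_def [of n d k] by (intro nc.span_minimal) auto
qed

lemma nc_sym_words_hom:
  assumes "set_mset m \<subseteq> {1..n}"
  shows "nc_sym m \<in> nc_words n \<inter> nc_hom (size m)"
  unfolding nc_sym_def nc_words_hom_span using assms
  by (intro nc.span_sum nc.span_base imageI CollectI)
    (auto simp: permutations_of_multiset_def)

text \<open>The spanning half of the module basis, degree by degree: a word \<open>w\<close> is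
  \<open>w\<close> times 1, and so lies in the filtration at its own length.\<close>

lemma nc_words_hom_sym:
  "nc_words n \<inter> nc_hom k = nc.span {nc_sym m * u | m u.
     set_mset m \<subseteq> {1..n} \<and> size m \<le> k \<and> u \<in> nc_A'_part n (k - size m)}"
  (is "?W = nc.span ?S")
proof
  have "nc_mono w \<in> nc_filt n k k" if "set w \<subseteq> {1..n}" "length w = k" for w
  proof -
    have "nc_mono w * 1 \<in> nc_filt n k k"
      by (rule nc_filtI [OF that(1) _ one_nc_A'_part]) (simp_all add: that(2))
    then show ?thesis
      by simp
  qed
  then have "nc_mono ` {w. set w \<subseteq> {1..n} \<and> length w = k} \<subseteq> nc.span ?S"
    using nc_filt_subset_sym [of n k k] by blast
  then show "?W \<subseteq> nc.span ?S"
    unfolding nc_words_hom_span by (intro nc.span_minimal) auto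
  have "nc_sym m * u \<in> ?W"
    if "set_mset m \<subseteq> {1..n}" "size m \<le> k" "u \<in> nc_A'_part n (k - size m)" for m u
    using nc_sym_words_hom [OF that(1)] that(2,3) nc_A'_subset_words [of n]
      mult_nc_hom [of "nc_sym m" "size m" u "k - size m"] mult_nc_words [of "nc_sym m" n u]
    by (auto simp: nc_graded_part_eq)
  then show "nc.span ?S \<subseteq> ?W"
    by (intro nc.span_minimal nc.subspace_inter subspace_nc_words subspace_nc_hom) auto
qed

lemma nc_act_sym:
  assumes "inj \<sigma>"
  shows "nc_act \<sigma> (nc_sym m) = nc_sym (image_mset \<sigma> m)"
proof -
  have "inj_on (map \<sigma>) (permutations_of_multiset m)"
    using assms by (meson inj_mapI inj_on_subset subset_UNIV)
  then show ?thesis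
    by (simp add: nc_sym_def nc_linear_sum [OF linear_nc_act] permutations_of_multiset_image sum.reindex)
qed

section \<open>Two computations of the trace on words\<close>

lemma finite_words: "finite {w. set w \<subseteq> {1..n::nat} \<and> length w = k}"
  by (rule finite_lists_length_eq) simp

text \<open>The words are permuted, so the trace counts the fixed ones, which are the words in fixed
  letters.\<close>

lemma trace_words:
  assumes "\<sigma> permutes {1..n}"
  shows "nc_trace_on (nc_words n \<inter> nc_hom k) (nc_act \<sigma>) = of_nat (card {i\<in>{1..n}. \<sigma> i = i} ^ k)"
proof -
  let ?I = "{w. set w \<subseteq> {1..n} \<and> length w = k}"
  have "nc_trace_on (nc_words n \<inter> nc_hom k) (nc_act \<sigma>) = (\<Sum>w\<in>?I. if w = map \<sigma> w then 1 else 0)"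
  proof (rule nc.trace_on_family [where M = "\<lambda>v w. if v = map \<sigma> w then 1 else 0",
        OF finite_words nc_words_hom_span [symmetric] _ linear_nc_act])
    fix c assume c: "(\<Sum>w\<in>?I. nc_scale (c w) (nc_mono w)) = 0"
    show "\<forall>w\<in>?I. c w = 0"
    proof
      fix w assume w: "w \<in> ?I"
      have "0 = Poly_Mapping.lookup (\<Sum>w\<in>?I. nc_scale (c w) (nc_mono w)) (NCWord w)"
        by (simp only: c lookup_zero)
      also have "\<dots> = (\<Sum>v\<in>?I. if v = w then c v else 0)"
        by (auto simp: lookup_sum lookup_nc_scale nc_mono_def lookup_single when_def intro!: sum.cong)
      also have "\<dots> = c w"
        using finite_words w by (subst sum.delta) auto
      finally show "c w = 0" ..
    qed
  next
    fix w assume w: "w \<in> ?I"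
    have "map \<sigma> w \<in> ?I"
      using w permutes_in_image [OF assms] by auto
    have "(\<Sum>v\<in>?I. nc_scale (if v = map \<sigma> w then 1 else 0) (nc_mono v))
        = (\<Sum>v\<in>?I. if v = map \<sigma> w then nc_mono v else 0)"
      by (intro sum.cong refl) simp
    also have "\<dots> = nc_mono (map \<sigma> w)"
      using finite_words \<open>map \<sigma> w \<in> ?I\<close> by (subst sum.delta) auto
    finally show "nc_act \<sigma> (nc_mono w) = (\<Sum>v\<in>?I. nc_scale (if v = map \<sigma> w then 1 else 0) (nc_mono v))"
      by simp
  qed
  also have "\<dots> = of_nat (card {w\<in>?I. w = map \<sigma> w})"
    using finite_words by (simp add: sum.If_cases Int_def)
  also have "{w\<in>?I. w = map \<sigma> w} = {w. set w \<subseteq> {i\<in>{1..n}. \<sigma> i = i} \<and> length w = k}"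
  proof -
    have "w = map \<sigma> w \<longleftrightarrow> (\<forall>i\<in>set w. \<sigma> i = i)" for w
      by (metis map_idI map_eq_conv list.map_ident)
    then show ?thesis
      by blast
  qed
  also have "card \<dots> = card {i\<in>{1..n}. \<sigma> i = i} ^ k"
    by (rule card_lists_length_eq) simp
  finally show ?thesis .
qed

lemma nc_A'_part_basis:
  obtains B where "finite B" "nc.independent B" "nc.span B = nc_A'_part n k"
proof -
  obtain B where B: "B \<subseteq> nc_A'_part n k" "nc.independent B" "nc_A'_part n k \<subseteq> nc.span B"
    using nc.maximal_independent_subset by blast
  have "B \<subseteq> nc.span (nc_mono ` {w. set w \<subseteq> {1..n} \<and> length w = k})"
    using B(1) nc_A'_subset_words [of n] unfolding nc_words_hom_span [symmetric] nc_graded_part_eq by blast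
  then have "finite B"
    using nc.independent_span_bound [OF finite_imageI [OF finite_words] B(2)] by blast
  moreover have "nc.span B = nc_A'_part n k"
    using B nc.span_minimal [OF B(1) subspace_nc_A'_part] by blast
  ultimately show ?thesis
    using that B(2) by blast
qed

lemma finite_msets: "finite {m. set_mset m \<subseteq> {1..n::nat} \<and> size m \<le> k}"
proof -
  have "{m. set_mset m \<subseteq> {1..n::nat} \<and> size m \<le> k}
      \<subseteq> mset ` {w. set w \<subseteq> {1..n} \<and> length w \<le> k}"
  proof
    fix m assume "m \<in> {m. set_mset m \<subseteq> {1..n::nat} \<and> size m \<le> k}"
    moreover obtain w where "m = mset w"
      by (metis ex_mset)
    ultimately show "m \<in> mset ` {w. set w \<subseteq> {1..n} \<and> length w \<le> k}"
      by auto
  qed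
  then show ?thesis
    by (rule finite_subset) (intro finite_imageI finite_lists_length_le, simp)
qed

text \<open>In the basis of products of a symmetrised monomial and a basis element of
  \<open>nc_A' n\<close>, the permutation carries the block of \<open>m\<close> to the block of
  \<open>image_mset \<sigma> m\<close>. Only invariant \<open>m\<close> meet the diagonal, and such
  a block has the trace on the part of \<open>nc_A' n\<close> of complementary degree.\<close>

lemma trace_words_decompose:
  assumes \<sigma>: "\<sigma> permutes {1..n}"
  shows "nc_trace_on (nc_words n \<inter> nc_hom k) (nc_act \<sigma>) =
    (\<Sum>m | set_mset m \<subseteq> {1..n} \<and> size m \<le> k \<and> image_mset \<sigma> m = m.
      nc_trace_on (nc_A'_part n (k - size m)) (nc_act \<sigma>))"
proof -
  let ?M = "{m. set_mset m \<subseteq> {1..n} \<and> size m \<le> k}"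
  have "\<exists>B. finite B \<and> nc.independent B \<and> nc.span B = nc_A'_part n j" for j
    by (rule nc_A'_part_basis [of n j]) blast
  then obtain B where B: "\<And>j. finite (B j)" "\<And>j. nc.independent (B j)" "\<And>j. nc.span (B j)
      = nc_A'_part n j"
    by metis
  have BA: "b \<in> nc_A'_part n j" if "b \<in> B j" for b j
    using that B(3) nc.span_base by blast
  let ?I = "Sigma ?M (\<lambda>m. B (k - size m))"
  let ?e = "\<lambda>(m, b). nc_sym m * b"
  define R where "R j b = nc.representation (B j) (nc_act \<sigma> b)" for j b
  let ?N = "\<lambda>(m', b') (m, b). if m' = image_mset \<sigma> m then R (k - size m) b b' else 0"
  have finI: "finite ?I"
    using finite_msets B(1) by blast
  have M\<sigma>: "image_mset \<sigma> m \<in> ?M" if "m \<in> ?M" for m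
    using that permutes_in_image [OF \<sigma>] by auto
  have act: "nc_act \<sigma> b = (\<Sum>b'\<in>B j. nc_scale (R j b b') b')" if "b \<in> B j" for b j
    unfolding R_def using B nc_act_A'_part [OF \<sigma> BA [OF that]]
    by (subst nc.sum_representation_eq) auto
  have "nc_trace_on (nc_words n \<inter> nc_hom k) (nc_act \<sigma>) = (\<Sum>i\<in>?I. ?N i i)"
  proof (rule nc.trace_on_family [where M = ?N, OF finI _ _ linear_nc_act])
    show "nc.span (?e ` ?I) = nc_words n \<inter> nc_hom k"
    proof
      show "nc.span (?e ` ?I) \<subseteq> nc_words n \<inter> nc_hom k"
        unfolding nc_words_hom_sym using BA by (intro nc.span_mono) auto
      have "nc_sym m * u \<in> nc.span (?e ` ?I)" if "m \<in> ?M" "u \<in> nc_A'_part n (k - size m)" for m u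
      proof (rule span_mult)
        show "nc_sym m \<in> nc.span {nc_sym m}" "u \<in> nc.span (B (k - size m))"
          using that(2) by (simp_all add: B(3) nc.span_base)
        show "a * b \<in> nc.span (?e ` ?I)" if "a \<in> {nc_sym m}" "b \<in> B (k - size m)" for a b
          using that \<open>m \<in> ?M\<close> by (intro nc.span_base image_eqI [of _ _ "(m, b)"]) auto
      qed simp
      then show "nc_words n \<inter> nc_hom k \<subseteq> nc.span (?e ` ?I)"
        unfolding nc_words_hom_sym by (intro nc.span_minimal) auto
    qed
  next
    fix c assume "(\<Sum>i\<in>?I. nc_scale (c i) (?e i)) = 0"
    moreover have "(\<Sum>i\<in>?I. nc_scale (c i) (?e i))
        = (\<Sum>m\<in>?M. \<Sum>b\<in>B (k - size m). nc_scale (c (m, b)) (nc_sym m * b))"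
      using finite_msets B(1) by (subst sum.Sigma) (auto intro!: sum.cong)
    ultimately have c: "(\<Sum>m\<in>?M. nc_sym m * (\<Sum>b\<in>B (k - size m). nc_scale (c (m, b)) b)) = 0"
      by (simp add: sum_distrib_left nc_scale_mult)
    \<comment> \<open>A relation is first collected by \<open>m\<close>, so that its coefficients
      lie in \<open>nc_A' n\<close> and are killed by every derivative; only then is the
      independence of \<open>B\<close> used.\<close>
    have "(\<Sum>b\<in>B (k - size m). nc_scale (c (m, b)) b) = 0" if "m \<in> ?M" for m
    proof (rule nc_sym_independent [where d = k, OF finite_msets _ _ c that])
      fix m i
      have "(\<Sum>b\<in>B (k - size m). nc_scale (c (m, b)) b) \<in> nc_A'_part n (k - size m)"
        using BA by (intro nc.subspace_sum nc.subspace_scale subspace_nc_A'_part)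
      then show "nc_pd i (\<Sum>b\<in>B (k - size m). nc_scale (c (m, b)) b) = 0"
        by (intro nc_pd_A' [of _ n]) (simp add: nc_graded_part_eq)
    qed simp
    then have "c (m, b) = 0" if "m \<in> ?M" "b \<in> B (k - size m)" for m b
      using nc.independentD [OF B(2) B(1) subset_refl, where u = "\<lambda>b. c (m, b)"] that by blast
    then show "\<forall>i\<in>?I. c i = 0"
      by blast
  next
    fix i assume "i \<in> ?I"
    then obtain m b where i: "i = (m, b)" "m \<in> ?M" "b \<in> B (k - size m)"
      by blast
    have "nc_act \<sigma> (?e i) = nc_sym (image_mset \<sigma> m) * (\<Sum>b'\<in>B (k - size m). nc_scale (R (k - size m) b b') b')"
      using i(1) act [OF i(3)] by (simp add: nc_act_mult nc_act_sym [OF permutes_inj [OF \<sigma>]])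
    \<comment> \<open>\<open>image_mset\<close> preserves the size, so on the only surviving index
      \<open>k - size m'\<close> equals \<open>k - size m\<close> and the basis is the same.\<close>
    also have "\<dots> = (\<Sum>m'\<in>?M. if m' = image_mset \<sigma> m then
        \<Sum>b'\<in>B (k - size m'). nc_scale (R (k - size m) b b') (nc_sym m' * b') else 0)"
      using finite_msets M\<sigma> [OF i(2)]
      by (subst sum.delta) (auto simp: sum_distrib_left nc_scale_mult)
    also have "\<dots> = (\<Sum>m'\<in>?M. \<Sum>b'\<in>B (k - size m'). nc_scale (?N (m', b') i) (?e (m', b')))"
      using i(1) by (intro sum.cong refl) auto
    also have "\<dots> = (\<Sum>j\<in>?I. nc_scale (?N j i) (?e j))"
      using finite_msets B(1) by (subst sum.Sigma) (auto intro!: sum.cong)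
    finally show "nc_act \<sigma> (?e i) = (\<Sum>j\<in>?I. nc_scale (?N j i) (?e j))" .
  qed
  also have "\<dots> = (\<Sum>m\<in>?M. \<Sum>b\<in>B (k - size m). ?N (m, b) (m, b))"
    using finite_msets B(1) by (subst sum.Sigma) (auto intro!: sum.cong)
  also have "\<dots> = (\<Sum>m\<in>?M. if image_mset \<sigma> m = m then nc_trace_on (nc_A'_part n (k - size m)) (nc_act \<sigma>) else 0)"
  proof (intro sum.cong refl)
    fix m :: "nat multiset"
    have "nc_trace_on (nc_A'_part n (k - size m)) (nc_act \<sigma>)
        = (\<Sum>b\<in>B (k - size m). R (k - size m) b b)"
      unfolding R_def by (rule nc.trace_on_basis [OF B linear_nc_act nc_act_A'_part [OF \<sigma>]])
    then show "(\<Sum>b\<in>B (k - size m). ?N (m, b) (m, b)) =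
        (if image_mset \<sigma> m = m then nc_trace_on (nc_A'_part n (k - size m)) (nc_act \<sigma>) else 0)"
      by auto
  qed
  also have "\<dots> = (\<Sum>m | set_mset m \<subseteq> {1..n} \<and> size m \<le> k \<and> image_mset \<sigma> m = m.
      nc_trace_on (nc_A'_part n (k - size m)) (nc_act \<sigma>))"
    using finite_msets [of n k] by (simp add: sum.If_cases Int_def conj_assoc)
  finally show ?thesis .
qed

section \<open>Colourings invariant under a permutation\<close>

text \<open>
  The coefficient extraction is abstract so as to cover both symmetric functions, graded by
  monomials, and power series in \<open>q\<close>, graded by degree.
\<close>

lemma prod_coeff_card:
  fixes coef :: "'r::comm_monoid_mult \<Rightarrow> 'm::comm_monoid_add \<Rightarrow> 'a::comm_semiring_1"
    and W :: "'i \<Rightarrow> 'v \<Rightarrow> 'm"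
  assumes fin: "\<And>m::'m. finite {(a, b). a + b = m}"
    and one: "\<And>m. coef 1 m = (if m = 0 then 1 else 0)"
    and mult: "\<And>x y m. coef (x * y) m = (\<Sum>(a, b) | a + b = m. coef x a * coef y b)"
    and I: "finite I"
    and P: "\<And>i m. i \<in> I \<Longrightarrow> finite {v. W i v = m} \<and> coef (P i) m = of_nat (card {v. W i v = m})"
  shows "finite {c \<in> I \<rightarrow>\<^sub>E UNIV. (\<Sum>i\<in>I. W i (c i)) = m} \<and>
    coef (\<Prod>i\<in>I. P i) m = of_nat (card {c \<in> I \<rightarrow>\<^sub>E UNIV. (\<Sum>i\<in>I. W i (c i)) = m})"
  using I P
proof (induction I arbitrary: m rule: finite_induct)
  case empty
  have "{c \<in> {} \<rightarrow>\<^sub>E (UNIV :: 'v set). (\<Sum>i\<in>{}. W i (c i)) = m}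
      = (if m = 0 then {\<lambda>_. undefined} else {})"
    by (auto simp: PiE_empty_domain)
  then show ?case
    by (auto simp: one)
next
  case (insert j I)
  define C where "C m = {c \<in> I \<rightarrow>\<^sub>E (UNIV :: 'v set). (\<Sum>i\<in>I. W i (c i)) = m}" for m
  let ?V = "\<lambda>m. {v. W j v = m}"
  have C: "finite (C m)" "coef (\<Prod>i\<in>I. P i) m = of_nat (card (C m))" for m
    using insert.IH [of m] insert.prems unfolding C_def by auto
  have V: "finite (?V m)" "coef (P j) m = of_nat (card (?V m))" for m
    using insert.prems [of j m] by auto
  let ?f = "\<lambda>(v, c). c(j := v)"
  let ?U = "\<Union>(a, b)\<in>{(a, b). a + b = m}. ?V a \<times> C b"
  have upd: "(\<Sum>i\<in>I. W i ((c(j := v)) i)) = (\<Sum>i\<in>I. W i (c i))" for c v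
    using insert.hyps by (intro sum.cong) auto
  have eq: "{c \<in> insert j I \<rightarrow>\<^sub>E UNIV. (\<Sum>i\<in>insert j I. W i (c i)) = m} = ?f ` ?U"
  proof (intro equalityI subsetI)
    fix c assume c: "c \<in> {c \<in> insert j I \<rightarrow>\<^sub>E (UNIV :: 'v set). (\<Sum>i\<in>insert j I. W i (c i)) = m}"
    then obtain v c' where vc: "c = c'(j := v)" "c' \<in> I \<rightarrow>\<^sub>E UNIV"
      unfolding PiE_insert_eq by auto
    have "W j v + (\<Sum>i\<in>I. W i (c' i)) = m"
      using c insert.hyps upd [of c' v] unfolding vc(1) by simp
    then show "c \<in> ?f ` ?U"
      using vc by (intro image_eqI [of _ _ "(v, c')"]) (auto simp: C_def)
  next
    fix c assume "c \<in> ?f ` ?U"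
    then obtain v c' where "c = c'(j := v)" "c' \<in> I \<rightarrow>\<^sub>E UNIV" "W j v + (\<Sum>i\<in>I. W i (c' i)) = m"
      by (auto simp: C_def)
    then show "c \<in> {c \<in> insert j I \<rightarrow>\<^sub>E UNIV. (\<Sum>i\<in>insert j I. W i (c i)) = m}"
      using insert.hyps upd [of c' v] by (auto simp: PiE_insert_eq simp del: fun_upd_apply) auto
  qed
  have inj: "inj_on ?f ?U"
  proof (rule inj_on_subset)
    show "inj_on ?f (UNIV \<times> (I \<rightarrow>\<^sub>E UNIV))"
      using insert.hyps(2) by (rule inj_combinator)
  qed (auto simp: C_def)
  have finU: "finite ?U"
    using fin V C by auto
  have "card ?U = (\<Sum>(a, b) | a + b = m. card (?V a) * card (C b))"
    using fin V C by (subst card_UN_disjoint) (auto simp: case_prod_beta C_def card_cartesian_product)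
  then have "coef (\<Prod>i\<in>insert j I. P i) m = of_nat (card ?U)"
    using insert.hyps by (simp add: mult V C case_prod_beta)
  then show ?case
    unfolding eq using finU by (simp add: card_image [OF inj])
qed

section \<open>Functions constant on the orbits\<close>

lemma orbit_eq_iff:
  assumes "\<sigma> permutes S" "finite S"
  shows "orbit \<sigma> y = orbit \<sigma> x \<longleftrightarrow> y \<in> orbit \<sigma> x"
proof
  have self: "y \<in> orbit \<sigma> y" for y
    using assms by (metis permutation_permutes permutation_self_in_orbit)
  show "y \<in> orbit \<sigma> x" if "orbit \<sigma> y = orbit \<sigma> x"
    using self [of y] that by simp
  show "orbit \<sigma> y = orbit \<sigma> x" if "y \<in> orbit \<sigma> x"
    using orbit_trans [of _ \<sigma> y x] orbit_trans [of _ \<sigma> x y] orbit_swap [OF self that] that by blast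
qed

lemma orbit_fibre:
  assumes "\<sigma> permutes S" "finite S" "x \<in> S"
  shows "{y \<in> S. orbit \<sigma> y = orbit \<sigma> x} = orbit \<sigma> x"
  using permutes_orbit_subset [OF assms(1,3)] by (auto simp: orbit_eq_iff [OF assms(1,2)])

lemma invariant_on_orbit:
  assumes "\<sigma> permutes S" "x \<in> S" "\<And>x. x \<in> S \<Longrightarrow> g (\<sigma> x) = g x" "y \<in> orbit \<sigma> x"
  shows "g y = g x"
  using assms(4)
proof induction
  case (step y)
  then have "y \<in> S"
    using permutes_orbit_subset [OF assms(1,2)] by blast
  with step show ?case
    by (simp add: assms(3))
qed (use assms in auto)

text \<open>A function invariant under \<sigma> amounts to one value per orbit, and an orbit of size
  \<open>k\<close> counts the weight of its value \<open>k\<close> times; so the product over the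
  orbits generates the invariant functions by weight.\<close>

lemma orbit_prod_coeff_card:
  fixes coef :: "'r::comm_monoid_mult \<Rightarrow> 'm::comm_monoid_add \<Rightarrow> 'a::comm_semiring_1"
    and w :: "'v \<Rightarrow> 'm" and S :: "'b set"
  assumes fin: "\<And>m::'m. finite {(a, b). a + b = m}"
    and one: "\<And>m. coef 1 m = (if m = 0 then 1 else 0)"
    and mult: "\<And>x y m. coef (x * y) m = (\<Sum>(a, b) | a + b = m. coef x a * coef y b)"
    and P: "\<And>k m. k > 0 \<Longrightarrow> finite {v. (\<Sum>i<k. w v) = m} \<and>
      coef (P k) m = of_nat (card {v. (\<Sum>i<k. w v) = m})"
    and \<sigma>: "\<sigma> permutes S" and S: "finite S"
  shows "coef (\<Prod>C\<in>orbit \<sigma> ` S. P (card C)) m =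
    of_nat (card {g \<in> S \<rightarrow>\<^sub>E UNIV. (\<forall>x\<in>S. g (\<sigma> x) = g x) \<and> (\<Sum>x\<in>S. w (g x)) = m})"
proof -
  let ?O = "orbit \<sigma> ` S"
  have orbS: "orbit \<sigma> x \<subseteq> S" if "x \<in> S" for x
    using permutes_orbit_subset [OF \<sigma> that] .
  have W: "(\<Sum>x\<in>C. w v) = (\<Sum>i<card C. w v)" if "C \<in> ?O" for C v
  proof -
    have "finite C"
      using that orbS S finite_subset by blast
    then obtain h where "bij_betw h {..<card C} C"
      using ex_bij_betw_nat_finite atLeast0LessThan by metis
    then show ?thesis
      using sum.reindex_bij_betw [of h _ C "\<lambda>_. w v"] by simp
  qed
  have PC: "finite {v. (\<Sum>x\<in>C. w v) = m} \<and>
      coef (P (card C)) m = of_nat (card {v. (\<Sum>x\<in>C. w v) = m})" if "C \<in> ?O" for C m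
  proof -
    have "C \<noteq> {}"
      using that orbit_nonempty [of \<sigma>] by auto
    moreover have "finite C"
      using that orbS S finite_subset by blast
    ultimately have "card C > 0"
      by (simp add: card_gt_0_iff)
    then show ?thesis
      using P [of "card C" m] by (simp only: W [OF that])
  qed
  define F where "F = (\<lambda>c :: 'b set \<Rightarrow> 'v. \<lambda>x\<in>S. c (orbit \<sigma> x))"
  \<comment> \<open>The value on an orbit is read off at an arbitrary representative. Both maps are
    restricted, so that outside their domains they take the default value required by the
    extensional function spaces.\<close>
  define G where "G = (\<lambda>g :: 'b \<Rightarrow> 'v. \<lambda>C\<in>?O. g (SOME x. x \<in> C))"
  let ?A = "{c \<in> ?O \<rightarrow>\<^sub>E UNIV. (\<Sum>C\<in>?O. \<Sum>x\<in>C. w (c C)) = m}"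
  let ?B = "{g \<in> S \<rightarrow>\<^sub>E UNIV. (\<forall>x\<in>S. g (\<sigma> x) = g x) \<and> (\<Sum>x\<in>S. w (g x)) = m}"
  have "bij_betw F ?A ?B"
  proof -
    have sum: "(\<Sum>x\<in>S. w (F c x)) = (\<Sum>C\<in>?O. \<Sum>x\<in>C. w (c C))" for c
    proof -
      have "(\<Sum>x\<in>S. w (F c x)) = (\<Sum>C\<in>?O. \<Sum>x\<in>{x \<in> S. orbit \<sigma> x = C}. w (F c x))"
        by (rule sum.image_gen [OF S])
      also have "\<dots> = (\<Sum>C\<in>?O. \<Sum>x\<in>C. w (c C))"
      proof (rule sum.cong [OF refl])
        fix C assume "C \<in> ?O"
        then have C: "{x \<in> S. orbit \<sigma> x = C} = C"
          using orbit_fibre [OF \<sigma> S] by auto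
        show "(\<Sum>x\<in>{x \<in> S. orbit \<sigma> x = C}. w (F c x)) = (\<Sum>x\<in>C. w (c C))"
          by (intro sum.cong C) (use C in \<open>auto simp: F_def\<close>)
      qed
      finally show ?thesis .
    qed
    have \<sigma>S: "\<sigma> x \<in> S" "orbit \<sigma> (\<sigma> x) = orbit \<sigma> x" if "x \<in> S" for x
      using that \<sigma> by (auto simp: permutes_in_image orbit_eq_iff [OF \<sigma> S] orbit.base)
    have FA: "F c \<in> ?B" if "c \<in> ?A" for c
      using that sum [of c] by (auto simp: \<sigma>S F_def)
    have some: "(SOME y. y \<in> orbit \<sigma> x) \<in> orbit \<sigma> x" for x
      unfolding some_in_eq by (rule orbit_nonempty)
    have FG: "F (G g) = g" if "g \<in> ?B" for g
    proof (rule ext)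
      fix x
      show "F (G g) x = g x"
      proof (cases "x \<in> S")
        case True
        have "g (SOME y. y \<in> orbit \<sigma> x) = g x"
          by (rule invariant_on_orbit [where g = g, OF \<sigma> True _ some], use that in blast)
        with True show ?thesis
          by (simp add: F_def G_def)
      next
        case False
        then have "F (G g) x = undefined"
          by (simp add: F_def)
        moreover have "g x = undefined"
          using that False by (blast intro: PiE_arb)
        ultimately show ?thesis
          by simp
      qed
    qed
    have GB: "G g \<in> ?A" if "g \<in> ?B" for g
    proof -
      have "(\<Sum>C\<in>?O. \<Sum>x\<in>C. w (G g C)) = m"
        using sum [of "G g"] that unfolding FG [OF that] by simp
      moreover have "G g \<in> ?O \<rightarrow>\<^sub>E UNIV"
        by (simp add: G_def)
      ultimately show ?thesis
        by blast
    qed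
    have GF: "G (F c) = c" if "c \<in> ?A" for c
    proof (rule ext)
      fix C
      show "G (F c) C = c C"
      proof (cases "C \<in> ?O")
        case True
        then obtain x where x: "x \<in> S" "C = orbit \<sigma> x"
          by auto
        define y where "y = (SOME y. y \<in> C)"
        have "y \<in> C"
          using some [of x] by (simp add: y_def x)
        then have "y \<in> S" "orbit \<sigma> y = C"
          using orbS [OF x(1)] by (auto simp: x orbit_eq_iff [OF \<sigma> S])
        with True show ?thesis
          by (simp add: G_def F_def flip: y_def)
      next
        case False
        then have "G (F c) C = undefined"
          by (simp add: G_def)
        moreover have "c C = undefined"
          using that False by (blast intro: PiE_arb)
        ultimately show ?thesis
          by simp
      qed
    qed
    show ?thesis
      by (rule bij_betw_byWitness [where f' = G])
        (rule ballI, erule GF, rule ballI, erule FG, rule image_subsetI, erule FA,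
          rule image_subsetI, erule GB)
  qed
  then have "card ?A = card ?B"
    by (rule bij_betw_same_card)
  moreover have "coef (\<Prod>C\<in>?O. P (card C)) m = of_nat (card ?A)"
    by (rule conjunct2 [OF prod_coeff_card [where W = "\<lambda>C v. \<Sum>x\<in>C. w v",
            OF fin one mult finite_imageI [OF S] PC]])
  ultimately show ?thesis
    by simp
qed

section \<open>Complete homogeneous symmetric functions as averages of power sums\<close>

lemma symf_eqI: "(\<And>m. symf_coeff f m = symf_coeff g m) \<Longrightarrow> f = g"
  by (simp add: symf_coeff_inject [symmetric] fun_eq_iff)

global_interpretation symf: module "symf_scale :: 'a::comm_ring_1 \<Rightarrow> _"
  by standard
    (auto intro!: symf_eqI simp: symf_scale.rep_eq plus_symf.rep_eq algebra_simps)

lemma symf_scale_mult: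
  fixes f g :: "'a::comm_ring_1 symf"
  shows "symf_scale c f * g = symf_scale c (f * g)" "f * symf_scale c g = symf_scale c (f * g)"
proof -
  have *: "symf_scale c f * g = symf_scale c (f * g)" for f g :: "'a symf"
    by (rule symf_eqI)
      (simp add: symf_scale.rep_eq times_symf.rep_eq sum_distrib_left case_prod_beta mult.assoc)
  show "symf_scale c f * g = symf_scale c (f * g)"
    by (rule *)
  show "f * symf_scale c g = symf_scale c (f * g)"
    using * [of g f] by (simp add: mult.commute)
qed

text \<open>Fixed points contribute \<open>symf_p 1\<close> to the power sum of the cycle type,
  which is how powers of \<open>symf_h 1\<close> arise.\<close>

lemma symf_h_1: "symf_h 1 = symf_p 1"
proof (rule symf_eqI)
  fix m :: "nat multiset"
  have "size m = 1 \<longleftrightarrow> (\<exists>i. m = replicate_mset 1 i)"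
    by (auto simp: size_1_singleton_mset)
  then show "symf_coeff (symf_h 1) m = symf_coeff (symf_p 1 :: 'a symf) m"
    by (simp add: symf_h.rep_eq symf_p.rep_eq)
qed

text \<open>\<open>cycle_power_sum\<close> on an arbitrary set, since a later induction removes
  fixed points from it.\<close>

definition orbit_power_sum :: "nat set \<Rightarrow> (nat \<Rightarrow> nat) \<Rightarrow> 'a::comm_ring_1 symf" where
  "orbit_power_sum S \<sigma> = (\<Prod>C\<in>orbit \<sigma> ` S. symf_p (card C))"

lemma sum_single_mset: "finite S \<Longrightarrow> (\<Sum>x\<in>S. {#g x#}) = image_mset g (mset_set S)"
  by (induction S rule: finite_induct) auto

text \<open>A term in the product of power sums chooses one variable for each cycle, that is, a
  colouring constant on the cycles, and its monomial is the content of that colouring.\<close>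

lemma orbit_power_sum_coeff:
  assumes \<sigma>: "\<sigma> permutes S" and S: "finite S"
  shows "symf_coeff (orbit_power_sum S \<sigma> :: 'a::comm_ring_1 symf) m =
    of_nat (card {g \<in> S \<rightarrow>\<^sub>E UNIV. (\<forall>x\<in>S. g (\<sigma> x) = g x) \<and> image_mset g (mset_set S) = m})"
proof -
  have rep: "(\<Sum>i<k. {#v#}) = replicate_mset k v" for k and v :: nat
    by (induction k) auto
  have P: "finite {v. (\<Sum>i<k. {#v#}) = m} \<and>
      symf_coeff (symf_p k :: 'a symf) m = of_nat (card {v. (\<Sum>i<k. {#v#}) = m})"
    if "k > 0" for k and m :: "nat multiset"
  proof (cases "\<exists>i. m = replicate_mset k i")
    case True
    then obtain i where i: "m = replicate_mset k i" ..
    \<comment> \<open>\<open>k > 0\<close> matters: \<open>replicate_mset 0 v\<close> is the same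
      for all \<open>v\<close>.\<close>
    have "replicate_mset k v = replicate_mset k i \<longleftrightarrow> v = i" for v
      using that by (metis count_replicate_mset not_gr_zero)
    then have "{v. (\<Sum>i<k. {#v#}) = m} = {i}"
      by (simp add: rep i)
    with True show ?thesis
      by (simp add: symf_p.rep_eq)
  next
    case False
    then have "{v. (\<Sum>i<k. {#v#}) = m} = {}"
      by (auto simp: rep)
    with False show ?thesis
      by (simp add: symf_p.rep_eq)
  qed
  show ?thesis
    unfolding orbit_power_sum_def
    by (subst orbit_prod_coeff_card [where coef = symf_coeff and w = "\<lambda>v. {#v#}", OF finite_mset_splits _ _ P \<sigma> S])
      (simp_all add: one_symf.rep_eq times_symf.rep_eq sum_single_mset [OF S])
qed

text \<open>
  Fix one colouring \<open>g\<^sub>0\<close> with content \<open>m\<close>.  The stabiliser of any other one, \<open>g\<close>, is as large as the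
  set of all \<open>\<sigma>\<close> with \<open>g\<^sub>0 \<circ> \<sigma> = g\<close>, and these sets partition the symmetric group.
\<close>

lemma card_invariant_colourings:
  assumes S: "finite S" and m: "size m = card S"
  shows "(\<Sum>\<sigma> | \<sigma> permutes S.
    card {g \<in> S \<rightarrow>\<^sub>E UNIV. (\<forall>x\<in>S. g (\<sigma> x) = g x) \<and> image_mset g (mset_set S) = m}) = fact (card S)"
proof -
  let ?P = "{\<sigma>. \<sigma> permutes S}"
  let ?G = "{g \<in> S \<rightarrow>\<^sub>E UNIV. image_mset g (mset_set S) = m}"
  have finP: "finite ?P"
    using S by (rule finite_permutations)
  have "?G \<subseteq> S \<rightarrow>\<^sub>E set_mset m"
    using S by (auto simp: PiE_def Pi_def)
  then have finG: "finite ?G"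
    by (rule finite_subset) (simp add: finite_PiE S)
  obtain xs where xs: "m = mset xs"
    by (metis ex_mset)
  obtain ys where ys: "set ys = S" "distinct ys"
    using finite_distinct_list [OF S] by blast
  have len: "length xs = length ys"
    using m xs ys distinct_card by force
  \<comment> \<open>Any colouring with content \<open>m\<close> will do; this one lays a list of the
    elements of \<open>m\<close> along an enumeration of \<open>S\<close>.\<close>
  obtain g0 where g0: "image_mset g0 (mset_set S) = m"
  proof
    have "map (the \<circ> map_of (zip ys xs)) ys = xs"
      by (rule nth_equalityI) (use len ys in \<open>simp_all add: map_of_zip_nth\<close>)
    then show "image_mset (the \<circ> map_of (zip ys xs)) (mset_set S) = m"
      using ys by (metis mset_map mset_set_set xs)
  qed
  have count: "card {\<sigma> \<in> ?P. \<forall>x\<in>S. g (\<sigma> x) = g x} = card {\<sigma> \<in> ?P. \<forall>x\<in>S. g0 (\<sigma> x) = g x}"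
    if "g \<in> ?G" for g
  proof -
    have "image_mset g (mset_set S) = image_mset g0 (mset_set S)"
      using that g0 by simp
    then obtain \<tau> where \<tau>: "\<tau> permutes S" "\<forall>x\<in>S. g x = g0 (\<tau> x)"
      using image_mset_eq_implies_permutes [OF S] by blast
    \<comment> \<open>As \<open>g\<close> is \<open>g0\<close> after \<tau>, composing with \<tau>
      carries the stabiliser of \<open>g\<close> onto the set of all \<sigma> for which
      \<open>g0\<close> after \<sigma> equals \<open>g\<close>.\<close>
    have "bij_betw ((\<circ>) \<tau>) {\<sigma> \<in> ?P. \<forall>x\<in>S. g (\<sigma> x) = g x} {\<sigma> \<in> ?P. \<forall>x\<in>S. g0 (\<sigma> x) = g x}"
    proof (rule bij_betwI [where g = "(\<circ>) (inv \<tau>)"])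
      show "(\<circ>) \<tau> \<in> {\<sigma> \<in> ?P. \<forall>x\<in>S. g (\<sigma> x) = g x} \<rightarrow> {\<sigma> \<in> ?P. \<forall>x\<in>S. g0 (\<sigma> x) = g x}"
        using \<tau> by (auto simp: permutes_in_image intro!: permutes_compose)
      show "(\<circ>) (inv \<tau>) \<in> {\<sigma> \<in> ?P. \<forall>x\<in>S. g0 (\<sigma> x) = g x} \<rightarrow> {\<sigma> \<in> ?P. \<forall>x\<in>S. g (\<sigma> x) = g x}"
      proof
        fix \<sigma> assume \<sigma>: "\<sigma> \<in> {\<sigma> \<in> ?P. \<forall>x\<in>S. g0 (\<sigma> x) = g x}"
        have "g ((inv \<tau> \<circ> \<sigma>) x) = g x" if "x \<in> S" for x
        proof -
          have "\<sigma> x \<in> S"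
            using \<sigma> that by (simp add: permutes_in_image)
          then have "inv \<tau> (\<sigma> x) \<in> S"
            using permutes_in_image [OF permutes_inv [OF \<tau>(1)]] by blast
          with \<tau>(2) have "g (inv \<tau> (\<sigma> x)) = g0 (\<sigma> x)"
            using permutes_inverses(1) [OF \<tau>(1)] by simp
          with \<sigma> that show ?thesis
            by simp
        qed
        with \<sigma> show "inv \<tau> \<circ> \<sigma> \<in> {\<sigma> \<in> ?P. \<forall>x\<in>S. g (\<sigma> x) = g x}"
          using permutes_compose [OF _ permutes_inv [OF \<tau>(1)]] by blast
      qed
    qed (simp_all add: o_assoc permutes_inv_o [OF \<tau>(1)])
    then show ?thesis
      by (rule bij_betw_same_card)
  qed
  have "(\<Sum>\<sigma>\<in>?P. card {g \<in> S \<rightarrow>\<^sub>E UNIV. (\<forall>x\<in>S. g (\<sigma> x) = g x) \<and> image_mset g (mset_set S) = m})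
      = (\<Sum>\<sigma>\<in>?P. card {g \<in> ?G. \<forall>x\<in>S. g (\<sigma> x) = g x})"
    by (intro sum.cong refl arg_cong [of _ _ card]) auto
  also have "\<dots> = (\<Sum>g\<in>?G. card {\<sigma> \<in> ?P. \<forall>x\<in>S. g (\<sigma> x) = g x})"
    using sum.swap_restrict [OF finP finG, of "\<lambda>_ _. 1 :: nat" "\<lambda>\<sigma> g. \<forall>x\<in>S. g (\<sigma> x) = g x"]
    by simp
  also have "\<dots> = (\<Sum>g\<in>?G. card {\<sigma> \<in> ?P. \<forall>x\<in>S. g0 (\<sigma> x) = g x})"
    by (intro sum.cong refl count)
  also have "\<dots> = (\<Sum>\<sigma>\<in>?P. card {g \<in> ?G. \<forall>x\<in>S. g0 (\<sigma> x) = g x})"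
    using sum.swap_restrict [OF finP finG, of "\<lambda>_ _. 1 :: nat" "\<lambda>\<sigma> g. \<forall>x\<in>S. g0 (\<sigma> x) = g x"]
    by simp
  \<comment> \<open>Every \<sigma> is counted for exactly one \<open>g\<close>, the restriction of
    \<open>g0\<close> after \<sigma>.\<close>
  also have "\<dots> = (\<Sum>\<sigma>\<in>?P. 1)"
  proof (intro sum.cong refl)
    fix \<sigma> assume "\<sigma> \<in> ?P"
    then have \<sigma>: "\<sigma> permutes S"
      by simp
    have "image_mset (\<lambda>x\<in>S. g0 (\<sigma> x)) (mset_set S) = image_mset (g0 \<circ> \<sigma>) (mset_set S)"
      using S by (intro image_mset_cong) simp
    also have "\<dots> = image_mset g0 (mset_set (\<sigma> ` S))"
      using permutes_inj_on [OF \<sigma>] by (simp flip: multiset.map_comp add: image_mset_mset_set)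
    also have "\<dots> = m"
      using \<sigma> g0 by (simp add: permutes_image)
    finally have "{g \<in> ?G. \<forall>x\<in>S. g0 (\<sigma> x) = g x} = {\<lambda>x\<in>S. g0 (\<sigma> x)}"
      by (auto simp: fun_eq_iff PiE_def extensional_def)
    then show "card {g \<in> ?G. \<forall>x\<in>S. g0 (\<sigma> x) = g x} = 1"
      by simp
  qed
  also have "\<dots> = fact (card S)"
    using card_permutations [OF refl S] by simp
  finally show ?thesis .
qed

text \<open>The classical expansion of \<open>symf_h\<close> over cycle types, multiplied by the
  factorial so that it makes sense over every commutative ring. A monomial of another degree is the
  content of no colouring.\<close>

lemma sum_orbit_power_sum:
  assumes S: "finite S"
  shows "(\<Sum>\<sigma> | \<sigma> permutes S. orbit_power_sum S \<sigma>)
    = symf_scale (of_nat (fact (card S))) (symf_h (card S) :: 'a::comm_ring_1 symf)"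
proof (rule symf_eqI)
  fix m :: "nat multiset"
  have "symf_coeff (\<Sum>\<sigma> | \<sigma> permutes S. orbit_power_sum S \<sigma> :: 'a symf) m
      = of_nat (\<Sum>\<sigma> | \<sigma> permutes S.
      card {g \<in> S \<rightarrow>\<^sub>E UNIV. (\<forall>x\<in>S. g (\<sigma> x) = g x) \<and> image_mset g (mset_set S) = m})"
    unfolding symf_coeff_sum of_nat_sum
    by (intro sum.cong refl orbit_power_sum_coeff S) simp
  also have "(\<Sum>\<sigma> | \<sigma> permutes S. card {g \<in> S \<rightarrow>\<^sub>E UNIV. (\<forall>x\<in>S. g (\<sigma> x) = g x) \<and>
      image_mset g (mset_set S) = m}) = (if size m = card S then fact (card S) else 0)"
  proof (cases "size m = card S")
    case False
    then have *: "{g \<in> S \<rightarrow>\<^sub>E UNIV. (\<forall>x\<in>S. g (\<sigma> x) = g x) \<and> image_mset g (mset_set S) = m} = {}" for \<sigma>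
      by auto
    show ?thesis
      using False by (simp only: * card.empty sum.neutral_const if_False)
  qed (simp add: card_invariant_colourings [OF S])
  finally show "symf_coeff (\<Sum>\<sigma> | \<sigma> permutes S. orbit_power_sum S \<sigma> :: 'a symf) m =
      symf_coeff (symf_scale (of_nat (fact (card S))) (symf_h (card S))) m"
    by (simp add: symf_scale.rep_eq symf_h.rep_eq)
qed

section \<open>Weights that count choices of fixed points\<close>

text \<open>For \<open>d > m\<close> the truncated subtraction yields a factor 0.\<close>

definition falling_fact :: "nat \<Rightarrow> nat \<Rightarrow> nat" where
  "falling_fact m d = (\<Prod>i<d. m - i)"

lemma falling_fact_0 [simp]: "falling_fact m 0 = 1"
  by (simp add: falling_fact_def)

lemma falling_fact_Suc_left: "falling_fact m (Suc d) = m * falling_fact (m - 1) d"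
  unfolding falling_fact_def prod.lessThan_Suc_shift by simp

lemma falling_fact_Suc: "falling_fact m (Suc d) = falling_fact m d * (m - d)"
  by (simp add: falling_fact_def)

lemma falling_fact_eq_0: "m < d \<Longrightarrow> falling_fact m d = 0"
  by (auto simp: falling_fact_def)

lemma permutes_fixing: "x \<in> S \<Longrightarrow> {\<sigma>. \<sigma> permutes S \<and> \<sigma> x = x} = {\<sigma>. \<sigma> permutes (S - {x})}"
  by (auto intro: permutes_superset permutes_subset permutes_not_in)

text \<open>The falling factorial of the number of fixed points is a sum over the fixed points
  \<open>x\<close> of the next shorter one for the remaining fixed points. Exchanging the sums
  leaves the permutations of \<open>S - {x}\<close>, the fixed point splits off
  \<open>symf_p 1\<close>, and the \<open>card S\<close> choices of \<open>x\<close> complete the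
  factorial.\<close>

lemma sum_falling_fact_orbit_power_sum:
  "finite S \<Longrightarrow> d \<le> card S \<Longrightarrow>
    (\<Sum>\<sigma> | \<sigma> permutes S. symf_scale (of_nat (falling_fact (card {x\<in>S. \<sigma> x = x}) d)) (orbit_power_sum S \<sigma>))
    = symf_scale (of_nat (fact (card S))) (symf_h (card S - d) * symf_h 1 ^ d :: 'a::comm_ring_1 symf)"
proof (induction d arbitrary: S)
  case 0
  then show ?case
    by (simp add: sum_orbit_power_sum)
next
  case (Suc d)
  let ?P = "\<lambda>S. {\<sigma>. \<sigma> permutes S}"
  let ?fix = "\<lambda>S \<sigma>. {x\<in>S. \<sigma> x = x}"
  let ?t = "\<lambda>S \<sigma>. symf_scale (of_nat (falling_fact (card (?fix S \<sigma>)) d)) (orbit_power_sum S \<sigma> :: 'a symf)"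
  have finP: "finite (?P S)"
    using Suc.prems(1) by (rule finite_permutations)
  have pos: "card S > 0"
    using Suc.prems(2) by simp
  have step: "symf_scale (of_nat (falling_fact (card (?fix S \<sigma>) - 1) d)) (orbit_power_sum S \<sigma>)
      = symf_h 1 * ?t (S - {x}) \<sigma>" if "x \<in> S" "\<sigma> \<in> ?P (S - {x})" for x \<sigma>
  proof -
    have \<sigma>: "\<sigma> permutes S - {x}" "\<sigma> x = x"
      using that permutes_not_in [of \<sigma> "S - {x}" x] by auto
    have "?fix (S - {x}) \<sigma> = ?fix S \<sigma> - {x}"
      by auto
    then have card: "card (?fix (S - {x}) \<sigma>) = card (?fix S \<sigma>) - 1"
      using that(1) \<sigma>(2) Suc.prems(1) by simp
    have orb: "orbit \<sigma> x = {x}"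
      using \<sigma>(2) by (simp add: orbit_eq_singleton_iff)
    have "orbit \<sigma> ` S = insert {x} (orbit \<sigma> ` (S - {x}))"
      using orb that(1) by (metis image_insert insert_Diff)
    moreover have "{x} \<notin> orbit \<sigma> ` (S - {x})"
      using permutes_orbit_subset [OF \<sigma>(1)] by blast
    ultimately have "orbit_power_sum S \<sigma> = symf_p 1 * (orbit_power_sum (S - {x}) \<sigma> :: 'a symf)"
      using Suc.prems(1) by (simp add: orbit_power_sum_def)
    then show ?thesis
      by (simp only: card symf_h_1 symf_scale_mult)
  qed
  have "(\<Sum>\<sigma>\<in>?P S. symf_scale (of_nat (falling_fact (card (?fix S \<sigma>)) (Suc d))) (orbit_power_sum S \<sigma>))
      = (\<Sum>\<sigma>\<in>?P S. \<Sum>x\<in>?fix S \<sigma>.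
          symf_scale (of_nat (falling_fact (card (?fix S \<sigma>) - 1) d)) (orbit_power_sum S \<sigma> :: 'a symf))"
    by (simp add: falling_fact_Suc_left symf.sum_constant_scale del: sum_constant)
  also have "\<dots> = (\<Sum>x\<in>S. \<Sum>\<sigma>\<in>{\<sigma>\<in>?P S. \<sigma> x = x}.
          symf_scale (of_nat (falling_fact (card (?fix S \<sigma>) - 1) d)) (orbit_power_sum S \<sigma>))"
    by (rule sum.swap_restrict [OF finP Suc.prems(1)])
  also have "\<dots> = (\<Sum>x\<in>S. \<Sum>\<sigma>\<in>?P (S - {x}). symf_h 1 * ?t (S - {x}) \<sigma>)"
  proof (rule sum.cong [OF refl])
    fix x assume x: "x \<in> S"
    have *: "{\<sigma>\<in>?P S. \<sigma> x = x} = ?P (S - {x})"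
      using permutes_fixing [OF x] by simp
    show "(\<Sum>\<sigma>\<in>{\<sigma>\<in>?P S. \<sigma> x = x}.
          symf_scale (of_nat (falling_fact (card (?fix S \<sigma>) - 1) d)) (orbit_power_sum S \<sigma>))
        = (\<Sum>\<sigma>\<in>?P (S - {x}). symf_h 1 * ?t (S - {x}) \<sigma>)"
      unfolding * by (intro sum.cong refl step x)
  qed
  also have "\<dots> = (\<Sum>x\<in>S. symf_scale (of_nat (fact (card S - 1)))
      (symf_h (card S - Suc d) * symf_h 1 ^ Suc d))"
  proof (intro sum.cong refl)
    fix x assume x: "x \<in> S"
    have card: "card (S - {x}) = card S - 1"
      using x Suc.prems(1) by simp
    have *: "(\<Sum>\<sigma>\<in>?P (S - {x}). ?t (S - {x}) \<sigma>)
        = symf_scale (of_nat (fact (card S - 1))) (symf_h (card S - Suc d) * symf_h 1 ^ d)"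
      using Suc.IH [of "S - {x}"] Suc.prems card by simp
    show "(\<Sum>\<sigma>\<in>?P (S - {x}). symf_h 1 * ?t (S - {x}) \<sigma>)
        = symf_scale (of_nat (fact (card S - 1))) (symf_h (card S - Suc d) * symf_h 1 ^ Suc d)"
      unfolding sum_distrib_left [symmetric] * by (simp only: symf_scale_mult power_Suc mult_ac)
  qed
  also have "\<dots> = symf_scale (of_nat (card S * fact (card S - 1))) (symf_h (card S - Suc d) * symf_h 1 ^ Suc d)"
    by (simp add: symf.sum_constant_scale del: sum_constant)
  also have "card S * fact (card S - 1) = fact (card S)"
    using pos by (simp add: fact_reduce)
  finally show ?case .
qed

section \<open>Power sums as a basis, and the plethysm\<close>

text \<open>The partition formed by the exponents of the monomial; it labels the orbit of the
  monomial under permutation of the variables.\<close>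

definition mset_type :: "nat multiset \<Rightarrow> nat multiset" where
  "mset_type m = image_mset (count m) (mset_set (set_mset m))"

lemma size_mset_type [simp]: "size (mset_type m) = card (set_mset m)"
  by (simp add: mset_type_def)

lemma mset_type_add:
  assumes "i \<notin># m" "k > 0"
  shows "mset_type (m + replicate_mset k i) = add_mset k (mset_type m)"
proof -
  have "set_mset (m + replicate_mset k i) = insert i (set_mset m)"
    using assms(2) by auto
  moreover have "image_mset (count (m + replicate_mset k i)) (mset_set (set_mset m))
      = image_mset (count m) (mset_set (set_mset m))"
    using assms(1) by (intro image_mset_cong) auto
  ultimately show ?thesis
    using assms(1) by (simp add: mset_type_def not_in_iff)
qed

lemma mset_type_surj:
  "\<forall>k\<in>#l. k > 0 \<Longrightarrow> \<exists>m. mset_type m = l"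
proof (induction l)
  case empty
  show ?case
    by (rule exI [of _ "{#}"]) (simp add: mset_type_def)
next
  case (add k l)
  then obtain m where m: "mset_type m = l"
    by auto
  obtain i where "i \<notin># m"
    using ex_new_if_finite [of "set_mset m"] by auto
  then have "mset_type (m + replicate_mset k i) = add_mset k l"
    using m add.prems by (simp add: mset_type_add)
  then show ?case ..
qed

lemma mset_type_pos: "k \<in># mset_type m \<Longrightarrow> k > 0"
  by (auto simp: mset_type_def)

lemma count_image_mset_inj: "inj f \<Longrightarrow> count (image_mset f m) (f x) = count m x"
  by (induction m) (auto simp: inj_eq)

text \<open>Padding both types with zeros over the union of the supports gives equal multiset images
  of one finite set, and these yield a permutation of that set.\<close>

lemma mset_type_eq_imp_permute:
  assumes "mset_type m = mset_type m'"
  obtains \<pi> where "bij \<pi>" "m' = image_mset \<pi> m"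
proof -
  let ?U = "set_mset m \<union> set_mset m'"
  have ext: "image_mset (count m) (mset_set ?U)
      = mset_type m + replicate_mset (card ?U - card (set_mset m)) 0"
    if "set_mset m \<subseteq> ?U" for m
  proof -
    have U: "mset_set ?U = mset_set (set_mset m) + mset_set (?U - set_mset m)"
      using that by (metis Diff_disjoint Un_Diff_cancel finite_Diff finite_UnI finite_set_mset
          mset_set_Union sup.absorb2)
    have "image_mset (count m) (mset_set (?U - set_mset m))
        = image_mset (\<lambda>_. 0) (mset_set (?U - set_mset m))"
      by (intro image_mset_cong) (auto simp: not_in_iff)
    also have "\<dots> = replicate_mset (card ?U - card (set_mset m)) 0"
      using that by (simp add: image_mset_const_eq card_Diff_subset)
    finally show ?thesis
      by (subst U) (simp add: mset_type_def)
  qed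
  have "card (set_mset m) = card (set_mset m')"
    using assms by (metis size_mset_type)
  then have "image_mset (count m) (mset_set ?U) = image_mset (count m') (mset_set ?U)"
    using ext [of m] ext [of m'] assms by simp
  then obtain \<pi> where \<pi>: "\<pi> permutes ?U" "\<forall>x\<in>?U. count m x = count m' (\<pi> x)"
    using image_mset_eq_implies_permutes [of ?U] by (metis finite_UnI finite_set_mset)
  have "count m' y = count (image_mset \<pi> m) y" for y
  proof -
    have "count (image_mset \<pi> m) (\<pi> x) = count m x" for x
      using permutes_inj [OF \<pi>(1)] by (rule count_image_mset_inj)
    then have "count (image_mset \<pi> m) y = count m (inv \<pi> y)"
      by (metis \<pi>(1) permutes_inverses(1))
    also have "\<dots> = count m' y"
    proof (cases "y \<in> ?U")
      case True
      then have "inv \<pi> y \<in> ?U"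
        using permutes_in_image [OF permutes_inv [OF \<pi>(1)]] by blast
      with \<pi> show ?thesis
        by (metis permutes_inverses(1))
    next
      case False
      then have "inv \<pi> y = y"
        using permutes_not_in [OF permutes_inv [OF \<pi>(1)]] by blast
      with False show ?thesis
        by (simp add: not_in_iff)
    qed
    finally show ?thesis ..
  qed
  then show ?thesis
    using that [OF permutes_bij [OF \<pi>(1)]] by (simp add: multiset_eq_iff)
qed

lemma symf_coeff_type_cong:
  assumes "mset_type m = mset_type m'"
  shows "symf_coeff f m = symf_coeff f m'"
proof -
  obtain \<pi> where "bij \<pi>" "m' = image_mset \<pi> m"
    using mset_type_eq_imp_permute [OF assms] .
  then show ?thesis
    using symf_coeff [of f] by auto
qed

lemma symf_p_mult_coeff:
  assumes "k > 0"
  shows "symf_coeff (symf_p k * f :: 'a::comm_ring_1 symf) m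
    = (\<Sum>i | k \<le> count m i. symf_coeff f (m - replicate_mset k i))"
proof -
  let ?I = "{i. k \<le> count m i}"
  let ?h = "\<lambda>i. (replicate_mset k i, m - replicate_mset k i)"
  have inj: "inj_on ?h ?I"
  proof (rule inj_onI)
    fix i j assume "?h i = ?h j"
    then have "count (replicate_mset k i) i = count (replicate_mset k j) i"
      by simp
    with assms show "i = j"
      by (auto split: if_splits)
  qed
  have img: "?h ` ?I = {p \<in> {(a, b). a + b = m}. \<exists>i. fst p = replicate_mset k i}"
  proof (intro equalityI subsetI)
    fix p assume "p \<in> ?h ` ?I"
    then show "p \<in> {p \<in> {(a, b). a + b = m}. \<exists>i. fst p = replicate_mset k i}"
      by (auto simp: count_le_replicate_mset_subset_eq)
  next
    fix p assume "p \<in> {p \<in> {(a, b). a + b = m}. \<exists>i. fst p = replicate_mset k i}"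
    then obtain i b where "p = (replicate_mset k i, b)" "replicate_mset k i + b = m"
      by auto
    then show "p \<in> ?h ` ?I"
      by (intro image_eqI [of _ _ i]) auto
  qed
  have "symf_coeff (symf_p k * f) m = (\<Sum>p\<in>{(a, b). a + b = m}.
      if \<exists>i. fst p = replicate_mset k i then symf_coeff f (snd p) else 0)"
    by (auto simp: times_symf.rep_eq symf_p.rep_eq intro!: sum.cong)
  also have "\<dots> = (\<Sum>p\<in>?h ` ?I. symf_coeff f (snd p))"
    unfolding img using finite_mset_splits [of m] by (simp add: sum.If_cases Int_def)
  also have "\<dots> = (\<Sum>i\<in>?I. symf_coeff f (m - replicate_mset k i))"
    by (simp add: sum.reindex [OF inj])
  finally show ?thesis .
qed

definition power_sum_mset :: "nat multiset \<Rightarrow> 'a::comm_ring_1 symf" where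
  "power_sum_mset l = (\<Prod>k\<in>#l. symf_p k)"

text \<open>
  Triangularity: \<open>p\<^sub>l\<close> involves only monomials in at most \<open>size l\<close> variables, and those in exactly
  \<open>size l\<close> variables have exponents \<open>l\<close>.
\<close>

lemma power_sum_mset_coeff:
  assumes "\<forall>k\<in>#l. k > 0"
  shows "\<exists>c. (\<forall>m. symf_coeff (power_sum_mset l :: 'a::comm_ring_1 symf) m = of_nat (c m)) \<and>
    (\<forall>m. c m \<noteq> 0 \<longrightarrow> card (set_mset m) \<le> size l \<and> (card (set_mset m) = size l \<longrightarrow> mset_type m = l)) \<and>
    (\<forall>m. mset_type m = l \<longrightarrow> c m \<noteq> 0)"
  using assms
proof (induction l)
  case empty
  show ?case
    by (rule exI [of _ "\<lambda>m. if m = {#} then 1 else 0"])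
      (auto simp: power_sum_mset_def one_symf.rep_eq mset_type_def mset_set_empty_iff)
next
  case (add k l)
  then obtain c where c: "\<And>m. symf_coeff (power_sum_mset l :: 'a symf) m = of_nat (c m)"
    and c_le: "\<And>m. c m \<noteq> 0 \<Longrightarrow> card (set_mset m) \<le> size l"
    and c_eq: "\<And>m. c m \<noteq> 0 \<Longrightarrow> card (set_mset m) = size l \<Longrightarrow> mset_type m = l"
    and c_pos: "\<And>m. mset_type m = l \<Longrightarrow> c m \<noteq> 0"
    by auto
  have k: "k > 0"
    using add.prems by simp
  \<comment> \<open>Multiplication by \<open>symf_p k\<close> adds \<open>k\<close> to the exponent
    of one variable. As the values are natural numbers nothing cancels, so one nonzero term makes
    the sum nonzero.\<close>
  define c' where "c' m = (\<Sum>i | k \<le> count m i. c (m - replicate_mset k i))" for m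
  have fin: "finite {i. k \<le> count m i}" for m :: "nat multiset"
  proof (rule finite_subset)
    show "{i. k \<le> count m i} \<subseteq> set_mset m"
      using k by (auto intro: ccontr simp: not_in_iff)
  qed simp
  have "symf_coeff (power_sum_mset (add_mset k l) :: 'a symf) m = of_nat (c' m)" for m
  proof -
    have eq: "power_sum_mset (add_mset k l) = symf_p k * (power_sum_mset l :: 'a symf)"
      by (simp add: power_sum_mset_def)
    show ?thesis
      by (simp only: eq symf_p_mult_coeff [OF k] c c'_def of_nat_sum)
  qed
  moreover have "card (set_mset m) \<le> size (add_mset k l) \<and>
      (card (set_mset m) = size (add_mset k l) \<longrightarrow> mset_type m = add_mset k l)"
          if nz: "c' m \<noteq> 0" for m
  proof -
    from nz have "(\<Sum>i | k \<le> count m i. c (m - replicate_mset k i)) \<noteq> 0"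
      by (simp only: c'_def not_False_eq_True)
    then obtain i where "i \<in> {i. k \<le> count m i}" and i2: "c (m - replicate_mset k i) \<noteq> 0"
      by (rule sum.not_neutral_contains_not_neutral)
    then have i: "k \<le> count m i" "c (m - replicate_mset k i) \<noteq> 0"
      by simp_all
    define m' where "m' = m - replicate_mset k i"
    have m: "m = m' + replicate_mset k i"
      using i(1) by (simp add: m'_def count_le_replicate_mset_subset_eq)
    have set: "set_mset m = insert i (set_mset m')"
      using k by (auto simp: m)
    have le: "card (set_mset m') \<le> size l"
      using c_le i(2) by (simp add: m'_def)
    show ?thesis
    \<comment> \<open>If \<open>i\<close> already occurs, the number of variables does not grow
      while the size of the index does, so equality is impossible.\<close>
    proof (cases "i \<in># m'")
      case True
      with set le show ?thesis
        by (simp add: insert_absorb)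
    next
      case False
      then have "card (set_mset m) = Suc (card (set_mset m'))"
        by (simp add: set)
      with le show ?thesis
        using c_eq [of m'] i(2) mset_type_add [OF False k]
            by (simp add: m'_def [symmetric] m [symmetric])
    qed
  qed
  moreover have "c' m \<noteq> 0" if m: "mset_type m = add_mset k l" for m
  proof -
    have "k \<in># mset_type m"
      by (simp add: m)
    then obtain i where i: "i \<in># m" "count m i = k"
      by (auto simp: mset_type_def)
    define m' where "m' = m - replicate_mset k i"
    have m': "m = m' + replicate_mset k i"
      unfolding m'_def using i(2)
      by (intro subset_mset.diff_add [symmetric]) (simp flip: count_le_replicate_mset_subset_eq)
    have "i \<notin># m'"
      by (simp add: m'_def i(2) not_in_iff)
    then have "mset_type m' = l"
      using mset_type_add [OF _ k, of i m'] m by (simp add: m' [symmetric])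
    then have "c m' \<noteq> 0"
      by (rule c_pos)
    moreover have "i \<in> {i. k \<le> count m i}"
      by (simp add: i(2))
    ultimately show ?thesis
      unfolding c'_def sum_eq_0_iff [OF fin] m'_def by (meson bspec)
  qed
  ultimately show ?case
    by (intro exI [of _ c'] conjI allI impI) simp_all
qed

abbreviation pos_msets :: "nat multiset set" where
  "pos_msets \<equiv> {l. \<forall>k\<in>#l. k > 0}"

text \<open>Among the \<open>l\<close> with nonzero coefficient take \<open>l0\<close> of maximal
  size and a monomial \<open>m\<close> of type \<open>l0\<close>. Any such \<open>l\<close> whose
  power sum contains \<open>m\<close> has at least the size of \<open>l0\<close>, hence the same
  size, and triangularity gives \<open>l = l0\<close>.\<close>

lemma power_sum_mset_independent:
  fixes a :: "nat multiset \<Rightarrow> 'a::{idom, semiring_char_0}"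
  assumes T: "finite T" "T \<subseteq> pos_msets"
    and sum: "(\<Sum>l\<in>T. symf_scale (a l) (power_sum_mset l)) = 0" and l: "l \<in> T"
  shows "a l = 0"
proof (rule ccontr)
  assume "a l \<noteq> 0"
  define T' where "T' = {l\<in>T. a l \<noteq> 0}"
  have T': "finite T'" "T' \<noteq> {}"
    using T l \<open>a l \<noteq> 0\<close> by (auto simp: T'_def)
  have "Max (size ` T') \<in> size ` T'"
    using T' by simp
  then obtain l0 where l0_max: "Max (size ` T') = size l0" and "l0 \<in> T'"
    by (rule imageE)
  moreover have "size l \<le> size l0" if "l \<in> T'" for l
    unfolding l0_max [symmetric] using T'(1) that by simp
  ultimately have l0: "l0 \<in> T'" "\<And>l. l \<in> T' \<Longrightarrow> size l \<le> size l0"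
    by simp_all
  have l0T: "l0 \<in> T" "a l0 \<noteq> 0"
    using l0(1) by (auto simp: T'_def)
  then obtain m where m: "mset_type m = l0"
    using mset_type_surj T(2) by blast
  have zero: "a l * symf_coeff (power_sum_mset l) m = 0" if "l \<in> T" "l \<noteq> l0" for l
  proof (rule ccontr)
    assume nz: "a l * symf_coeff (power_sum_mset l) m \<noteq> 0"
    then have "l \<in> T'"
      using that by (auto simp: T'_def)
    then have "size l \<le> card (set_mset m)"
      using l0(2) m by (metis size_mset_type)
    moreover have "symf_coeff (power_sum_mset l :: 'a symf) m \<noteq> 0"
      using nz by auto
    ultimately have "mset_type m = l"
      using power_sum_mset_coeff [of l, where ?'a = 'a] that T(2)
      by (metis (no_types, lifting) le_antisym mem_Collect_eq of_nat_0 subsetD)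
    with m that show False
      by simp
  qed
  have "0 = symf_coeff (\<Sum>l\<in>T. symf_scale (a l) (power_sum_mset l)) m"
    by (simp add: sum zero_symf.rep_eq)
  also have "\<dots> = (\<Sum>l\<in>T. if l = l0 then a l * symf_coeff (power_sum_mset l) m else 0)"
    unfolding symf_coeff_sum symf_scale.rep_eq using zero by (intro sum.cong) auto
  also have "\<dots> = a l0 * symf_coeff (power_sum_mset l0) m"
    using T(1) l0T by simp
  finally have "symf_coeff (power_sum_mset l0 :: 'a symf) m = 0"
    using l0T by simp
  then show False
    using power_sum_mset_coeff [of l0, where ?'a = 'a] l0T(1) T(2) m
    by (metis (no_types, lifting) mem_Collect_eq of_nat_eq_0_iff subsetD)
qed

lemma finite_types: "finite {l. size l = r \<and> set_mset l \<subseteq> {..N::nat}}"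
proof -
  have "{l. size l = r \<and> set_mset l \<subseteq> {..N}} \<subseteq> mset ` {xs. set xs \<subseteq> {..N} \<and> length xs = r}"
  proof
    fix l assume "l \<in> {l. size l = r \<and> set_mset l \<subseteq> {..N}}"
    moreover obtain xs where "l = mset xs"
      by (metis ex_mset)
    ultimately show "l \<in> mset ` {xs. set xs \<subseteq> {..N} \<and> length xs = r}"
      by auto
  qed
  then show ?thesis
    by (rule finite_subset) (intro finite_imageI finite_lists_length_eq, simp)
qed

text \<open>Elimination from the top: the monomials with the most variables are removed by a
  combination of power sums whose remaining monomials have fewer variables. The process ends because
  the bounded degree also bounds the number of variables.\<close>

lemma symf_span_power_sums:
  fixes f :: "rat fps symf"
  shows "f \<in> symf.span (power_sum_mset ` pos_msets)"
proof -
  have *: "f \<in> symf.span (power_sum_mset ` pos_msets)"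
    if "\<And>m. r \<le> card (set_mset m) \<Longrightarrow> symf_coeff f m = 0" for r and f :: "rat fps symf"
    using that
  proof (induction r arbitrary: f)
    case 0
    then have "f = 0"
      by (intro symf_eqI) (simp add: zero_symf.rep_eq)
    then show ?case
      by (simp add: symf.span_zero)
  next
    case (Suc r)
    define M where "M = {m. symf_coeff f m \<noteq> 0 \<and> card (set_mset m) = r}"
    define T where "T = mset_type ` M"
    obtain N where N: "\<And>m. size m > N \<Longrightarrow> symf_coeff f m = 0"
      using symf_coeff [of f] by auto
    have "T \<subseteq> {l. size l = r \<and> set_mset l \<subseteq> {..N}}"
    proof
      fix l assume "l \<in> T"
      then obtain m where m: "l = mset_type m" "symf_coeff f m \<noteq> 0" "card (set_mset m) = r"
        by (auto simp: T_def M_def)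
      then have "size m \<le> N"
        using N not_less by blast
      then have "count m i \<le> N" for i
        using count_le_size [of m i] by linarith
      with m show "l \<in> {l. size l = r \<and> set_mset l \<subseteq> {..N}}"
        by (auto simp: mset_type_def)
    qed
    then have finT: "finite T"
      using finite_types finite_subset by blast
    have Tpos: "l \<in> pos_msets" if "l \<in> T" for l
      using that mset_type_pos by (auto simp: T_def)
    have "\<exists>a. \<forall>m. mset_type m = l \<longrightarrow> a * symf_coeff (power_sum_mset l) m = symf_coeff f m"
      if lT: "l \<in> T" for l
    proof -
      obtain c where c: "\<And>m. symf_coeff (power_sum_mset l :: rat fps symf) m = of_nat (c m)"
        "\<And>m. mset_type m = l \<Longrightarrow> c m \<noteq> 0"
        using power_sum_mset_coeff [of l, where ?'a = "rat fps"] Tpos [OF lT] by auto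
      obtain m0 where m0: "mset_type m0 = l"
        using lT by (auto simp: T_def)
      \<comment> \<open>The coefficient at \<open>m0\<close> is a positive integer, inverted here as
        a rational constant; all other monomials of type \<open>l\<close> follow by
        symmetry.\<close>
      have "symf_coeff f m0 * fps_const (1 / of_nat (c m0)) * symf_coeff (power_sum_mset l) m
          = symf_coeff f m" if "mset_type m = l" for m
      proof -
        have "symf_coeff (power_sum_mset l :: rat fps symf) m = symf_coeff (power_sum_mset l) m0"
          "symf_coeff f m = symf_coeff f m0"
          using that m0 by (auto intro: symf_coeff_type_cong)
        moreover have "fps_const (1 / of_nat (c m0)) * of_nat (c m0) = (1 :: rat fps)"
          using c(2) [OF m0] by (simp flip: fps_of_nat)
        ultimately show ?thesis
          by (simp add: c(1) mult.assoc)
      qed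
      then show ?thesis
        by blast
    qed
    then obtain a where a: "\<And>l m. l \<in> T \<Longrightarrow> mset_type m = l \<Longrightarrow>
        a l * symf_coeff (power_sum_mset l) m = symf_coeff f m"
      by metis
    define g where "g = (\<Sum>l\<in>T. symf_scale (a l) (power_sum_mset l))"
    have "symf_coeff (f - g) m = 0" if m: "r \<le> card (set_mset m)" for m
    proof -
      have zero: "symf_coeff (power_sum_mset l :: rat fps symf) m = 0" if "l \<in> T"
          "l \<noteq> mset_type m" for l
      proof (rule ccontr)
        assume nz: "symf_coeff (power_sum_mset l :: rat fps symf) m \<noteq> 0"
        have "size l = r"
          using that(1) by (auto simp: T_def M_def)
        with nz m that show False
          using power_sum_mset_coeff [of l, where ?'a = "rat fps"] Tpos [OF that(1)]
          by (metis (no_types, lifting) le_antisym mem_Collect_eq of_nat_0)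
      qed
      have "symf_coeff g m = (\<Sum>l\<in>T. if l = mset_type m then symf_coeff f m else 0)"
        unfolding g_def symf_coeff_sum symf_scale.rep_eq using zero a by (intro sum.cong) auto
      also have "\<dots> = (if mset_type m \<in> T then symf_coeff f m else 0)"
        using finT by simp
      also have "\<dots> = symf_coeff f m"
      proof (cases "card (set_mset m) = r")
        case True
        then show ?thesis
          by (auto simp: T_def M_def)
      next
        case False
        with m Suc.prems [of m] show ?thesis
          by simp
      qed
      finally show ?thesis
        unfolding minus_symf_def plus_symf.rep_eq uminus_symf.rep_eq by simp
    qed
    then have "f - g \<in> symf.span (power_sum_mset ` pos_msets)"
      by (rule Suc.IH)
    moreover have "g \<in> symf.span (power_sum_mset ` pos_msets)"
      unfolding g_def using Tpos by (intro symf.span_sum symf.span_scale symf.span_base imageI)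
    ultimately show ?case
      using symf.span_add by fastforce
  qed
  obtain N where N: "\<And>m. size m > N \<Longrightarrow> symf_coeff f m = 0"
    using symf_coeff [of f] by auto
  have card_le: "card (set_mset m) \<le> size m" for m :: "nat multiset"
    by (induction m) (auto simp: card_insert_if)
  have "symf_coeff f m = 0" if "Suc N \<le> card (set_mset m)" for m
  proof (rule N)
    from that have "N < card (set_mset m)"
      by simp
    also have "\<dots> \<le> size m"
      by (rule card_le)
    finally show "N < size m" .
  qed
  then show ?thesis
    by (rule *)
qed

lemma inj_power_sum_mset:
  "inj_on (power_sum_mset :: _ \<Rightarrow> 'a::{idom, semiring_char_0} symf) pos_msets"
proof (rule inj_onI, rule ccontr)
  fix l l' assume l: "l \<in> pos_msets" "l' \<in> pos_msets" "l \<noteq> l'"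
    and eq: "power_sum_mset l = (power_sum_mset l' :: 'a symf)"
  let ?a = "\<lambda>x. if x = l then 1 else - 1 :: 'a"
  have "?a l = 0"
  proof (rule power_sum_mset_independent [of "{l, l'}" ?a l])
    show "(\<Sum>x\<in>{l, l'}. symf_scale (?a x) (power_sum_mset x)) = 0"
      using l(3) eq by auto
  qed (use l in auto)
  then show False
    by simp
qed

lemma independent_power_sums:
  "symf.independent (power_sum_mset ` pos_msets :: 'a::{idom, semiring_char_0} symf set)"
  unfolding symf.independent_explicit_module
proof (intro allI impI)
  fix t and u :: "'a symf \<Rightarrow> 'a" and v
  assume t: "finite t" "t \<subseteq> power_sum_mset ` pos_msets" "(\<Sum>v\<in>t. symf_scale (u v) v) = 0" "v \<in> t"
  obtain T where T: "T \<subseteq> pos_msets" "finite T" "t = power_sum_mset ` T"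
    using finite_subset_image [OF t(1,2)] by blast
  obtain l where l: "l \<in> T" "v = power_sum_mset l"
    using t(4) T(3) by blast
  have "inj_on (power_sum_mset :: _ \<Rightarrow> 'a symf) T"
    using inj_power_sum_mset T(1) by (rule inj_on_subset)
  then have "(\<Sum>l\<in>T. symf_scale (u (power_sum_mset l)) (power_sum_mset l)) = 0"
    using t(3) by (simp add: T(3) sum.reindex)
  then show "u v = 0"
    using power_sum_mset_independent [of T "\<lambda>l. u (power_sum_mset l)" l] T l by simp
qed

lemma power_sum_mset_add: "power_sum_mset l * power_sum_mset l' = power_sum_mset (l + l')"
  by (simp add: power_sum_mset_def)

section \<open>Homomorphisms that scale the power sums\<close>

lemma alg_hom_zero:
  assumes "is_symf_alg_hom \<phi>"
  shows "\<phi> 0 = 0"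
proof -
  have "\<phi> (symf_scale 0 0) = symf_scale 0 (\<phi> 0)"
    using assms unfolding is_symf_alg_hom_def by blast
  then show ?thesis
    by simp
qed

lemma alg_hom_power_sum_mset:
  assumes \<phi>: "is_symf_alg_hom \<phi>" "\<And>k. k > 0 \<Longrightarrow> \<phi> (symf_p k) = symf_scale (w k) (symf_p k)"
  shows "l \<in> pos_msets \<Longrightarrow> \<phi> (power_sum_mset l) = symf_scale (\<Prod>k\<in>#l. w k) (power_sum_mset l)"
proof (induction l)
  case empty
  then show ?case
    using \<phi>(1) by (simp add: power_sum_mset_def is_symf_alg_hom_def)
next
  case (add k l)
  have "\<phi> (symf_p k * power_sum_mset l) = \<phi> (symf_p k) * \<phi> (power_sum_mset l)"
    using \<phi>(1) by (simp add: is_symf_alg_hom_def)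
  also have "\<phi> (symf_p k) = symf_scale (w k) (symf_p k)"
    using add.prems by (intro \<phi>(2)) simp
  also have "\<phi> (power_sum_mset l) = symf_scale (\<Prod>k\<in>#l. w k) (power_sum_mset l)"
    using add by simp
  finally show ?case
    by (simp add: power_sum_mset_def symf_scale_mult mult.commute [of "w k"])
qed

text \<open>The map is defined diagonally on the basis: the factor of
  \<open>power_sum_mset l\<close> is a product over \<open>l\<close>, hence multiplicative in
  \<open>l\<close>, and this makes the linear map a homomorphism.\<close>

lemma ex_symf_alg_hom:
  fixes w :: "nat \<Rightarrow> rat fps"
  shows "\<exists>\<phi>. is_symf_alg_hom \<phi> \<and> (\<forall>k>0. \<phi> (symf_p k) = symf_scale (w k) (symf_p k))"
proof -
  let ?B = "power_sum_mset ` pos_msets :: rat fps symf set"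
  let ?r = "symf.representation ?B"
  note indep = independent_power_sums [where ?'a = "rat fps"]
  note span = symf_span_power_sums
  \<comment> \<open>The basis is a set of symmetric functions, so the index \<open>l\<close> is
    recovered by inverting \<open>power_sum_mset\<close>, which is injective on
    \<open>pos_msets\<close>.\<close>
  define W where "W b = (\<Prod>k\<in>#inv_into pos_msets (power_sum_mset :: _ \<Rightarrow> rat fps symf) b. w k)" for b
  define \<phi> where "\<phi> f = (\<Sum>b | ?r f b \<noteq> 0. symf_scale (?r f b * W b) b)" for f
  have \<phi>_superset: "\<phi> f = (\<Sum>b\<in>K. symf_scale (?r f b * W b) b)"
    if "finite K" "{b. ?r f b \<noteq> 0} \<subseteq> K" for f K
    unfolding \<phi>_def using that by (intro sum.mono_neutral_left) auto
  have fin: "finite {b. ?r f b \<noteq> 0}" for f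
    by (rule symf.finite_representation)
  have add: "\<phi> (f + g) = \<phi> f + \<phi> g" for f g
  proof -
    let ?K = "{b. ?r f b \<noteq> 0} \<union> {b. ?r g b \<noteq> 0}"
    have r: "?r (f + g) = (\<lambda>b. ?r f b + ?r g b)"
      by (rule symf.representation_add [OF indep span span])
    have K: "finite ?K"
      using fin by blast
    have "{b. ?r (f + g) b \<noteq> 0} \<subseteq> ?K"
      unfolding r by auto
    then have "\<phi> (f + g) = (\<Sum>b\<in>?K. symf_scale (?r (f + g) b * W b) b)"
      by (rule \<phi>_superset [OF K])
    also have "\<dots> = (\<Sum>b\<in>?K. symf_scale (?r f b * W b) b) + (\<Sum>b\<in>?K. symf_scale (?r g b * W b) b)"
      by (simp only: r distrib_right symf.scale_left_distrib sum.distrib)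
    also have "(\<Sum>b\<in>?K. symf_scale (?r f b * W b) b) = \<phi> f"
      by (rule \<phi>_superset [OF K, symmetric]) blast
    also have "(\<Sum>b\<in>?K. symf_scale (?r g b * W b) b) = \<phi> g"
      by (rule \<phi>_superset [OF K, symmetric]) blast
    finally show ?thesis .
  qed
  have scale: "\<phi> (symf_scale c f) = symf_scale c (\<phi> f)" for c f
  proof -
    have r: "?r (symf_scale c f) = (\<lambda>b. c * ?r f b)"
      by (rule symf.representation_scale [OF indep span])
    have "\<phi> (symf_scale c f) = (\<Sum>b | ?r f b \<noteq> 0. symf_scale (?r (symf_scale c f) b * W b) b)"
      by (rule \<phi>_superset [OF fin]) (auto simp: r)
    also have "\<dots> = symf_scale c (\<phi> f)"
      by (simp add: r \<phi>_def symf.scale_sum_right mult.assoc)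
    finally show ?thesis .
  qed
  have basis: "\<phi> (power_sum_mset l) = symf_scale (\<Prod>k\<in>#l. w k) (power_sum_mset l)"
    if "l \<in> pos_msets" for l
  proof -
    have r: "?r (power_sum_mset l) = (\<lambda>b. if b = power_sum_mset l then 1 else 0)"
      using that by (intro symf.representation_basis [OF indep]) simp
    have "\<phi> (power_sum_mset l) = (\<Sum>b\<in>{power_sum_mset l}. symf_scale (?r (power_sum_mset l) b * W b) b)"
      by (rule \<phi>_superset) (auto simp: r)
    moreover have "W (power_sum_mset l) = (\<Prod>k\<in>#l. w k)"
      by (simp only: W_def inv_into_f_f [OF inj_power_sum_mset that])
    ultimately show ?thesis
      by (simp add: r)
  qed
  have mult_basis: "\<phi> (power_sum_mset l * g) = \<phi> (power_sum_mset l) * \<phi> g"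
    if l: "l \<in> pos_msets" for l g
    using span [of g]
  proof (induction rule: symf.span_induct_alt)
    case base
    have "\<phi> 0 = 0"
      using scale [of 0 0] by simp
    then show ?case
      by simp
  next
    case (step c b g)
    then obtain l' where l': "b = power_sum_mset l'" "l' \<in> pos_msets"
      by blast
    have "\<phi> (power_sum_mset l * b) = symf_scale (\<Prod>k\<in>#l + l'. w k) (power_sum_mset (l + l'))"
      unfolding l'(1) power_sum_mset_add using l l'(2) by (intro basis) auto
    also have "\<dots> = \<phi> (power_sum_mset l) * \<phi> b"
      unfolding l'(1) basis [OF l] basis [OF l'(2)] symf_scale_mult power_sum_mset_add
      by (simp add: mult.commute)
    finally show ?case
      using step.IH by (simp add: distrib_left symf_scale_mult add scale)
  qed
  have mult: "\<phi> (f * g) = \<phi> f * \<phi> g" for f g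
    using span [of f]
  proof (induction rule: symf.span_induct_alt)
    case base
    have "\<phi> 0 = 0"
      using scale [of 0 0] by simp
    then show ?case
      by simp
  next
    case (step c b f)
    then obtain l where l: "b = power_sum_mset l" "l \<in> pos_msets"
      by blast
    show ?case
      using step.IH mult_basis [OF l(2), of g]
          by (simp add: distrib_right symf_scale_mult add scale l(1))
  qed
  have "\<phi> 1 = 1"
    using basis [of "{#}"] by (simp add: power_sum_mset_def)
  moreover have "\<phi> (symf_p k) = symf_scale (w k) (symf_p k)" if "k > 0" for k
    using basis [of "{#k#}"] that by (simp add: power_sum_mset_def)
  ultimately show ?thesis
    unfolding is_symf_alg_hom_def using add mult scale by (intro exI [of _ \<phi>]) blast
qed

text \<open>Existence and uniqueness give access to the \<open>THE\<close> in the definition;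
  uniqueness holds since the values on power sums fix those on their products, which span.\<close>

lemma plethysm_1_minus_q:
  "is_symf_alg_hom plethysm_1_minus_q"
  "k > 0 \<Longrightarrow> plethysm_1_minus_q (symf_p k) = symf_scale (1 - fps_X ^ k) (symf_p k)"
proof -
  let ?H = "\<lambda>\<phi>. is_symf_alg_hom \<phi> \<and> (\<forall>k>0. \<phi> (symf_p k) = symf_scale (1 - fps_X ^ k :: rat fps) (symf_p k))"
  have "\<exists>!\<phi>. ?H \<phi>"
  proof (rule ex_ex1I)
    show "\<exists>\<phi>. ?H \<phi>"
      by (rule ex_symf_alg_hom)
    show "\<phi> = \<psi>" if "?H \<phi>" "?H \<psi>" for \<phi> \<psi>
    proof
      fix f
      have hom: "is_symf_alg_hom \<phi>" "is_symf_alg_hom \<psi>"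
        using that by auto
      show "\<phi> f = \<psi> f"
        using symf_span_power_sums [of f]
      proof (induction rule: symf.span_induct_alt)
        case base
        show ?case
          using hom by (simp add: alg_hom_zero)
      next
        case (step c b f)
        then obtain l where l: "b = power_sum_mset l" "l \<in> pos_msets"
          by blast
        have "\<phi> b = \<psi> b"
          using alg_hom_power_sum_mset [of \<phi> "\<lambda>k. 1 - fps_X ^ k" l]
            alg_hom_power_sum_mset [of \<psi> "\<lambda>k. 1 - fps_X ^ k" l] that l by simp
        with step.IH hom show ?case
          by (simp add: is_symf_alg_hom_def)
      qed
    qed
  qed
  then have H: "?H plethysm_1_minus_q"
    unfolding plethysm_1_minus_q_def by (rule theI')
  then show "is_symf_alg_hom plethysm_1_minus_q"
    by blast
  from H show "plethysm_1_minus_q (symf_p k) = symf_scale (1 - fps_X ^ k) (symf_p k)" if "k > 0"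
    using that by blast
qed

section \<open>Graded traces\<close>

lemma q_bracket_Suc: "q_bracket (Suc d) = q_bracket d * (1 - of_nat (Suc d) * fps_X)"
  by (simp add: q_bracket_def)

lemma q_bracket_nth_0: "fps_nth (q_bracket d) 0 = 1"
proof (induction d)
  case 0
  show ?case
    by (simp add: q_bracket_def)
next
  case (Suc d)
  then show ?case
    by (simp add: q_bracket_Suc del: of_nat_Suc)
qed

text \<open>Induction with \<open>1 - mq = (1 - (N+1)q) - (m - (N+1))q\<close>: in the new summand
  the first part cancels the old remainder and the second part leaves the new one.\<close>

lemma geometric_falling_fact_aux:
  "(1 - of_nat m * fps_X) * (\<Sum>d=0..N. of_nat (falling_fact m d) * (fps_X ^ d / q_bracket d))
    = 1 - of_nat (falling_fact m (Suc N)) * fps_X ^ Suc N * inverse (q_bracket N)"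
proof (induction N)
  case 0
  have "q_bracket 0 = 1"
    by (simp add: q_bracket_def)
  then show ?case
    by (simp add: falling_fact_def)
next
  case (Suc N)
  let ?a = "of_nat (falling_fact m (Suc N)) * fps_X ^ Suc N :: rat fps"
  let ?q = "inverse (q_bracket (Suc N))"
  \<comment> \<open>Truncated subtraction may be replaced by subtraction in the ring: whenever it
    truncates, the factor \<open>falling_fact m (Suc N)\<close> is already 0.\<close>
  have ff: "of_nat (falling_fact m (Suc (Suc N)))
      = of_nat (falling_fact m (Suc N)) * (of_nat m - of_nat (Suc N) :: rat fps)"
  proof (cases "Suc N \<le> m")
    case True
    then show ?thesis
      by (simp only: falling_fact_Suc [of m "Suc N"] of_nat_mult of_nat_diff)
  next
    case False
    then show ?thesis
      by (simp add: falling_fact_Suc [of m "Suc N"] falling_fact_eq_0)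
  qed
  have unit: "inverse (1 - of_nat (Suc N) * fps_X) * (1 - of_nat (Suc N) * fps_X) = (1 :: rat fps)"
    by (rule inverse_mult_eq_1) simp
  have inv: "inverse (q_bracket N) = ?q * (1 - of_nat (Suc N) * fps_X)"
    by (simp only: q_bracket_Suc fps_inverse_mult mult.assoc unit mult_1_right)
  have div: "fps_X ^ Suc N / q_bracket (Suc N) = fps_X ^ Suc N * ?q"
    by (rule fps_divide_unit) (simp add: q_bracket_nth_0)
  have "(1 - of_nat m * fps_X) * (\<Sum>d=0..Suc N. of_nat (falling_fact m d) * (fps_X ^ d / q_bracket d))
      = (1 - ?a * inverse (q_bracket N)) + (1 - of_nat m * fps_X) * (?a * ?q)"
    using Suc.IH by (simp only: sum.atLeast0_atMost_Suc distrib_left div mult.assoc)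
  also have "\<dots> = 1 - ?a * (of_nat m - of_nat (Suc N)) * fps_X * ?q"
    unfolding inv by (simp add: algebra_simps)
  also have "?a * (of_nat m - of_nat (Suc N)) * fps_X * ?q
      = of_nat (falling_fact m (Suc (Suc N))) * fps_X ^ Suc (Suc N) * ?q"
    unfolding ff by (simp only: power_Suc mult_ac)
  finally show ?case .
qed

text \<open>For \<open>m \<le> N\<close> the remainder contains the factor
  \<open>m - m\<close>.\<close>

lemma geometric_falling_fact:
  assumes "m \<le> N"
  shows "(\<Sum>d=0..N. of_nat (falling_fact m d) * (fps_X ^ d / q_bracket d))
      = inverse (1 - of_nat m * fps_X)"
proof -
  let ?s = "\<Sum>d=0..N. of_nat (falling_fact m d) * (fps_X ^ d / q_bracket d) :: rat fps"
  have "(1 - of_nat m * fps_X) * ?s = 1"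
    unfolding geometric_falling_fact_aux using assms by (simp add: falling_fact_eq_0 del: power_Suc)
  then show ?thesis
    by (metis fps_inverse_unique)
qed

lemma inverse_one_minus_of_nat_X_nth:
  "fps_nth (inverse (1 - of_nat m * fps_X :: rat fps)) k = of_nat (m ^ k)"
proof -
  have "(1 - of_nat m * fps_X) * Abs_fps (\<lambda>k. of_nat m ^ k) = (1 :: rat fps)"
  proof (rule fps_ext)
    fix j
    show "fps_nth ((1 - of_nat m * fps_X) * Abs_fps (\<lambda>k. of_nat m ^ k)) j
        = fps_nth (1 :: rat fps) j"
      by (cases j) (simp_all add: left_diff_distrib mult.assoc fps_of_nat [symmetric])
  qed
  then have "inverse (1 - of_nat m * fps_X) = Abs_fps (\<lambda>k. of_nat m ^ k :: rat)"
    by (rule fps_inverse_unique)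
  then show ?thesis
    by simp
qed

lemma inverse_one_minus_X_power_nth:
  assumes "k > 0"
  shows "fps_nth (inverse (1 - fps_X ^ k :: rat fps)) j = (if k dvd j then 1 else 0)"
proof -
  have "(1 - fps_X ^ k) * Abs_fps (\<lambda>j. if k dvd j then 1 else 0) = (1 :: rat fps)"
  proof (rule fps_ext)
    fix j
    show "fps_nth ((1 - fps_X ^ k) * Abs_fps (\<lambda>j. if k dvd j then 1 else 0)) j
        = fps_nth (1 :: rat fps) j"
      using assms by (auto simp: left_diff_distrib fps_X_power_mult_nth dvd_minus_self dest: dvd_imp_le)
  qed
  then have "inverse (1 - fps_X ^ k) = Abs_fps (\<lambda>j. if k dvd j then 1 else 0 :: rat)"
    by (rule fps_inverse_unique)
  then show ?thesis
    by simp
qed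

section \<open>The trace series of a permutation\<close>

text \<open>Multiplicities turn multisets on \<open>S\<close> into functions, and invariance into
  constancy along \<sigma>, so the count over orbits applies with the value itself as
  weight.\<close>

lemma card_invariant_msets:
  assumes \<sigma>: "\<sigma> permutes S" and S: "finite S"
  shows "card {g \<in> S \<rightarrow>\<^sub>E (UNIV :: nat set). (\<forall>x\<in>S. g (\<sigma> x) = g x) \<and> (\<Sum>x\<in>S. g x) = i}
    = card {m :: nat multiset. set_mset m \<subseteq> S \<and> size m = i \<and> image_mset \<sigma> m = m}"
    (is "card ?A = card ?B")
proof -
  define F where "F g = (\<Sum>x\<in>S. replicate_mset (g x) x)" for g :: "nat \<Rightarrow> nat"
  have count_F: "count (F g) y = (if y \<in> S then g y else 0)" for g y
    using S by (simp add: F_def count_sum)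
  have size: "size m = (\<Sum>x\<in>S. count m x)" if "set_mset m \<subseteq> S" for m
    unfolding size_multiset_overloaded_eq using that S
    by (intro sum.mono_neutral_left) (auto simp: not_in_iff)
  have set_F: "set_mset (F g) \<subseteq> S" for g
    using count_F [of g] by (metis count_eq_zero_iff subsetI)
  have inv: "image_mset \<sigma> m = m \<longleftrightarrow> (\<forall>x\<in>S. count m (\<sigma> x) = count m x)" if "set_mset m \<subseteq> S" for m
  proof
    assume "image_mset \<sigma> m = m"
    then show "\<forall>x\<in>S. count m (\<sigma> x) = count m x"
      using count_image_mset_inj [OF permutes_inj [OF \<sigma>], of m] by simp
  next
    assume *: "\<forall>x\<in>S. count m (\<sigma> x) = count m x"
    have "count (image_mset \<sigma> m) (\<sigma> x) = count m (\<sigma> x)" for x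
    proof -
      have "count (image_mset \<sigma> m) (\<sigma> x) = count m x"
        by (rule count_image_mset_inj [OF permutes_inj [OF \<sigma>]])
      also have "\<dots> = count m (\<sigma> x)"
        using * permutes_not_in [OF \<sigma>, of x] by (cases "x \<in> S") simp_all
      finally show ?thesis .
    qed
    then show "image_mset \<sigma> m = m"
      using permutes_inverses(1) [OF \<sigma>] by (metis multiset_eqI)
  qed
  have "bij_betw F ?A ?B"
  proof (rule bij_betw_byWitness [where f' = "\<lambda>m. restrict (count m) S"])
    show "\<forall>g\<in>?A. restrict (count (F g)) S = g"
      by (auto simp: fun_eq_iff count_F PiE_def extensional_def)
    show "\<forall>m\<in>?B. F (restrict (count m) S) = m"
      by (auto simp: multiset_eq_iff count_F not_in_iff)
    show "F ` ?A \<subseteq> ?B"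
    proof (rule image_subsetI)
      fix g assume g: "g \<in> ?A"
      have "size (F g) = i"
        using g by (simp add: size [OF set_F] count_F)
      moreover have "image_mset \<sigma> (F g) = F g"
        unfolding inv [OF set_F] using g permutes_in_image [OF \<sigma>] by (simp add: count_F)
      ultimately show "F g \<in> ?B"
        using set_F by simp
    qed
    show "(\<lambda>m. restrict (count m) S) ` ?B \<subseteq> ?A"
    proof (rule image_subsetI)
      fix m assume m: "m \<in> ?B"
      then have "\<forall>x\<in>S. count m (\<sigma> x) = count m x"
        using inv [of m] by blast
      with m show "restrict (count m) S \<in> ?A"
        using size [of m] permutes_in_image [OF \<sigma>] by simp
    qed
  qed
  then show ?thesis
    by (rule bij_betw_same_card)
qed

text \<open>The graded character of the symmetric algebra, 1/det(1 - q\<sigma>): a cycle of length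
  \<open>k\<close> carries one common multiplicity and so contributes multiples of \<open>k\<close>
  to the degree.\<close>

lemma orbit_geometric_nth:
  assumes \<sigma>: "\<sigma> permutes S" and S: "finite S"
  shows "fps_nth (\<Prod>C\<in>orbit \<sigma> ` S. inverse (1 - fps_X ^ card C) :: rat fps) i
    = of_nat (card {m :: nat multiset. set_mset m \<subseteq> S \<and> size m = i \<and> image_mset \<sigma> m = m})"
proof -
  have splits: "{(a, b). a + b = m} = (\<lambda>i. (i, m - i)) ` {0..m}" for m :: nat
    by force
  have fin: "finite {(a, b). a + b = (m :: nat)}" for m
    unfolding splits by simp
  have mult: "fps_nth (x * y) m = (\<Sum>(a, b) | a + b = m. fps_nth x a * fps_nth y b)"
    for x y :: "rat fps" and m
    unfolding splits by (subst sum.reindex) (auto simp: fps_mult_nth inj_on_def)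
  have P: "finite {v :: nat. (\<Sum>i<k. v) = m} \<and>
      fps_nth (inverse (1 - fps_X ^ k) :: rat fps) m = of_nat (card {v :: nat. (\<Sum>i<k. v) = m})"
    if "k > 0" for k m
  proof (cases "k dvd m")
    case True
    then have "{v. (\<Sum>i<k. v) = m} = {m div k}"
      using that by auto
    with True that show ?thesis
      by (simp add: inverse_one_minus_X_power_nth)
  next
    case False
    then have "{v. (\<Sum>i<k. v) = m} = {}"
      by auto
    with False that show ?thesis
      by (simp add: inverse_one_minus_X_power_nth)
  qed
  show ?thesis
    unfolding card_invariant_msets [OF \<sigma> S, symmetric]
    by (rule orbit_prod_coeff_card [where coef = fps_nth and w = "\<lambda>v. v", OF fin _ mult P \<sigma> S]) simp
qed

definition trace_series :: "nat \<Rightarrow> (nat \<Rightarrow> nat) \<Rightarrow> rat fps" where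
  "trace_series n \<sigma> = Abs_fps (\<lambda>k. nc_trace_on (nc_A'_part n k) (nc_act \<sigma>))"

text \<open>Grouped by \<open>size m\<close>, the block decomposition of the words is the Cauchy
  product of the series of invariant multisets with the unknown trace series; the first factor is a
  product of inverses and is multiplied away.\<close>

lemma trace_series_eq:
  assumes \<sigma>: "\<sigma> permutes {1..n}"
  shows "trace_series n \<sigma> = inverse (1 - of_nat (card {i\<in>{1..n}. \<sigma> i = i}) * fps_X)
    * (\<Prod>C\<in>orbit \<sigma> ` {1..n}. 1 - fps_X ^ card C)"
proof -
  let ?O = "orbit \<sigma> ` {1..n}"
  let ?M = "\<lambda>k. {m. set_mset m \<subseteq> {1..n} \<and> size m \<le> k \<and> image_mset \<sigma> m = m}"
  let ?g = "inverse (1 - of_nat (card {i\<in>{1..n}. \<sigma> i = i}) * fps_X) :: rat fps"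
  have finM: "finite (?M k)" for k
    by (rule finite_subset [OF _ finite_msets [of n k]]) auto
  have "(\<Prod>C\<in>?O. inverse (1 - fps_X ^ card C)) * trace_series n \<sigma> = ?g"
  proof (rule fps_ext)
    fix k
    have "fps_nth ((\<Prod>C\<in>?O. inverse (1 - fps_X ^ card C)) * trace_series n \<sigma>) k
        = (\<Sum>i=0..k. \<Sum>m | m \<in> ?M k \<and> size m = i. nc_trace_on (nc_A'_part n (k - size m)) (nc_act \<sigma>))"
      unfolding fps_mult_nth
    proof (rule sum.cong [OF refl])
      fix i assume "i \<in> {0..k}"
      then have *: "{m \<in> ?M k. size m = i} = {m. set_mset m \<subseteq> {1..n} \<and> size m = i \<and> image_mset \<sigma> m = m}"
        by auto
      have "(\<Sum>m | m \<in> ?M k \<and> size m = i. nc_trace_on (nc_A'_part n (k - size m)) (nc_act \<sigma>))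
          = (\<Sum>m | m \<in> ?M k \<and> size m = i. nc_trace_on (nc_A'_part n (k - i)) (nc_act \<sigma>))"
        by (rule sum.cong) auto
      also have "\<dots> = of_nat (card {m \<in> ?M k. size m = i}) * nc_trace_on (nc_A'_part n (k - i)) (nc_act \<sigma>)"
        by simp
      finally show "fps_nth (\<Prod>C\<in>?O. inverse (1 - fps_X ^ card C)) i * fps_nth (trace_series n \<sigma>) (k - i)
          = (\<Sum>m | m \<in> ?M k \<and> size m = i. nc_trace_on (nc_A'_part n (k - size m)) (nc_act \<sigma>))"
        unfolding orbit_geometric_nth [OF \<sigma> finite_atLeastAtMost] * by (simp add: trace_series_def)
    qed
    also have "\<dots> = (\<Sum>m\<in>?M k. nc_trace_on (nc_A'_part n (k - size m)) (nc_act \<sigma>))"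
      by (rule sum.group [OF finM]) auto
    also have "\<dots> = of_nat (card {i\<in>{1..n}. \<sigma> i = i} ^ k)"
      unfolding trace_words [OF \<sigma>, symmetric] trace_words_decompose [OF \<sigma>] ..
    finally show "fps_nth ((\<Prod>C\<in>?O. inverse (1 - fps_X ^ card C)) * trace_series n \<sigma>) k
        = fps_nth ?g k"
      by (simp only: inverse_one_minus_of_nat_X_nth)
  qed
  then have "?g * (\<Prod>C\<in>?O. 1 - fps_X ^ card C)
      = (\<Prod>C\<in>?O. (1 - fps_X ^ card C) * inverse (1 - fps_X ^ card C)) * trace_series n \<sigma>"
    by (simp add: prod.distrib mult_ac)
  also have "(\<Prod>C\<in>?O. (1 - fps_X ^ card C) * inverse (1 - fps_X ^ card C)) = (1 :: rat fps)"
  proof (rule prod.neutral, rule ballI)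
    fix C assume C: "C \<in> ?O"
    then have "finite C"
      using permutes_orbit_subset [OF \<sigma>] finite_subset by blast
    moreover have "C \<noteq> {}"
      using C orbit_nonempty [of \<sigma>] by auto
    ultimately have "card C > 0"
      by (simp add: card_gt_0_iff)
    then show "(1 - fps_X ^ card C) * inverse (1 - fps_X ^ card C) = (1 :: rat fps)"
      by (intro inverse_mult_eq_1') simp
  qed
  finally show ?thesis
    by simp
qed

section \<open>Assembling the formula\<close>

lemma alg_hom_sum:
  assumes "is_symf_alg_hom \<phi>"
  shows "\<phi> (sum f A) = (\<Sum>x\<in>A. \<phi> (f x))"
  using assms by (induction A rule: infinite_finite_induct) (auto simp: alg_hom_zero is_symf_alg_hom_def)

lemma plethysm_orbit_power_sum:
  assumes \<sigma>: "\<sigma> permutes S" and S: "finite S"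
  shows "plethysm_1_minus_q (orbit_power_sum S \<sigma>)
    = symf_scale (\<Prod>C\<in>orbit \<sigma> ` S. 1 - fps_X ^ card C) (orbit_power_sum S \<sigma>)"
proof -
  have hom: "plethysm_1_minus_q 1 = 1"
    "plethysm_1_minus_q (f * g) = plethysm_1_minus_q f * plethysm_1_minus_q g" for f g
    using plethysm_1_minus_q(1) by (auto simp: is_symf_alg_hom_def)
  have "plethysm_1_minus_q (\<Prod>C\<in>A. symf_p (card C))
      = symf_scale (\<Prod>C\<in>A. 1 - fps_X ^ card C) (\<Prod>C\<in>A. symf_p (card C))"
    if "finite A" "\<forall>C\<in>A. card C > 0" for A :: "nat set set"
    using that
  proof (induction A rule: finite_induct)
    case (insert C A)
    then show ?case
      by (simp add: hom plethysm_1_minus_q(2) symf_scale_mult mult.commute)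
  qed (simp add: hom)
  moreover have "\<forall>C\<in>orbit \<sigma> ` S. card C > 0"
  proof
    fix C assume C: "C \<in> orbit \<sigma> ` S"
    then have "finite C"
      using permutes_orbit_subset [OF \<sigma>] finite_subset S by blast
    moreover have "C \<noteq> {}"
      using C orbit_nonempty [of \<sigma>] by auto
    ultimately show "card C > 0"
      by (simp add: card_gt_0_iff)
  qed
  ultimately show ?thesis
    using S by (simp add: orbit_power_sum_def)
qed

lemma cycle_power_sum_eq: "cycle_power_sum n \<sigma> = orbit_power_sum {1..n} \<sigma>"
  by (simp add: cycle_power_sum_def orbit_power_sum_def)

text \<open>In the expansion with falling factorial weights the plethysm scales every term
  separately; the factorial is cleared by a rational constant.\<close>

lemma plethysm_h:
  assumes "d \<le> n"
  shows "plethysm_1_minus_q (symf_h (n - d) * symf_h 1 ^ d) = (\<Sum>\<sigma> | \<sigma> permutes {1..n}.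
    symf_scale (fps_const (1 / fact n) * of_nat (falling_fact (card {i\<in>{1..n}. \<sigma> i = i}) d)
      * (\<Prod>C\<in>orbit \<sigma> ` {1..n}. 1 - fps_X ^ card C)) (orbit_power_sum {1..n} \<sigma>))"
proof -
  let ?t = "\<lambda>\<sigma>. of_nat (falling_fact (card {i\<in>{1..n}. \<sigma> i = i}) d) :: rat fps"
  let ?c = "fps_const (1 / fact n) :: rat fps"
  have c: "?c * of_nat (fact n) = 1"
    by (simp flip: fps_of_nat)
  have scale: "plethysm_1_minus_q (symf_scale a f) = symf_scale a (plethysm_1_minus_q f)" for a f
    using plethysm_1_minus_q(1) by (auto simp: is_symf_alg_hom_def)
  have "symf_h (n - d) * symf_h 1 ^ d
      = symf_scale ?c (symf_scale (of_nat (fact n)) (symf_h (n - d) * symf_h 1 ^ d))"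
    by (simp only: symf.scale_scale c symf.scale_one)
  also have "\<dots> = symf_scale ?c (\<Sum>\<sigma> | \<sigma> permutes {1..n}. symf_scale (?t \<sigma>) (orbit_power_sum {1..n} \<sigma>))"
    using sum_falling_fact_orbit_power_sum [of "{1..n}" d, where ?'a = "rat fps"] assms by simp
  finally have "plethysm_1_minus_q (symf_h (n - d) * symf_h 1 ^ d)
      = symf_scale ?c (\<Sum>\<sigma> | \<sigma> permutes {1..n}. symf_scale (?t \<sigma>) (plethysm_1_minus_q (orbit_power_sum {1..n} \<sigma>)))"
    by (simp only: scale alg_hom_sum [OF plethysm_1_minus_q(1)])
  also have "\<dots> = (\<Sum>\<sigma> | \<sigma> permutes {1..n}. symf_scale (?c * ?t \<sigma>
      * (\<Prod>C\<in>orbit \<sigma> ` {1..n}. 1 - fps_X ^ card C)) (orbit_power_sum {1..n} \<sigma>))"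
    unfolding symf.scale_sum_right
    by (rule sum.cong [OF refl]) (simp add: plethysm_orbit_power_sum mult.assoc)
  finally show ?thesis .
qed

theorem theorem3p4:
  fixes n :: nat
  assumes "n \<ge> 1"
  shows "nc_graded_frob n (nc_A' n) =
    (\<Sum>d=0..n. symf_scale (fps_X ^ d / q_bracket d)
       (plethysm_1_minus_q (symf_h (n - d) * symf_h 1 ^ d)))"
proof -
  let ?P = "{\<sigma>. \<sigma> permutes {1..n}}"
  let ?fix = "\<lambda>\<sigma>. card {i\<in>{1..n}. \<sigma> i = i}"
  let ?w = "\<lambda>\<sigma>. \<Prod>C\<in>orbit \<sigma> ` {1..n}. 1 - fps_X ^ card C :: rat fps"
  let ?c = "fps_const (1 / fact n) :: rat fps"
  have "(\<Sum>d=0..n. symf_scale (fps_X ^ d / q_bracket d) (plethysm_1_minus_q (symf_h (n - d) * symf_h 1 ^ d)))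
      = (\<Sum>d=0..n. \<Sum>\<sigma>\<in>?P. symf_scale (?c * (of_nat (falling_fact (?fix \<sigma>) d) * (fps_X ^ d / q_bracket d)) * ?w \<sigma>)
          (orbit_power_sum {1..n} \<sigma>))"
  proof (rule sum.cong [OF refl])
    fix d assume "d \<in> {0..n}"
    then have "d \<le> n"
      by simp
    show "symf_scale (fps_X ^ d / q_bracket d) (plethysm_1_minus_q (symf_h (n - d) * symf_h 1 ^ d))
      = (\<Sum>\<sigma>\<in>?P. symf_scale (?c * (of_nat (falling_fact (?fix \<sigma>) d) * (fps_X ^ d / q_bracket d)) * ?w \<sigma>)
          (orbit_power_sum {1..n} \<sigma>))"
      unfolding plethysm_h [OF \<open>d \<le> n\<close>] symf.scale_sum_right symf.scale_scale
      by (simp only: mult_ac)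
  qed
  \<comment> \<open>With \<sigma> outside, the inner sum over \<open>d\<close> is the expansion of
    1/(1 - q fix(\<sigma>)).\<close>
  also have "\<dots> = (\<Sum>\<sigma>\<in>?P. \<Sum>d=0..n. symf_scale (?c * (of_nat (falling_fact (?fix \<sigma>) d) * (fps_X ^ d / q_bracket d)) * ?w \<sigma>)
          (orbit_power_sum {1..n} \<sigma>))"
    by (rule sum.swap)
  also have "\<dots> = (\<Sum>\<sigma>\<in>?P. symf_scale (?c * trace_series n \<sigma>) (orbit_power_sum {1..n} \<sigma>))"
  proof (rule sum.cong [OF refl])
    fix \<sigma> assume "\<sigma> \<in> ?P"
    then have \<sigma>: "\<sigma> permutes {1..n}"
      by simp
    \<comment> \<open>This bound is what lets the sum over \<open>d\<close> end at
      \<open>n\<close>.\<close>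
    have "card {i\<in>{1..n}. \<sigma> i = i} \<le> card {1..n}"
      by (rule card_mono) auto
    then have le: "?fix \<sigma> \<le> n"
      by simp
    show "(\<Sum>d=0..n. symf_scale (?c * (of_nat (falling_fact (?fix \<sigma>) d) * (fps_X ^ d / q_bracket d)) * ?w \<sigma>)
          (orbit_power_sum {1..n} \<sigma>)) = symf_scale (?c * trace_series n \<sigma>) (orbit_power_sum {1..n} \<sigma>)"
      unfolding symf.scale_sum_left [symmetric] sum_distrib_right [symmetric] sum_distrib_left [symmetric]
        geometric_falling_fact [OF le] trace_series_eq [OF \<sigma>]
      by (simp only: mult.assoc)
  qed
  also have "\<dots> = nc_graded_frob n (nc_A' n)"
  proof (rule symf_eqI, rule fps_ext)
    fix m k
    \<comment> \<open>The two power sums live over different coefficient rings; both coefficients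
      are the same natural number, so the comparison can be made degree by degree in q.\<close>
    have coeff: "symf_coeff (orbit_power_sum {1..n} \<sigma> :: rat fps symf) m
        = fps_const (symf_coeff (orbit_power_sum {1..n} \<sigma>) m)" if "\<sigma> \<in> ?P" for \<sigma>
      using that by (simp add: orbit_power_sum_coeff fps_of_nat)
    have "fps_nth (symf_coeff (\<Sum>\<sigma>\<in>?P. symf_scale (?c * trace_series n \<sigma>) (orbit_power_sum {1..n} \<sigma>)) m) k
        = (\<Sum>\<sigma>\<in>?P. 1 / fact n * nc_trace_on (nc_A'_part n k) (nc_act \<sigma>) * symf_coeff (orbit_power_sum {1..n} \<sigma>) m)"
      unfolding symf_coeff_sum symf_scale.rep_eq fps_sum_nth
      by (rule sum.cong [OF refl]) (simp only: coeff, simp add: trace_series_def mult.assoc)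
    also have "\<dots> = fps_nth (symf_coeff (nc_graded_frob n (nc_A' n)) m) k"
      unfolding nc_graded_frob_coeff nc_frob_def cycle_power_sum_eq symf_scale.rep_eq symf_coeff_sum
      by (simp only: sum_distrib_left mult.assoc)
    finally show "fps_nth (symf_coeff (\<Sum>\<sigma>\<in>?P. symf_scale (?c * trace_series n \<sigma>) (orbit_power_sum {1..n} \<sigma>)) m) k
        = fps_nth (symf_coeff (nc_graded_frob n (nc_A' n)) m) k" .
  qed
  finally show ?thesis ..
qed

end
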